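(* Let $*:\hat S\to\widehat{{}^*S}$ be an enlargement, let $R$ be a ring whose underlying set is an element of $\hat S$, let $(R\text{-}\mathrm{Mod})$ be the category of $R$-modules, let $\mathcal A$ be an $\hat S$-small abelian category, let $F:\mathcal A\to(R\text{-}\mathrm{Mod})$ be an exact, fully faithful functor, and assume that there exists an object $\mathfrak R$ of $\mathcal A$ such that there is an isomorphism $\psi:F\mathfrak R\to R$ of $R$-modules. Then: (i) Let $(R\text{-}\mathrm{Mod})(S)$ denote the full subcategory of $(R\text{-}\mathrm{Mod})$ consisting of $R$-modules whose underlying set is an element of $\hat S$. For every $A\in\mathrm{Ob}(\mathcal A)$, the set $\mathrm{Mor}_{\mathcal A}(\mathfrak R,A)$ carries an $R$-module structure induced by $F$ and $\psi$, and this defines an exact, fully faithful functor $G=\mathrm{Mor}_{\mathcal A}(\mathfrak R,\_)$ from $\mathcal A$ to $(R\text{-}\mathrm{Mod})$ which is isomorphic to $F$ and which factorizes over $(R\text{-}\mathrm{Mod})(S)$. (ii) For every $A\in\mathrm{Ob}({}^*\mathcal A)$, the set $\mathrm{Mor}_{{}^*\mathcal A}({}^*\mathfrak R,A)$ carries an ${}^*R$-module structure induced by ${}^*G$, and this defines an exact, faithful functor $\tilde G=\mathrm{Mor}_{{}^*\mathcal A}({}^*\mathfrak R,\_)$ from ${}^*\mathcal A$ to $({}^*R\text{-}\mathrm{Mod})$. Furthermore, for an object $M$ of $(R\text{-}\mathrm{Mod})(S)$ there is a canonical ${}^*R$-module structure on the set ${}^*M$, giving a functor $*:(R\text{-}\mathrm{Mod})(S)\to({}^*R\text{-}\mathrm{Mod})$,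 and the functors $*\circ G$ and $\tilde G\circ *$ from $\mathcal A$ to $({}^*R\text{-}\mathrm{Mod})$ are equal. This means that if $\mathcal A$ is identified with an abelian subcategory of $(R\text{-}\mathrm{Mod})$ via $G$, then ${}^*\mathcal A$ can be identified with an abelian subcategory of $({}^*R\text{-}\mathrm{Mod})$ by identifying an object $A$ of ${}^*\mathcal A$ with the ${}^*R$-module $\mathrm{Mor}_{{}^*\mathcal A}({}^*\mathfrak R,A)$; then for every $R$-module $M$ that is an object of $\mathcal A$, the object ${}^*M$ of ${}^*\mathcal A$ is just the ${}^*R$-module ${}^*M$. (iii) Let $({}^*\mathcal A)^{\mathrm{fin}}$ denote the full subcategory of ${}^*\mathcal A$ consisting of objects $A$ such that $\tilde GA$ is finite (as a set). Then $({}^*\mathcal A)^{\mathrm{fin}}$ is a Serre subcategory, i.e. it is closed with respect to subobjects, quotients and extensions.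
   Context: Superstructures: a base set $S$ is an infinite set whose elements are not sets; $S_0=S$, $S_n=S_{n-1}\cup\mathcal P(S_{n-1})$, and $\hat S=\bigcup_{n\ge 0}S_n$. Formulas in $\hat S$ are built from $=$, $\in$, constants in $\hat S$, variables, ordered pairs and function application by $\neg$, $\wedge$ and bounded quantifiers $\forall x\in t$; statements are formulas without free variables. For $\varphi$ a formula in $\hat S$, ${}^*\varphi$ is obtained by replacing each constant $\tau$ by ${}^*\tau$. Enlargement: a map $*:\hat S\to\hat W$ between superstructures with (1) ${}^*S=W$; (2) ${}^*s=s$ for $s\in S$; (3) (transfer) a statement $\varphi$ in $\hat S$ is true iff ${}^*\varphi$ is true; (4) (saturation) with $\mathcal I=\bigcup_{A\in\hat S\setminus S}{}^*A$ (the internal elements), every nonempty family $\{U_i\}_{i\in I}$ of nonempty sets $U_i\in\mathcal I$ with $|I|\le|\hat S|$ and the finite intersection property has nonempty intersection. $\hat S$-small category: a category $\mathcal A=\langle M,s,t,c\rangle$ given by its set of morphisms $M\in\hat S\setminus S$, the maps $s,t:M\to M$ sending a morphism to the identity of its source resp. target, and the composition relation $c$; objects are identified with their identity morphisms. An additive (abelian) $\hat S$-small category is such a category which is additive (abelian) in the usual sense, together with the relation $P\subseteq M^3$ recording addition of morphisms. Its enlargement ${}^*\mathcal A=\langle{}^*M,{}^*s,{}^*t,{}^*c\rangle$ with ${}^*P$ is again additive (abelian), and $*$ induces a functor $*:\mathcal A\to{}^*\mathcal A$. Module structures: the $R$-module structure on $GA=\mathrm{Mor}_{\mathcal A}(\mathfrak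 R,A)$ is transported along the bijections $\mathrm{Mor}_{\mathcal A}(\mathfrak R,A)\xrightarrow{F}\mathrm{Hom}_R(F\mathfrak R,FA)\cong\mathrm{Hom}_R(R,FA)\cong FA$, the middle one being induced by $\psi$. The addition and scalar multiplication maps $GA\times GA\to GA$, $R\times GA\to GA$ form families (over $A\in\mathrm{Ob}(\mathcal A)$) which are elements of $\hat S$; applying $*$ to these families gives the ${}^*R$-module structures on $\mathrm{Mor}_{{}^*\mathcal A}({}^*\mathfrak R,A)$ for $A\in\mathrm{Ob}({}^*\mathcal A)$. Likewise ${}^*R$ is a ring, and ${}^*M$ carries the $*$-image of the $R$-module structure of $M$. *)

theory Defs
  imports "HOL-Algebra.Module" "HOL-Library.Equipollence"
begin

section \<open>An ambient universe of sets and atoms\<close>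

text \<open>
  Superstructures are unions of countably many iterated power sets, which HOL cannot construct
  uniformly over a given type. They are therefore carved out of an arbitrary type whose elements
  behave as sets and atoms of Zermelo set theory. Separation is second order, so the power sets
  below are full power sets.
\<close>

class set_universe =
  fixes is_set :: "'a \<Rightarrow> bool"
    and elems :: "'a \<Rightarrow> 'a set"
  assumes elems_atom: "\<not> is_set x \<Longrightarrow> elems x = {}"
    and extensionality: "is_set x \<Longrightarrow> is_set y \<Longrightarrow> elems x = elems y \<Longrightarrow> x = y"
    and pairing: "\<exists>z. is_set z \<and> elems z = {x, y}"
    and separation: "is_set x \<Longrightarrow> A \<subseteq> elems x \<Longrightarrow> \<exists>y. is_set y \<and> elems y = A"
    and power_set: "is_set x \<Longrightarrow> \<exists>y. is_set y \<and> elems y = {z. is_set z \<and> elems z \<subseteq> elems x}"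
    and binary_union: "is_set x \<Longrightarrow> is_set y \<Longrightarrow> \<exists>z. is_set z \<and> elems z = elems x \<union> elems y"

definition mkset :: "'u::set_universe set \<Rightarrow> 'u" where
  "mkset A = (THE x. is_set x \<and> elems x = A)"

text \<open>Kuratowski pairs; triples are left-nested.\<close>

definition opair :: "'u::set_universe \<Rightarrow> 'u \<Rightarrow> 'u" where
  "opair a b = mkset {mkset {a}, mkset {a, b}}"

definition otriple :: "'u::set_universe \<Rightarrow> 'u \<Rightarrow> 'u \<Rightarrow> 'u" where
  "otriple a b c = opair (opair a b) c"

text \<open>Function application is total: where \<open>f\<close> has no unique value at \<open>x\<close>, it returns the empty set.\<close>

definition app :: "'u::set_universe \<Rightarrow> 'u \<Rightarrow> 'u" where
  "app f x = (if \<exists>!y. opair x y \<in> elems f then THE y. opair x y \<in> elems f else mkset {})"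

definition is_map :: "'u::set_universe \<Rightarrow> 'u set \<Rightarrow> 'u set \<Rightarrow> bool" where
  "is_map f X Y \<longleftrightarrow> is_set f \<and> (\<forall>p\<in>elems f. \<exists>x\<in>X. \<exists>y\<in>Y. p = opair x y) \<and>
     (\<forall>x\<in>X. \<exists>!y. opair x y \<in> elems f)"

definition graph1 :: "('u::set_universe \<Rightarrow> 'u) \<Rightarrow> 'u set \<Rightarrow> 'u" where
  "graph1 f X = mkset {opair x (f x) | x. x \<in> X}"

definition graph2 :: "('u::set_universe \<Rightarrow> 'u \<Rightarrow> 'u) \<Rightarrow> 'u set \<Rightarrow> 'u set \<Rightarrow> 'u" where
  "graph2 f X Y = mkset {opair (opair x y) (f x y) | x y. x \<in> X \<and> y \<in> Y}"


section \<open>Superstructures and enlargements\<close>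

definition base_set :: "'u::set_universe \<Rightarrow> bool" where
  "base_set S \<longleftrightarrow> is_set S \<and> infinite (elems S) \<and> (\<forall>s\<in>elems S. \<not> is_set s)"

primrec level :: "'u::set_universe \<Rightarrow> nat \<Rightarrow> 'u set" where
  "level S 0 = elems S"
| "level S (Suc n) = level S n \<union> {x. is_set x \<and> elems x \<subseteq> level S n}"

definition superstructure :: "'u::set_universe \<Rightarrow> 'u set" where
  "superstructure S = (\<Union>n. level S n)"

definition set_in_superstructure :: "'u::set_universe \<Rightarrow> 'u set \<Rightarrow> bool" where
  "set_in_superstructure S X \<longleftrightarrow> (\<exists>x\<in>superstructure S. is_set x \<and> elems x = X)"

datatype 'u trm = Var nat | Cst 'u | PairT "'u trm" "'u trm" | AppT "'u trm" "'u trm"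

datatype 'u formula =
    Equal "'u trm" "'u trm"
  | Member "'u trm" "'u trm"
  | Neg "'u formula"
  | And "'u formula" "'u formula"
  | BAll nat "'u trm" "'u formula"

primrec trm_vars :: "'u trm \<Rightarrow> nat set" where
  "trm_vars (Var i) = {i}"
| "trm_vars (Cst a) = {}"
| "trm_vars (PairT s t) = trm_vars s \<union> trm_vars t"
| "trm_vars (AppT s t) = trm_vars s \<union> trm_vars t"

primrec free_vars :: "'u formula \<Rightarrow> nat set" where
  "free_vars (Equal s t) = trm_vars s \<union> trm_vars t"
| "free_vars (Member s t) = trm_vars s \<union> trm_vars t"
| "free_vars (Neg p) = free_vars p"
| "free_vars (And p q) = free_vars p \<union> free_vars q"
| "free_vars (BAll i t p) = trm_vars t \<union> (free_vars p - {i})"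

primrec trm_val :: "(nat \<Rightarrow> 'u::set_universe) \<Rightarrow> 'u trm \<Rightarrow> 'u" where
  "trm_val v (Var i) = v i"
| "trm_val v (Cst a) = a"
| "trm_val v (PairT s t) = opair (trm_val v s) (trm_val v t)"
| "trm_val v (AppT s t) = app (trm_val v s) (trm_val v t)"

primrec sat :: "(nat \<Rightarrow> 'u::set_universe) \<Rightarrow> 'u formula \<Rightarrow> bool" where
  "sat v (Equal s t) \<longleftrightarrow> trm_val v s = trm_val v t"
| "sat v (Member s t) \<longleftrightarrow> trm_val v s \<in> elems (trm_val v t)"
| "sat v (Neg p) \<longleftrightarrow> \<not> sat v p"
| "sat v (And p q) \<longleftrightarrow> sat v p \<and> sat v q"
| "sat v (BAll i t p) \<longleftrightarrow> (\<forall>a\<in>elems (trm_val v t). sat (v(i := a)) p)"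

definition statement_in :: "'u::set_universe \<Rightarrow> 'u formula \<Rightarrow> bool" where
  "statement_in S p \<longleftrightarrow> set_formula p \<subseteq> superstructure S \<and> free_vars p = {}"

definition internal :: "'u::set_universe \<Rightarrow> ('u \<Rightarrow> 'u) \<Rightarrow> 'u set" where
  "internal S star = (\<Union>A\<in>superstructure S - elems S. elems (star A))"

text \<open>
  \<^term>\<open>map_formula star p\<close> replaces every constant of \<^term>\<open>p\<close> by its image. In the saturation
  clause a family of sets is given by the set of its members.
\<close>

definition enlargement :: "'u::set_universe \<Rightarrow> 'u \<Rightarrow> ('u \<Rightarrow> 'u) \<Rightarrow> bool" where
  "enlargement S W star \<longleftrightarrow>
     base_set S \<and> base_set W \<and>
     star \<in> superstructure S \<rightarrow> superstructure W \<and>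
     star S = W \<and>
     (\<forall>s\<in>elems S. star s = s) \<and>
     (\<forall>p v. statement_in S p \<longrightarrow> (sat v p \<longleftrightarrow> sat v (map_formula star p))) \<and>
     (\<forall>\<U>. \<U> \<noteq> {} \<and> \<U> \<subseteq> internal S star \<and>
        (\<forall>U\<in>\<U>. is_set U \<and> elems U \<noteq> {}) \<and>
        \<U> \<lesssim> superstructure S \<and>
        (\<forall>\<F>. \<F> \<subseteq> \<U> \<and> finite \<F> \<and> \<F> \<noteq> {} \<longrightarrow> (\<Inter>U\<in>\<F>. elems U) \<noteq> {})
        \<longrightarrow> (\<Inter>U\<in>\<U>. elems U) \<noteq> {})"


section \<open>Categories\<close>

record ('o, 'm) category =
  obj :: "'o set"
  arr :: "'m set"
  src :: "'m \<Rightarrow> 'o"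
  tgt :: "'m \<Rightarrow> 'o"
  idt :: "'o \<Rightarrow> 'm"
  cmp :: "'m \<Rightarrow> 'm \<Rightarrow> 'm"

record ('o, 'm) lin_category = "('o, 'm) category" +
  padd :: "'m \<Rightarrow> 'm \<Rightarrow> 'm"

definition mor :: "('o, 'm, 'x) category_scheme \<Rightarrow> 'o \<Rightarrow> 'o \<Rightarrow> 'm set" where
  "mor C a b = {f \<in> arr C. src C f = a \<and> tgt C f = b}"

text \<open>\<^term>\<open>cmp C g f\<close> is \<open>g\<close> after \<open>f\<close>.\<close>

locale category =
  fixes C :: "('o, 'm, 'x) category_scheme"
  assumes src_obj: "f \<in> arr C \<Longrightarrow> src C f \<in> obj C"
    and tgt_obj: "f \<in> arr C \<Longrightarrow> tgt C f \<in> obj C"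
    and idt_mor: "a \<in> obj C \<Longrightarrow> idt C a \<in> mor C a a"
    and cmp_mor: "f \<in> mor C a b \<Longrightarrow> g \<in> mor C b c \<Longrightarrow> cmp C g f \<in> mor C a c"
    and cmp_idt: "f \<in> mor C a b \<Longrightarrow> cmp C f (idt C a) = f"
    and idt_cmp: "f \<in> mor C a b \<Longrightarrow> cmp C (idt C b) f = f"
    and cmp_assoc: "f \<in> mor C a b \<Longrightarrow> g \<in> mor C b c \<Longrightarrow> h \<in> mor C c d \<Longrightarrow>
      cmp C h (cmp C g f) = cmp C (cmp C h g) f"

locale preadditive_category = category C
  for C :: "('o, 'm, 'x) lin_category_scheme" +
  assumes mor_comm_group: "a \<in> obj C \<Longrightarrow> b \<in> obj C \<Longrightarrow>
      \<exists>z. comm_group \<lparr>carrier = mor C a b, monoid.mult = padd C, one = z\<rparr>"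
    and cmp_padd_right: "f \<in> mor C a b \<Longrightarrow> f' \<in> mor C a b \<Longrightarrow> g \<in> mor C b c \<Longrightarrow>
      cmp C g (padd C f f') = padd C (cmp C g f) (cmp C g f')"
    and cmp_padd_left: "f \<in> mor C a b \<Longrightarrow> g \<in> mor C b c \<Longrightarrow> g' \<in> mor C b c \<Longrightarrow>
      cmp C (padd C g g') f = padd C (cmp C g f) (cmp C g' f)"

definition zero_object :: "('o, 'm, 'x) category_scheme \<Rightarrow> 'o \<Rightarrow> bool" where
  "zero_object C z \<longleftrightarrow> z \<in> obj C \<and>
     (\<forall>a\<in>obj C. (\<exists>!f. f \<in> mor C z a) \<and> (\<exists>!f. f \<in> mor C a z))"

definition is_biproduct ::
    "('o, 'm, 'x) lin_category_scheme \<Rightarrow> 'o \<Rightarrow> 'o \<Rightarrow> 'o \<Rightarrow> 'm \<Rightarrow> 'm \<Rightarrow> 'm \<Rightarrow> 'm \<Rightarrow> bool" where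
  "is_biproduct C a b p i j q r \<longleftrightarrow>
     p \<in> obj C \<and> i \<in> mor C a p \<and> j \<in> mor C b p \<and> q \<in> mor C p a \<and> r \<in> mor C p b \<and>
     cmp C q i = idt C a \<and> cmp C r j = idt C b \<and>
     padd C (cmp C i q) (cmp C j r) = idt C p"

locale additive_category = preadditive_category C
  for C :: "('o, 'm, 'x) lin_category_scheme" +
  assumes ex_zero_object: "\<exists>z. zero_object C z"
    and ex_biproduct: "a \<in> obj C \<Longrightarrow> b \<in> obj C \<Longrightarrow> \<exists>p i j q r. is_biproduct C a b p i j q r"

definition monic :: "('o, 'm, 'x) category_scheme \<Rightarrow> 'm \<Rightarrow> bool" where
  "monic C f \<longleftrightarrow> f \<in> arr C \<and>
     (\<forall>a. \<forall>g\<in>mor C a (src C f). \<forall>h\<in>mor C a (src C f). cmp C f g = cmp C f h \<longrightarrow> g = h)"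

definition epic :: "('o, 'm, 'x) category_scheme \<Rightarrow> 'm \<Rightarrow> bool" where
  "epic C f \<longleftrightarrow> f \<in> arr C \<and>
     (\<forall>a. \<forall>g\<in>mor C (tgt C f) a. \<forall>h\<in>mor C (tgt C f) a. cmp C g f = cmp C h f \<longrightarrow> g = h)"

definition zero_arrow :: "('o, 'm, 'x) lin_category_scheme \<Rightarrow> 'm \<Rightarrow> bool" where
  "zero_arrow C f \<longleftrightarrow> f \<in> arr C \<and> (\<forall>g\<in>mor C (src C f) (tgt C f). padd C f g = g)"

definition is_kernel :: "('o, 'm, 'x) lin_category_scheme \<Rightarrow> 'm \<Rightarrow> 'm \<Rightarrow> bool" where
  "is_kernel C k f \<longleftrightarrow> k \<in> arr C \<and> f \<in> arr C \<and> tgt C k = src C f \<and> zero_arrow C (cmp C f k) \<and>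
     (\<forall>h\<in>arr C. tgt C h = src C f \<and> zero_arrow C (cmp C f h) \<longrightarrow>
        (\<exists>!u. u \<in> mor C (src C h) (src C k) \<and> cmp C k u = h))"

definition is_cokernel :: "('o, 'm, 'x) lin_category_scheme \<Rightarrow> 'm \<Rightarrow> 'm \<Rightarrow> bool" where
  "is_cokernel C k f \<longleftrightarrow> k \<in> arr C \<and> f \<in> arr C \<and> src C k = tgt C f \<and> zero_arrow C (cmp C k f) \<and>
     (\<forall>h\<in>arr C. src C h = tgt C f \<and> zero_arrow C (cmp C h f) \<longrightarrow>
        (\<exists>!u. u \<in> mor C (tgt C k) (tgt C h) \<and> cmp C u k = h))"

locale abelian_category = additive_category C
  for C :: "('o, 'm, 'x) lin_category_scheme" +
  assumes ex_kernel: "f \<in> arr C \<Longrightarrow> \<exists>k. is_kernel C k f"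
    and ex_cokernel: "f \<in> arr C \<Longrightarrow> \<exists>k. is_cokernel C k f"
    and monic_is_kernel: "monic C f \<Longrightarrow> \<exists>g. is_kernel C f g"
    and epic_is_cokernel: "epic C f \<Longrightarrow> \<exists>g. is_cokernel C f g"

text \<open>The sequence \<open>0 \<rightarrow> a \<rightarrow> b \<rightarrow> c \<rightarrow> 0\<close> with the arrows \<open>f\<close> and \<open>g\<close> is exact.\<close>

definition short_exact :: "('o, 'm, 'x) lin_category_scheme \<Rightarrow> 'm \<Rightarrow> 'm \<Rightarrow> bool" where
  "short_exact C f g \<longleftrightarrow> is_kernel C f g \<and> is_cokernel C g f"

definition full_subcategory ::
    "('o, 'm, 'x) category_scheme \<Rightarrow> 'o set \<Rightarrow> ('o, 'm, 'x) category_scheme" where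
  "full_subcategory C T =
     C\<lparr>obj := obj C \<inter> T, arr := {f \<in> arr C. src C f \<in> T \<and> tgt C f \<in> T}\<rparr>"

definition serre_subcategory ::
    "('o, 'm, 'x) lin_category_scheme \<Rightarrow> ('o, 'm, 'x) lin_category_scheme \<Rightarrow> bool" where
  "serre_subcategory B C \<longleftrightarrow> abelian_category C \<and>
     obj B \<subseteq> obj C \<and> B = full_subcategory C (obj B) \<and> obj B \<noteq> {} \<and>
     (\<forall>f. monic C f \<and> tgt C f \<in> obj B \<longrightarrow> src C f \<in> obj B) \<and>
     (\<forall>f. epic C f \<and> src C f \<in> obj B \<longrightarrow> tgt C f \<in> obj B) \<and>
     (\<forall>f g. short_exact C f g \<and> src C f \<in> obj B \<and> tgt C g \<in> obj B \<longrightarrow> tgt C f \<in> obj B)"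


section \<open>Functors\<close>

record ('o, 'm, 'p, 'n) functor_map =
  fob :: "'o \<Rightarrow> 'p"
  far :: "'m \<Rightarrow> 'n"

definition is_functor ::
    "('o, 'm, 'x) category_scheme \<Rightarrow> ('p, 'n, 'y) category_scheme \<Rightarrow>
     ('o, 'm, 'p, 'n) functor_map \<Rightarrow> bool" where
  "is_functor C D F \<longleftrightarrow> category C \<and> category D \<and>
     (\<forall>a\<in>obj C. fob F a \<in> obj D \<and> far F (idt C a) = idt D (fob F a)) \<and>
     (\<forall>f\<in>arr C. far F f \<in> mor D (fob F (src C f)) (fob F (tgt C f))) \<and>
     (\<forall>f\<in>arr C. \<forall>g\<in>arr C. src C g = tgt C f \<longrightarrow> far F (cmp C g f) = cmp D (far F g) (far F f))"

definition faithful_functor ::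
    "('o, 'm, 'x) category_scheme \<Rightarrow> ('p, 'n, 'y) category_scheme \<Rightarrow>
     ('o, 'm, 'p, 'n) functor_map \<Rightarrow> bool" where
  "faithful_functor C D F \<longleftrightarrow> is_functor C D F \<and>
     (\<forall>a\<in>obj C. \<forall>b\<in>obj C. inj_on (far F) (mor C a b))"

definition full_functor ::
    "('o, 'm, 'x) category_scheme \<Rightarrow> ('p, 'n, 'y) category_scheme \<Rightarrow>
     ('o, 'm, 'p, 'n) functor_map \<Rightarrow> bool" where
  "full_functor C D F \<longleftrightarrow> is_functor C D F \<and>
     (\<forall>a\<in>obj C. \<forall>b\<in>obj C. far F ` mor C a b = mor D (fob F a) (fob F b))"

definition additive_functor ::
    "('o, 'm, 'x) lin_category_scheme \<Rightarrow> ('p, 'n, 'y) lin_category_scheme \<Rightarrow>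
     ('o, 'm, 'p, 'n) functor_map \<Rightarrow> bool" where
  "additive_functor C D F \<longleftrightarrow> preadditive_category C \<and> preadditive_category D \<and> is_functor C D F \<and>
     (\<forall>a\<in>obj C. \<forall>b\<in>obj C. \<forall>f\<in>mor C a b. \<forall>g\<in>mor C a b.
        far F (padd C f g) = padd D (far F f) (far F g))"

definition exact_functor ::
    "('o, 'm, 'x) lin_category_scheme \<Rightarrow> ('p, 'n, 'y) lin_category_scheme \<Rightarrow>
     ('o, 'm, 'p, 'n) functor_map \<Rightarrow> bool" where
  "exact_functor C D F \<longleftrightarrow> additive_functor C D F \<and>
     (\<forall>f g. short_exact C f g \<longrightarrow> short_exact D (far F f) (far F g))"

definition functor_comp ::
    "('p, 'n, 'q, 'k) functor_map \<Rightarrow> ('o, 'm, 'p, 'n) functor_map \<Rightarrow>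
     ('o, 'm, 'q, 'k) functor_map" where
  "functor_comp G F = \<lparr>fob = fob G \<circ> fob F, far = far G \<circ> far F\<rparr>"

definition functors_equal ::
    "('o, 'm, 'x) category_scheme \<Rightarrow> ('p, 'n, 'y) category_scheme \<Rightarrow>
     ('o, 'm, 'p, 'n) functor_map \<Rightarrow> ('o, 'm, 'p, 'n) functor_map \<Rightarrow> bool" where
  "functors_equal C D F G \<longleftrightarrow> is_functor C D F \<and> is_functor C D G \<and>
     (\<forall>a\<in>obj C. fob F a = fob G a) \<and> (\<forall>f\<in>arr C. far F f = far G f)"

definition image_category ::
    "('o, 'm, 'x) category_scheme \<Rightarrow> ('p, 'n, 'y) category_scheme \<Rightarrow>
     ('o, 'm, 'p, 'n) functor_map \<Rightarrow> ('p, 'n, 'y) category_scheme" where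
  "image_category C D F = D\<lparr>obj := fob F ` obj C, arr := far F ` arr C\<rparr>"

text \<open>That the inclusion is an additive functor says that \<open>B\<close> inherits its operations from \<open>D\<close>.\<close>

definition abelian_subcategory ::
    "('o, 'm, 'x) lin_category_scheme \<Rightarrow> ('o, 'm, 'x) lin_category_scheme \<Rightarrow> bool" where
  "abelian_subcategory B D \<longleftrightarrow> abelian_category B \<and> exact_functor B D \<lparr>fob = id, far = id\<rparr>"

definition category_isomorphism ::
    "('o, 'm, 'x) category_scheme \<Rightarrow> ('p, 'n, 'y) category_scheme \<Rightarrow>
     ('o, 'm, 'p, 'n) functor_map \<Rightarrow> bool" where
  "category_isomorphism C D F \<longleftrightarrow> is_functor C D F \<and>
     bij_betw (fob F) (obj C) (obj D) \<and> bij_betw (far F) (arr C) (arr D)"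

definition identifies_with_abelian_subcategory ::
    "('o, 'm, 'x) lin_category_scheme \<Rightarrow> ('p, 'n, 'y) lin_category_scheme \<Rightarrow>
     ('o, 'm, 'p, 'n) functor_map \<Rightarrow> bool" where
  "identifies_with_abelian_subcategory C D F \<longleftrightarrow>
     abelian_subcategory (image_category C D F) D \<and>
     category_isomorphism C (image_category C D F) F"


section \<open>Modules over a possibly noncommutative ring\<close>

locale left_module = R?: ring R + M?: abelian_group M
  for R :: "('r, 'x) ring_scheme" (structure) and M :: "('r, 'm) module" (structure) +
  assumes smult_closed: "r \<in> carrier R \<Longrightarrow> x \<in> carrier M \<Longrightarrow> r \<odot>\<^bsub>M\<^esub> x \<in> carrier M"
    and smult_l_distr: "r \<in> carrier R \<Longrightarrow> s \<in> carrier R \<Longrightarrow> x \<in> carrier M \<Longrightarrow>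
      (r \<oplus>\<^bsub>R\<^esub> s) \<odot>\<^bsub>M\<^esub> x = r \<odot>\<^bsub>M\<^esub> x \<oplus>\<^bsub>M\<^esub> s \<odot>\<^bsub>M\<^esub> x"
    and smult_r_distr: "r \<in> carrier R \<Longrightarrow> x \<in> carrier M \<Longrightarrow> y \<in> carrier M \<Longrightarrow>
      r \<odot>\<^bsub>M\<^esub> (x \<oplus>\<^bsub>M\<^esub> y) = r \<odot>\<^bsub>M\<^esub> x \<oplus>\<^bsub>M\<^esub> r \<odot>\<^bsub>M\<^esub> y"
    and smult_assoc1: "r \<in> carrier R \<Longrightarrow> s \<in> carrier R \<Longrightarrow> x \<in> carrier M \<Longrightarrow>
      (r \<otimes>\<^bsub>R\<^esub> s) \<odot>\<^bsub>M\<^esub> x = r \<odot>\<^bsub>M\<^esub> (s \<odot>\<^bsub>M\<^esub> x)"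
    and smult_one: "x \<in> carrier M \<Longrightarrow> \<one>\<^bsub>R\<^esub> \<odot>\<^bsub>M\<^esub> x = x"

text \<open>
  The library's module records carry ring fields that mean nothing for a module, and their
  operations have values outside the carrier. \<open>mk_module\<close> fixes all of these, so that two modules
  of the form \<open>mk_module R X ad sm\<close> are equal as records if and only if they are equal as modules.
\<close>

definition mk_module ::
    "('r, 'x) ring_scheme \<Rightarrow> 'm set \<Rightarrow> ('m \<Rightarrow> 'm \<Rightarrow> 'm) \<Rightarrow> ('r \<Rightarrow> 'm \<Rightarrow> 'm) \<Rightarrow> ('r, 'm) module" where
  "mk_module R X ad sm =
     \<lparr>carrier = X, monoid.mult = undefined, one = undefined,
      zero = (THE z. z \<in> X \<and> (\<forall>x\<in>X. ad z x = x)),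
      add = (\<lambda>x y. if x \<in> X \<and> y \<in> X then ad x y else undefined),
      smult = (\<lambda>r x. if r \<in> carrier R \<and> x \<in> X then sm r x else undefined)\<rparr>"

definition modules :: "('r, 'x) ring_scheme \<Rightarrow> ('r, 'm) module set" where
  "modules R = {M. left_module R M \<and> M = mk_module R (carrier M) (add M) (smult M)}"

definition regular_module :: "('r, 'x) ring_scheme \<Rightarrow> ('r, 'r) module" where
  "regular_module R = mk_module R (carrier R) (add R) (monoid.mult R)"

definition mod_hom ::
    "('r, 'x) ring_scheme \<Rightarrow> ('r, 'm) module \<Rightarrow> ('r, 'n) module \<Rightarrow> ('m \<Rightarrow> 'n) set" where
  "mod_hom R M N = {h \<in> carrier M \<rightarrow> carrier N.
     (\<forall>x\<in>carrier M. \<forall>y\<in>carrier M. h (x \<oplus>\<^bsub>M\<^esub> y) = h x \<oplus>\<^bsub>N\<^esub> h y) \<and>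
     (\<forall>r\<in>carrier R. \<forall>x\<in>carrier M. h (r \<odot>\<^bsub>M\<^esub> x) = r \<odot>\<^bsub>N\<^esub> h x)}"

definition mod_iso ::
    "('r, 'x) ring_scheme \<Rightarrow> ('r, 'm) module \<Rightarrow> ('r, 'n) module \<Rightarrow> ('m \<Rightarrow> 'n) set" where
  "mod_iso R M N = {h \<in> mod_hom R M N. bij_betw h (carrier M) (carrier N)}"

record ('r, 'm) mod_arrow =
  msrc :: "('r, 'm) module"
  mmap :: "'m \<Rightarrow> 'm"
  mtgt :: "('r, 'm) module"

text \<open>The category of \<open>R\<close>-modules whose elements belong to the type \<open>'m\<close>.\<close>

definition LMod :: "('r, 'x) ring_scheme \<Rightarrow> (('r, 'm) module, ('r, 'm) mod_arrow) lin_category" where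
  "LMod R =
     \<lparr>obj = modules R,
      arr = {f. msrc f \<in> modules R \<and> mtgt f \<in> modules R \<and>
                mmap f \<in> mod_hom R (msrc f) (mtgt f) \<and> mmap f \<in> extensional (carrier (msrc f))},
      src = msrc,
      tgt = mtgt,
      idt = (\<lambda>M. \<lparr>msrc = M, mmap = (\<lambda>x\<in>carrier M. x), mtgt = M\<rparr>),
      cmp = (\<lambda>g f. \<lparr>msrc = msrc f, mmap = compose (carrier (msrc f)) (mmap g) (mmap f),
                    mtgt = mtgt g\<rparr>),
      padd = (\<lambda>f g. \<lparr>msrc = msrc f,
                     mmap = (\<lambda>x\<in>carrier (msrc f). mmap f x \<oplus>\<^bsub>mtgt f\<^esub> mmap g x),
                     mtgt = mtgt f\<rparr>)\<rparr>"

definition LModS ::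
    "'u::set_universe \<Rightarrow> ('u, 'x) ring_scheme \<Rightarrow> (('u, 'u) module, ('u, 'u) mod_arrow) lin_category" where
  "LModS S R = full_subcategory (LMod R) {M. set_in_superstructure S (carrier M)}"

text \<open>Natural isomorphism of module-valued functors; the two element types may differ.\<close>

definition mod_nat_iso ::
    "('r, 'x) ring_scheme \<Rightarrow> ('o, 'm, 'y) category_scheme \<Rightarrow>
     ('o, 'm, ('r, 'a) module, ('r, 'a) mod_arrow) functor_map \<Rightarrow>
     ('o, 'm, ('r, 'b) module, ('r, 'b) mod_arrow) functor_map \<Rightarrow> ('o \<Rightarrow> 'a \<Rightarrow> 'b) \<Rightarrow> bool" where
  "mod_nat_iso R C F G \<eta> \<longleftrightarrow>
     (\<forall>a\<in>obj C. \<eta> a \<in> mod_iso R (fob F a) (fob G a)) \<and>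
     (\<forall>f\<in>arr C. \<forall>x\<in>carrier (fob F (src C f)).
        \<eta> (tgt C f) (mmap (far F f) x) = mmap (far G f) (\<eta> (src C f) x))"


section \<open>Small categories inside a superstructure\<close>

record 'u small_cat =
  Mors :: 'u
  srcS :: 'u
  tgtS :: 'u
  cmpS :: 'u
  addS :: 'u

text \<open>
  Objects are identity morphisms. The triples in \<^term>\<open>cmpS A\<close> are \<open>(g, f, h)\<close> with \<open>h\<close> being
  \<open>g\<close> after \<open>f\<close>; those in \<^term>\<open>addS A\<close> are \<open>(f, g, h)\<close> with \<open>h\<close> the sum of \<open>f\<close> and \<open>g\<close>.
\<close>

definition cat_of :: "'u::set_universe small_cat \<Rightarrow> ('u, 'u) lin_category" where
  "cat_of A =
     \<lparr>obj = app (srcS A) ` elems (Mors A) \<union> app (tgtS A) ` elems (Mors A),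
      arr = elems (Mors A),
      src = app (srcS A),
      tgt = app (tgtS A),
      idt = (\<lambda>a. a),
      cmp = (\<lambda>g f. THE h. otriple g f h \<in> elems (cmpS A)),
      padd = (\<lambda>f g. THE h. otriple f g h \<in> elems (addS A))\<rparr>"

definition small_category :: "'u::set_universe \<Rightarrow> 'u small_cat \<Rightarrow> bool" where
  "small_category S A \<longleftrightarrow>
     Mors A \<in> superstructure S - elems S \<and>
     is_map (srcS A) (elems (Mors A)) (elems (Mors A)) \<and>
     is_map (tgtS A) (elems (Mors A)) (elems (Mors A)) \<and>
     is_set (cmpS A) \<and>
     (\<forall>p\<in>elems (cmpS A). \<exists>g\<in>elems (Mors A). \<exists>f\<in>elems (Mors A). \<exists>h\<in>elems (Mors A).
        p = otriple g f h \<and> app (srcS A) g = app (tgtS A) f) \<and>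
     (\<forall>g\<in>elems (Mors A). \<forall>f\<in>elems (Mors A). app (srcS A) g = app (tgtS A) f \<longrightarrow>
        (\<exists>!h. otriple g f h \<in> elems (cmpS A))) \<and>
     category (cat_of A)"

definition abelian_small_category :: "'u::set_universe \<Rightarrow> 'u small_cat \<Rightarrow> bool" where
  "abelian_small_category S A \<longleftrightarrow> small_category S A \<and>
     is_set (addS A) \<and>
     (\<forall>p\<in>elems (addS A). \<exists>f\<in>elems (Mors A). \<exists>g\<in>elems (Mors A). \<exists>h\<in>elems (Mors A).
        p = otriple f g h \<and> app (srcS A) f = app (srcS A) g \<and> app (tgtS A) f = app (tgtS A) g) \<and>
     (\<forall>f\<in>elems (Mors A). \<forall>g\<in>elems (Mors A).
        app (srcS A) f = app (srcS A) g \<and> app (tgtS A) f = app (tgtS A) g \<longrightarrow>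
        (\<exists>!h. otriple f g h \<in> elems (addS A))) \<and>
     abelian_category (cat_of A)"


section \<open>Images under an enlargement\<close>

definition star_cat :: "('u::set_universe \<Rightarrow> 'u) \<Rightarrow> 'u small_cat \<Rightarrow> 'u small_cat" where
  "star_cat star A =
     \<lparr>Mors = star (Mors A), srcS = star (srcS A), tgtS = star (tgtS A),
      cmpS = star (cmpS A), addS = star (addS A)\<rparr>"

definition star_cat_functor :: "('u \<Rightarrow> 'u) \<Rightarrow> ('u, 'u, 'u, 'u) functor_map" where
  "star_cat_functor star = \<lparr>fob = star, far = star\<rparr>"

definition star_ring :: "('u::set_universe \<Rightarrow> 'u) \<Rightarrow> 'u ring \<Rightarrow> 'u ring" where
  "star_ring star R =
     \<lparr>carrier = elems (star (mkset (carrier R))),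
      monoid.mult = (\<lambda>x y. app (star (graph2 (monoid.mult R) (carrier R) (carrier R))) (opair x y)),
      one = star \<one>\<^bsub>R\<^esub>,
      zero = star \<zero>\<^bsub>R\<^esub>,
      add = (\<lambda>x y. app (star (graph2 (add R) (carrier R) (carrier R))) (opair x y))\<rparr>"

definition star_module ::
    "('u::set_universe \<Rightarrow> 'u) \<Rightarrow> 'u ring \<Rightarrow> ('u, 'u) module \<Rightarrow> ('u, 'u) module" where
  "star_module star R M =
     mk_module (star_ring star R) (elems (star (mkset (carrier M))))
       (\<lambda>x y. app (star (graph2 (add M) (carrier M) (carrier M))) (opair x y))
       (\<lambda>r x. app (star (graph2 (smult M) (carrier R) (carrier M))) (opair r x))"

definition star_module_functor ::
    "('u::set_universe \<Rightarrow> 'u) \<Rightarrow> 'u ring \<Rightarrow>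
     (('u, 'u) module, ('u, 'u) mod_arrow, ('u, 'u) module, ('u, 'u) mod_arrow) functor_map" where
  "star_module_functor star R =
     \<lparr>fob = star_module star R,
      far = (\<lambda>f. \<lparr>msrc = star_module star R (msrc f),
                   mmap = restrict (app (star (graph1 (mmap f) (carrier (msrc f)))))
                            (carrier (star_module star R (msrc f))),
                   mtgt = star_module star R (mtgt f)\<rparr>)\<rparr>"


section \<open>The functors represented by \<open>\<RR>\<close> and its image\<close>

text \<open>
  The composite \<open>Mor(\<RR>, a) \<rightarrow> Hom(F \<RR>, F a) \<cong> Hom(R, F a) \<cong> F a\<close>, where the second map is
  precomposition with the inverse of \<open>\<psi>\<close> and the third is evaluation at \<open>1\<close>.
\<close>

definition transport ::
    "'u ring \<Rightarrow> ('u, 'u, ('u, 'v) module, ('u, 'v) mod_arrow) functor_map \<Rightarrow>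
     'u \<Rightarrow> ('v \<Rightarrow> 'u) \<Rightarrow> 'u \<Rightarrow> 'v" where
  "transport R F \<RR> \<psi> f = mmap (far F f) (inv_into (carrier (fob F \<RR>)) \<psi> \<one>\<^bsub>R\<^esub>)"

definition G_module ::
    "'u::set_universe small_cat \<Rightarrow> 'u ring \<Rightarrow>
     ('u, 'u, ('u, 'v) module, ('u, 'v) mod_arrow) functor_map \<Rightarrow>
     'u \<Rightarrow> ('v \<Rightarrow> 'u) \<Rightarrow> 'u \<Rightarrow> ('u, 'u) module" where
  "G_module A R F \<RR> \<psi> a =
     (let X = mor (cat_of A) \<RR> a; \<theta> = transport R F \<RR> \<psi>
      in mk_module R X (\<lambda>f g. inv_into X \<theta> (\<theta> f \<oplus>\<^bsub>fob F a\<^esub> \<theta> g))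
                       (\<lambda>r f. inv_into X \<theta> (r \<odot>\<^bsub>fob F a\<^esub> \<theta> f)))"

definition represented_functor ::
    "('u::set_universe, 'u) lin_category \<Rightarrow> 'u \<Rightarrow> ('u \<Rightarrow> ('u, 'u) module) \<Rightarrow>
     ('u, 'u, ('u, 'u) module, ('u, 'u) mod_arrow) functor_map" where
  "represented_functor C \<RR> mdl =
     \<lparr>fob = mdl,
      far = (\<lambda>h. \<lparr>msrc = mdl (src C h), mmap = (\<lambda>f\<in>mor C \<RR> (src C h). cmp C h f),
                   mtgt = mdl (tgt C h)\<rparr>)\<rparr>"

definition G_functor ::
    "'u::set_universe small_cat \<Rightarrow> 'u ring \<Rightarrow>
     ('u, 'u, ('u, 'v) module, ('u, 'v) mod_arrow) functor_map \<Rightarrow>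
     'u \<Rightarrow> ('v \<Rightarrow> 'u) \<Rightarrow> ('u, 'u, ('u, 'u) module, ('u, 'u) mod_arrow) functor_map" where
  "G_functor A R F \<RR> \<psi> = represented_functor (cat_of A) \<RR> (G_module A R F \<RR> \<psi>)"

text \<open>The families of addition and scalar multiplication maps, as maps on the set of objects.\<close>

definition add_family :: "'u::set_universe small_cat \<Rightarrow> ('u \<Rightarrow> ('u, 'u) module) \<Rightarrow> 'u" where
  "add_family A mdl =
     graph1 (\<lambda>a. graph2 (add (mdl a)) (carrier (mdl a)) (carrier (mdl a))) (obj (cat_of A))"

definition smult_family ::
    "'u::set_universe small_cat \<Rightarrow> 'u ring \<Rightarrow> ('u \<Rightarrow> ('u, 'u) module) \<Rightarrow> 'u" where
  "smult_family A R mdl =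
     graph1 (\<lambda>a. graph2 (smult (mdl a)) (carrier R) (carrier (mdl a))) (obj (cat_of A))"

definition Gtilde_module ::
    "('u::set_universe \<Rightarrow> 'u) \<Rightarrow> 'u small_cat \<Rightarrow> 'u ring \<Rightarrow>
     ('u, 'u, ('u, 'v) module, ('u, 'v) mod_arrow) functor_map \<Rightarrow>
     'u \<Rightarrow> ('v \<Rightarrow> 'u) \<Rightarrow> 'u \<Rightarrow> ('u, 'u) module" where
  "Gtilde_module star A R F \<RR> \<psi> a =
     mk_module (star_ring star R) (mor (cat_of (star_cat star A)) (star \<RR>) a)
       (\<lambda>f g. app (app (star (add_family A (G_module A R F \<RR> \<psi>))) a) (opair f g))
       (\<lambda>r f. app (app (star (smult_family A R (G_module A R F \<RR> \<psi>))) a) (opair r f))"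

definition Gtilde_functor ::
    "('u::set_universe \<Rightarrow> 'u) \<Rightarrow> 'u small_cat \<Rightarrow> 'u ring \<Rightarrow>
     ('u, 'u, ('u, 'v) module, ('u, 'v) mod_arrow) functor_map \<Rightarrow>
     'u \<Rightarrow> ('v \<Rightarrow> 'u) \<Rightarrow> ('u, 'u, ('u, 'u) module, ('u, 'u) mod_arrow) functor_map" where
  "Gtilde_functor star A R F \<RR> \<psi> =
     represented_functor (cat_of (star_cat star A)) (star \<RR>) (Gtilde_module star A R F \<RR> \<psi>)"

definition fin_subcategory ::
    "('u::set_universe, 'u) lin_category \<Rightarrow>
     ('u, 'u, ('u, 'u) module, ('u, 'u) mod_arrow) functor_map \<Rightarrow> ('u, 'u) lin_category" where
  "fin_subcategory C G = full_subcategory C {a. finite (carrier (fob G a))}"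

end

theory Submission
  imports Defs
begin

text \<open>
  Write \<open>Mor(\<RR>, a)\<close> for the arrows from \<open>\<RR>\<close> to \<open>a\<close>. The proof rests on the fact that \<open>\<RR>\<close> is a
  projective generator of \<open>A\<close> and that this is a first-order property.

  Sending an arrow \<open>f\<close> to \<open>F f\<close>, evaluated at the element of \<open>F \<RR>\<close> that corresponds to \<open>1\<close>, gives
  a bijection \<open>\<theta>\<close> from \<open>Mor(\<RR>, a)\<close> to \<open>F a\<close> (\<open>theta_bij\<close>), because \<open>F\<close> is fully faithful and \<open>F \<RR>\<close> is
  free of rank one. It is natural in \<open>a\<close>, and since \<open>F\<close> is additive the transported addition is the
  addition of arrows. Faithfulness of \<open>F\<close> says that \<open>\<RR>\<close> is a generator. Exactness of \<open>F\<close> says that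
  \<open>\<RR>\<close> is projective: an epic arrow fits into a short exact sequence, and a cokernel in the
  category of modules is surjective (\<open>LMod_cokernel_surj\<close>).

  Conversely, in any abelian category with a projective generator \<open>\<RR>\<close> and compatible module
  structures on the groups \<open>Mor(\<RR>, a)\<close>, the functor \<open>Mor(\<RR>, _)\<close> is exact and faithful, identifies
  the category with an abelian subcategory of the category of modules, and the objects \<open>a\<close> with
  \<open>Mor(\<RR>, a)\<close> finite form a Serre subcategory. This is the content of the locale
  \<open>represented_modules\<close>. It is applied twice, to \<open>A\<close> and to its enlargement.

  The second application needs that the enlargement of \<open>A\<close> is abelian, that the image of \<open>\<RR>\<close> is a
  projective generator and that the enlarged families of operations are module structures for
  which composition is linear. All of this is transfer of bounded statements. The equality of the
  two functors from \<open>A\<close> to modules over the enlarged ring comes down to the compatibility of \<open>star\<close>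
  with function application (\<open>star_app\<close>).
\<close>

section \<open>Sets and maps in a superstructure\<close>

text \<open>
  A set of elements of the universe is small if it is the extension of a set of the universe.
\<close>

definition small :: "'u::set_universe set \<Rightarrow> bool" where
  "small A \<longleftrightarrow> (\<exists>z. is_set z \<and> elems z = A)"

lemma mkset_eq: "is_set z \<Longrightarrow> elems z = A \<Longrightarrow> mkset A = z"
  unfolding mkset_def by (rule the_equality) (auto intro: extensionality)

lemma small_mkset:
  assumes "small A" shows "is_set (mkset A)" "elems (mkset A) = A"
  using assms mkset_eq[of _ A] unfolding small_def by metis+

lemma mkset_elems: "is_set z \<Longrightarrow> mkset (elems z) = z"
  by (simp add: mkset_eq)

lemma small_doubleton: "small {x, y}"
  using pairing unfolding small_def by blast

lemma small_singleton: "small {x}"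
  using small_doubleton[of x x] by simp

lemma small_subset: "small A \<Longrightarrow> B \<subseteq> A \<Longrightarrow> small B"
  unfolding small_def using separation by blast

lemma mkset_inj: "small A \<Longrightarrow> small B \<Longrightarrow> mkset A = mkset B \<longleftrightarrow> A = B"
  by (metis small_mkset(2))

lemma opair_eq_iff [simp]: "opair a b = opair c d \<longleftrightarrow> a = c \<and> b = d"
  unfolding opair_def
  by (auto simp: mkset_inj small_doubleton small_singleton doubleton_eq_iff
      singleton_insert_inj_eq singleton_insert_inj_eq')

lemma app_eqI:
  assumes "opair x y \<in> elems f" "\<And>z. opair x z \<in> elems f \<Longrightarrow> z = y"
  shows "app f x = y"
proof -
  have "\<exists>!y. opair x y \<in> elems f" using assms by blast
  moreover have "(THE y. opair x y \<in> elems f) = y" using assms by blast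
  ultimately show ?thesis by (simp add: app_def)
qed

lemma app_graph1:
  "small {opair x (f x) | x. x \<in> X} \<Longrightarrow> x \<in> X \<Longrightarrow> app (graph1 f X) x = f x"
  unfolding graph1_def by (rule app_eqI) (auto simp: small_mkset)

lemma app_graph2:
  "small {opair (opair x y) (f x y) | x y. x \<in> X \<and> y \<in> Y} \<Longrightarrow> x \<in> X \<Longrightarrow> y \<in> Y \<Longrightarrow>
   app (graph2 f X Y) (opair x y) = f x y"
  unfolding graph2_def by (rule app_eqI) (auto simp: small_mkset)

text \<open>
  Contained in a single level of the superstructure. These are exactly the extensions of sets in
  the superstructure, and boundedness is what makes graphs and families lie in the superstructure.
\<close>

definition bounded_in :: "'u::set_universe \<Rightarrow> 'u set \<Rightarrow> bool" where
  "bounded_in S B \<longleftrightarrow> (\<exists>n. B \<subseteq> level S n)"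

lemma level_mono: "m \<le> n \<Longrightarrow> level S m \<subseteq> level S n"
  by (induction rule: dec_induct) auto

lemma small_level: "base_set S \<Longrightarrow> small (level S n)"
proof (induction n)
  case 0
  then show ?case by (auto simp: small_def base_set_def)
next
  case (Suc n)
  then obtain z where z: "is_set z" "elems z = level S n" by (auto simp: small_def)
  obtain y where "is_set y" "elems y = {x. is_set x \<and> elems x \<subseteq> elems z}"
    using power_set[OF z(1)] by blast
  then show ?case using binary_union[OF z(1)] z by (metis level.simps(2) small_def)
qed

lemma superstructure_cases:
  assumes "x \<in> superstructure S"
  shows "x \<in> elems S \<or> (is_set x \<and> (\<exists>n. elems x \<subseteq> level S n))"
proof -
  have "x \<in> level S n \<Longrightarrow> x \<in> elems S \<or> (is_set x \<and> (\<exists>n. elems x \<subseteq> level S n))" for n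
    by (induction n) auto
  then show ?thesis using assms by (auto simp: superstructure_def)
qed

context
  fixes S :: "'u::set_universe"
  assumes S: "base_set S"
begin

lemma bounded_mkset:
  assumes "bounded_in S B"
  shows "small B" "mkset B \<in> superstructure S"
proof -
  obtain n where n: "B \<subseteq> level S n" using assms by (auto simp: bounded_in_def)
  show s: "small B" using small_subset[OF small_level[OF S] n] .
  have "mkset B \<in> level S (Suc n)" using small_mkset[OF s] n by simp
  then show "mkset B \<in> superstructure S" unfolding superstructure_def by blast
qed

lemma bounded_elems:
  assumes "x \<in> superstructure S" shows "bounded_in S (elems x)"
proof (cases "x \<in> elems S")
  case True
  then have "elems x = {}" using S elems_atom by (auto simp: base_set_def)
  then show ?thesis by (auto simp: bounded_in_def)
next
  case False
  then show ?thesis using superstructure_cases[OF assms] by (auto simp: bounded_in_def)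
qed

lemma bounded_elem: "bounded_in S B \<Longrightarrow> x \<in> B \<Longrightarrow> x \<in> superstructure S"
  by (auto simp: bounded_in_def superstructure_def)

lemma set_in_superstructure_iff: "set_in_superstructure S X \<longleftrightarrow> bounded_in S X"
  using bounded_mkset small_mkset bounded_elems unfolding set_in_superstructure_def by metis

lemma bounded_subset: "bounded_in S B \<Longrightarrow> A \<subseteq> B \<Longrightarrow> bounded_in S A"
  by (auto simp: bounded_in_def)

lemma bounded_Times:
  assumes "bounded_in S X" "bounded_in S Y"
  shows "bounded_in S {opair x y | x y. x \<in> X \<and> y \<in> Y}"
proof -
  obtain m n where mn: "X \<subseteq> level S m" "Y \<subseteq> level S n" using assms by (auto simp: bounded_in_def)
  define k where "k = max m n"
  have k: "X \<subseteq> level S k" "Y \<subseteq> level S k"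
    using mn level_mono[of m k S] level_mono[of n k S] by (auto simp: k_def)
  have "opair x y \<in> level S (Suc (Suc k))" if "x \<in> X" "y \<in> Y" for x y
  proof -
    have "mkset {x} \<in> level S (Suc k)" "mkset {x, y} \<in> level S (Suc k)"
      using small_mkset[OF small_singleton[of x]] small_mkset[OF small_doubleton[of x y]] k that by auto
    then show ?thesis
      unfolding opair_def level.simps(2)[of S "Suc k"]
      using small_mkset[OF small_doubleton[of "mkset {x}" "mkset {x, y}"]] by auto
  qed
  then have "{opair x y | x y. x \<in> X \<and> y \<in> Y} \<subseteq> level S (Suc (Suc k))" by blast
  then show ?thesis unfolding bounded_in_def by blast
qed

text \<open>
  Families of subsets of one bounded set are bounded; this puts families of graphs, indexed by the
  objects of a category, into the superstructure.
\<close>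

lemma bounded_mkset_image:
  assumes "bounded_in S Z" "\<And>a. a \<in> X \<Longrightarrow> g a \<subseteq> Z"
  shows "bounded_in S ((\<lambda>a. mkset (g a)) ` X)"
proof -
  obtain n where n: "Z \<subseteq> level S n" using assms by (auto simp: bounded_in_def)
  have "mkset (g a) \<in> level S (Suc n)" if "a \<in> X" for a
    using small_mkset[of "g a"] bounded_mkset(1)[of "g a"] assms(2)[OF that] n
    by (auto simp: bounded_in_def)
  then show ?thesis unfolding bounded_in_def by blast
qed

lemma bounded_graph1:
  assumes "bounded_in S X" "bounded_in S Y" "\<And>x. x \<in> X \<Longrightarrow> f x \<in> Y"
  shows "bounded_in S {opair x (f x) | x. x \<in> X}"
  by (rule bounded_subset[OF bounded_Times[OF assms(1,2)]]) (use assms(3) in blast)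

lemma bounded_graph2:
  assumes "bounded_in S X" "bounded_in S Y" "bounded_in S Z" "\<And>x y. x \<in> X \<Longrightarrow> y \<in> Y \<Longrightarrow> f x y \<in> Z"
  shows "bounded_in S {opair (opair x y) (f x y) | x y. x \<in> X \<and> y \<in> Y}"
  by (rule bounded_subset[OF bounded_Times[OF bounded_Times[OF assms(1,2)] assms(3)]])
    (use assms(4) in blast)

lemma graph1_superstructure:
  assumes "bounded_in S X" "bounded_in S Y" "\<And>x. x \<in> X \<Longrightarrow> f x \<in> Y"
  shows "graph1 f X \<in> superstructure S" "x \<in> X \<Longrightarrow> app (graph1 f X) x = f x"
  using bounded_mkset[OF bounded_graph1[OF assms]]
  by (auto simp: graph1_def[symmetric] app_graph1)

lemma graph2_superstructure:
  assumes "bounded_in S X" "bounded_in S Y" "bounded_in S Z" "\<And>x y. x \<in> X \<Longrightarrow> y \<in> Y \<Longrightarrow> f x y \<in> Z"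
  shows "graph2 f X Y \<in> superstructure S"
    "x \<in> X \<Longrightarrow> y \<in> Y \<Longrightarrow> app (graph2 f X Y) (opair x y) = f x y"
  using bounded_mkset[OF bounded_graph2[OF assms]]
  by (auto simp: graph2_def[symmetric] app_graph2)

end

section \<open>Bounded formulas and transfer\<close>

text \<open>
  Bounded formulas are synthesized rather than written down. A context is a pair of a number \<open>n\<close>
  and a function that reads off, from an assignment, the tuple of values of the variables
  \<open>0, \<dots>, n - 1\<close>. Relative to a context \<open>\<Gamma>\<close>, the predicates \<open>tr_trm\<close>, \<open>tr_form\<close> and \<open>tr_set\<close> say of a
  pair of functions on such tuples that the first is defined by some term, formula or bounded set
  comprehension with constants in the superstructure, and that the second is defined by the same
  expression with every constant replaced by its image. Each logical connective has one
  introduction rule, so that for concrete properties \<open>P\<close> and \<open>P'\<close> the equivalence of \<open>P\<close> and \<open>P'\<close>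
  is proved by following their common syntactic structure.
\<close>

locale enlarged =
  fixes S :: "'u::set_universe" and star :: "'u \<Rightarrow> 'u"
  assumes enl: "enlargement S (star S) star"
begin

abbreviation V :: "'u set" where "V \<equiv> superstructure S"

lemma base: "base_set S"
  using enl by (simp add: enlargement_def)

text \<open>
  The tuple depends on no variable outside the context.
\<close>

definition valid_ctx :: "nat \<times> ((nat \<Rightarrow> 'u) \<Rightarrow> 'e) \<Rightarrow> bool" where
  "valid_ctx \<Gamma> \<longleftrightarrow> (\<forall>v w. (\<forall>i<fst \<Gamma>. v i = w i) \<longrightarrow> snd \<Gamma> v = snd \<Gamma> w)"

definition closed_ctx :: "nat \<times> ((nat \<Rightarrow> 'u) \<Rightarrow> unit)" where
  "closed_ctx = (0, \<lambda>v. ())"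

text \<open>
  Adding one variable: it becomes the second component of the tuple.
\<close>

definition ext_ctx :: "nat \<times> ((nat \<Rightarrow> 'u) \<Rightarrow> 'e) \<Rightarrow> nat \<times> ((nat \<Rightarrow> 'u) \<Rightarrow> 'e \<times> 'u)" where
  "ext_ctx \<Gamma> = (Suc (fst \<Gamma>), \<lambda>v. (snd \<Gamma> v, v (fst \<Gamma>)))"

definition tr_trm :: "nat \<times> ((nat \<Rightarrow> 'u) \<Rightarrow> 'e) \<Rightarrow> ('e \<Rightarrow> 'u) \<Rightarrow> ('e \<Rightarrow> 'u) \<Rightarrow> bool" where
  "tr_trm \<Gamma> t t' \<longleftrightarrow> valid_ctx \<Gamma> \<and> (\<exists>\<tau>. set_trm \<tau> \<subseteq> V \<and> trm_vars \<tau> \<subseteq> {..<fst \<Gamma>} \<and>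
     (\<forall>v. t (snd \<Gamma> v) = trm_val v \<tau> \<and> t' (snd \<Gamma> v) = trm_val v (map_trm star \<tau>)))"

definition tr_form :: "nat \<times> ((nat \<Rightarrow> 'u) \<Rightarrow> 'e) \<Rightarrow> ('e \<Rightarrow> bool) \<Rightarrow> ('e \<Rightarrow> bool) \<Rightarrow> bool" where
  "tr_form \<Gamma> P P' \<longleftrightarrow> valid_ctx \<Gamma> \<and> (\<exists>p. set_formula p \<subseteq> V \<and> free_vars p \<subseteq> {..<fst \<Gamma>} \<and>
     (\<forall>v. P (snd \<Gamma> v) = sat v p \<and> P' (snd \<Gamma> v) = sat v (map_formula star p)))"

text \<open>
  A definable set is a definable subset of the extension of a definable element.
\<close>

definition tr_set :: "nat \<times> ((nat \<Rightarrow> 'u) \<Rightarrow> 'e) \<Rightarrow> ('e \<Rightarrow> 'u set) \<Rightarrow> ('e \<Rightarrow> 'u set) \<Rightarrow> bool" where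
  "tr_set \<Gamma> X X' \<longleftrightarrow> (\<exists>t t' Q Q'. tr_trm \<Gamma> t t' \<and> tr_form (ext_ctx \<Gamma>) Q Q' \<and>
     (\<forall>e. X e = {x \<in> elems (t e). Q (e, x)}) \<and> (\<forall>e. X' e = {x \<in> elems (t' e). Q' (e, x)}))"

named_theorems star_intros

lemma valid_closed [star_intros]: "valid_ctx closed_ctx"
  by (simp add: valid_ctx_def)

lemma valid_ext [star_intros]: "valid_ctx \<Gamma> \<Longrightarrow> valid_ctx (ext_ctx \<Gamma>)"
  by (simp add: valid_ctx_def ext_ctx_def)

lemma valid_upd: "valid_ctx \<Gamma> \<Longrightarrow> snd \<Gamma> (v(fst \<Gamma> := x)) = snd \<Gamma> v"
  unfolding valid_ctx_def by simp

lemma tr_trm_valid: "tr_trm \<Gamma> t t' \<Longrightarrow> valid_ctx \<Gamma>" by (simp add: tr_trm_def)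
lemma tr_form_valid: "tr_form \<Gamma> t t' \<Longrightarrow> valid_ctx \<Gamma>" by (simp add: tr_form_def)

lemma tr_trm_const [star_intros]: "valid_ctx \<Gamma> \<Longrightarrow> c \<in> V \<Longrightarrow> tr_trm \<Gamma> (\<lambda>e. c) (\<lambda>e. star c)"
  unfolding tr_trm_def by (auto intro!: exI[of _ "Cst c"])

lemma tr_trm_var [star_intros]: "valid_ctx \<Gamma> \<Longrightarrow> tr_trm (ext_ctx \<Gamma>) (\<lambda>e. snd e) (\<lambda>e. snd e)"
  unfolding tr_trm_def by (auto intro!: exI[of _ "Var (fst \<Gamma>)"] simp: ext_ctx_def valid_ctx_def)

lemma tr_trm_pair [star_intros]:
  assumes "tr_trm \<Gamma> s s'" "tr_trm \<Gamma> t t'"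
  shows "tr_trm \<Gamma> (\<lambda>e. opair (s e) (t e)) (\<lambda>e. opair (s' e) (t' e))"
proof -
  from assms obtain \<sigma> \<tau> where "set_trm \<sigma> \<subseteq> V" "trm_vars \<sigma> \<subseteq> {..<fst \<Gamma>}"
     "\<forall>v. s (snd \<Gamma> v) = trm_val v \<sigma> \<and> s' (snd \<Gamma> v) = trm_val v (map_trm star \<sigma>)"
     "set_trm \<tau> \<subseteq> V" "trm_vars \<tau> \<subseteq> {..<fst \<Gamma>}"
     "\<forall>v. t (snd \<Gamma> v) = trm_val v \<tau> \<and> t' (snd \<Gamma> v) = trm_val v (map_trm star \<tau>)"
    unfolding tr_trm_def by blast
  then show ?thesis using tr_trm_valid[OF assms(1)]
    unfolding tr_trm_def by (intro conjI exI[of _ "PairT \<sigma> \<tau>"]) auto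
qed

lemma tr_trm_app [star_intros]:
  assumes "tr_trm \<Gamma> s s'" "tr_trm \<Gamma> t t'"
  shows "tr_trm \<Gamma> (\<lambda>e. app (s e) (t e)) (\<lambda>e. app (s' e) (t' e))"
proof -
  from assms obtain \<sigma> \<tau> where "set_trm \<sigma> \<subseteq> V" "trm_vars \<sigma> \<subseteq> {..<fst \<Gamma>}"
     "\<forall>v. s (snd \<Gamma> v) = trm_val v \<sigma> \<and> s' (snd \<Gamma> v) = trm_val v (map_trm star \<sigma>)"
     "set_trm \<tau> \<subseteq> V" "trm_vars \<tau> \<subseteq> {..<fst \<Gamma>}"
     "\<forall>v. t (snd \<Gamma> v) = trm_val v \<tau> \<and> t' (snd \<Gamma> v) = trm_val v (map_trm star \<tau>)"
    unfolding tr_trm_def by blast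
  then show ?thesis using tr_trm_valid[OF assms(1)]
    unfolding tr_trm_def by (intro conjI exI[of _ "AppT \<sigma> \<tau>"]) auto
qed

lemma tr_trm_weaken [star_intros]:
  "tr_trm \<Gamma> t t' \<Longrightarrow> tr_trm (ext_ctx \<Gamma>) (\<lambda>e. t (fst e)) (\<lambda>e. t' (fst e))"
  unfolding tr_trm_def
  apply (elim conjE exE)
  subgoal for \<tau> by (intro conjI exI[of _ \<tau>]) (auto simp: ext_ctx_def valid_ctx_def)
  done

lemma tr_form_eq [star_intros]:
  assumes "tr_trm \<Gamma> s s'" "tr_trm \<Gamma> t t'"
  shows "tr_form \<Gamma> (\<lambda>e. s e = t e) (\<lambda>e. s' e = t' e)"
proof -
  from assms obtain \<sigma> \<tau> where "set_trm \<sigma> \<subseteq> V" "trm_vars \<sigma> \<subseteq> {..<fst \<Gamma>}"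
     "\<forall>v. s (snd \<Gamma> v) = trm_val v \<sigma> \<and> s' (snd \<Gamma> v) = trm_val v (map_trm star \<sigma>)"
     "set_trm \<tau> \<subseteq> V" "trm_vars \<tau> \<subseteq> {..<fst \<Gamma>}"
     "\<forall>v. t (snd \<Gamma> v) = trm_val v \<tau> \<and> t' (snd \<Gamma> v) = trm_val v (map_trm star \<tau>)"
    unfolding tr_trm_def by blast
  then show ?thesis using tr_trm_valid[OF assms(1)]
    unfolding tr_form_def by (intro conjI exI[of _ "Equal \<sigma> \<tau>"]) auto
qed

lemma tr_form_not [star_intros]: "tr_form \<Gamma> P P' \<Longrightarrow> tr_form \<Gamma> (\<lambda>e. \<not> P e) (\<lambda>e. \<not> P' e)"
  unfolding tr_form_def
  apply (elim conjE exE)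
  subgoal for p by (intro conjI exI[of _ "Neg p"]) auto
  done

lemma tr_form_and [star_intros]:
  assumes "tr_form \<Gamma> P P'" "tr_form \<Gamma> Q Q'"
  shows "tr_form \<Gamma> (\<lambda>e. P e \<and> Q e) (\<lambda>e. P' e \<and> Q' e)"
proof -
  from assms obtain p q where "set_formula p \<subseteq> V" "free_vars p \<subseteq> {..<fst \<Gamma>}"
     "\<forall>v. P (snd \<Gamma> v) = sat v p \<and> P' (snd \<Gamma> v) = sat v (map_formula star p)"
     "set_formula q \<subseteq> V" "free_vars q \<subseteq> {..<fst \<Gamma>}"
     "\<forall>v. Q (snd \<Gamma> v) = sat v q \<and> Q' (snd \<Gamma> v) = sat v (map_formula star q)"
    unfolding tr_form_def by blast
  then show ?thesis using tr_form_valid[OF assms(1)]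
    unfolding tr_form_def by (intro conjI exI[of _ "And p q"]) auto
qed

lemma tr_form_cong: "tr_form \<Gamma> P P' \<Longrightarrow> (\<And>e. P e = Q e) \<Longrightarrow> (\<And>e. P' e = Q' e) \<Longrightarrow> tr_form \<Gamma> Q Q'"
  by (simp add: tr_form_def)

lemma tr_form_or [star_intros]:
  assumes "tr_form \<Gamma> P P'" "tr_form \<Gamma> Q Q'" shows "tr_form \<Gamma> (\<lambda>e. P e \<or> Q e) (\<lambda>e. P' e \<or> Q' e)"
  using tr_form_not[OF tr_form_and[OF tr_form_not[OF assms(1)] tr_form_not[OF assms(2)]]] by simp

lemma tr_form_imp [star_intros]:
  assumes "tr_form \<Gamma> P P'" "tr_form \<Gamma> Q Q'" shows "tr_form \<Gamma> (\<lambda>e. P e \<longrightarrow> Q e) (\<lambda>e. P' e \<longrightarrow> Q' e)"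
  using tr_form_or[OF tr_form_not[OF assms(1)] assms(2)] by simp

lemma tr_form_iff [star_intros]:
  assumes "tr_form \<Gamma> P P'" "tr_form \<Gamma> Q Q'" shows "tr_form \<Gamma> (\<lambda>e. P e = Q e) (\<lambda>e. P' e = Q' e)"
  by (rule tr_form_cong[OF tr_form_and[OF tr_form_imp[OF assms] tr_form_imp[OF assms(2,1)]]]) blast+

lemma tr_form_ball_elems:
  assumes "tr_trm \<Gamma> t t'" "tr_form (ext_ctx \<Gamma>) (\<lambda>e. Q (fst e) (snd e)) (\<lambda>e. Q' (fst e) (snd e))"
  shows "tr_form \<Gamma> (\<lambda>e. \<forall>x\<in>elems (t e). Q e x) (\<lambda>e. \<forall>x\<in>elems (t' e). Q' e x)"
proof -
  from assms obtain \<tau> q where "set_trm \<tau> \<subseteq> V" "trm_vars \<tau> \<subseteq> {..<fst \<Gamma>}"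
     "\<forall>v. t (snd \<Gamma> v) = trm_val v \<tau> \<and> t' (snd \<Gamma> v) = trm_val v (map_trm star \<tau>)"
     "set_formula q \<subseteq> V" "free_vars q \<subseteq> {..<Suc (fst \<Gamma>)}"
     "\<forall>v. Q (snd \<Gamma> v) (v (fst \<Gamma>)) = sat v q \<and> Q' (snd \<Gamma> v) (v (fst \<Gamma>)) = sat v (map_formula star q)"
    unfolding tr_trm_def tr_form_def ext_ctx_def by auto
  then show ?thesis using tr_trm_valid[OF assms(1)]
    unfolding tr_form_def
    apply (intro conjI exI[of _ "BAll (fst \<Gamma>) \<tau> q"])
       apply (auto simp: less_Suc_eq)
       apply (metis fun_upd_same valid_upd)+
    done
qed

lemma tr_form_ball [star_intros]:
  assumes "tr_set \<Gamma> X X'" "tr_form (ext_ctx \<Gamma>) (\<lambda>e. Q (fst e) (snd e)) (\<lambda>e. Q' (fst e) (snd e))"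
  shows "tr_form \<Gamma> (\<lambda>e. \<forall>x\<in>X e. Q e x) (\<lambda>e. \<forall>x\<in>X' e. Q' e x)"
proof -
  obtain t t' R R' where t: "tr_trm \<Gamma> t t'" and R: "tr_form (ext_ctx \<Gamma>) R R'"
    and X: "\<forall>e. X e = {x \<in> elems (t e). R (e, x)}" "\<forall>e. X' e = {x \<in> elems (t' e). R' (e, x)}"
    using assms(1) unfolding tr_set_def by blast
  have "tr_form \<Gamma> (\<lambda>e. \<forall>x\<in>elems (t e). R (e, x) \<longrightarrow> Q e x) (\<lambda>e. \<forall>x\<in>elems (t' e). R' (e, x) \<longrightarrow> Q' e x)"
    using tr_form_ball_elems[OF t, of "\<lambda>e x. R (e, x) \<longrightarrow> Q e x" "\<lambda>e x. R' (e, x) \<longrightarrow> Q' e x"]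
      tr_form_imp[OF R assms(2)] by simp
  then show ?thesis by (rule tr_form_cong) (auto simp: X)
qed

lemma tr_form_bex [star_intros]:
  assumes "tr_set \<Gamma> X X'" "tr_form (ext_ctx \<Gamma>) (\<lambda>e. Q (fst e) (snd e)) (\<lambda>e. Q' (fst e) (snd e))"
  shows "tr_form \<Gamma> (\<lambda>e. \<exists>x\<in>X e. Q e x) (\<lambda>e. \<exists>x\<in>X' e. Q' e x)"
  using tr_form_not[OF tr_form_ball[OF assms(1) tr_form_not[OF assms(2)]]] by simp

lemma tr_set_elems [star_intros]:
  assumes "tr_trm \<Gamma> t t'" shows "tr_set \<Gamma> (\<lambda>e. elems (t e)) (\<lambda>e. elems (t' e))"
proof -
  have "tr_form (ext_ctx \<Gamma>) (\<lambda>e. snd e = snd e) (\<lambda>e. snd e = snd e)"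
    by (intro star_intros tr_trm_valid[OF assms])
  then show ?thesis using assms unfolding tr_set_def by fastforce
qed

lemma tr_set_valid: "tr_set \<Gamma> X X' \<Longrightarrow> valid_ctx \<Gamma>"
  unfolding tr_set_def using tr_trm_valid by blast

lemma tr_set_Collect [star_intros]:
  assumes "tr_set \<Gamma> X X'" "tr_form (ext_ctx \<Gamma>) (\<lambda>e. Q (fst e) (snd e)) (\<lambda>e. Q' (fst e) (snd e))"
  shows "tr_set \<Gamma> (\<lambda>e. {x \<in> X e. Q e x}) (\<lambda>e. {x \<in> X' e. Q' e x})"
proof -
  obtain t t' R R' where t: "tr_trm \<Gamma> t t'" and R: "tr_form (ext_ctx \<Gamma>) R R'"
    and X: "\<forall>e. X e = {x \<in> elems (t e). R (e, x)}" "\<forall>e. X' e = {x \<in> elems (t' e). R' (e, x)}"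
    using assms(1) unfolding tr_set_def by blast
  show ?thesis unfolding tr_set_def
    by (intro exI[of _ t] exI[of _ t'] exI[of _ "\<lambda>e. R e \<and> Q (fst e) (snd e)"]
        exI[of _ "\<lambda>e. R' e \<and> Q' (fst e) (snd e)"] conjI t tr_form_and R assms(2)) (auto simp: X)
qed

lemma tr_form_mem [star_intros]:
  assumes "tr_trm \<Gamma> x x'" "tr_set \<Gamma> X X'" shows "tr_form \<Gamma> (\<lambda>e. x e \<in> X e) (\<lambda>e. x' e \<in> X' e)"
proof -
  have "tr_form \<Gamma> (\<lambda>e. \<exists>y\<in>X e. y = x e) (\<lambda>e. \<exists>y\<in>X' e. y = x' e)"
    by (intro star_intros assms tr_trm_valid[OF assms(1)])
  then show ?thesis by (rule tr_form_cong) auto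
qed

text \<open>
  Unique existence is read as \<open>\<exists>z\<in>X. \<forall>x\<in>X. Q x \<longleftrightarrow> x = z\<close>; hence \<open>Q\<close> is needed in the context
  extended by both \<open>z\<close> and \<open>x\<close>, but only once.
\<close>

lemma tr_form_bex1 [star_intros]:
  assumes "tr_set \<Gamma> X X'"
    and "tr_set (ext_ctx \<Gamma>) (\<lambda>e. X (fst e)) (\<lambda>e. X' (fst e))"
    and "tr_form (ext_ctx (ext_ctx \<Gamma>)) (\<lambda>e. Q (fst (fst e)) (snd e)) (\<lambda>e. Q' (fst (fst e)) (snd e))"
  shows "tr_form \<Gamma> (\<lambda>e. \<exists>!x. x \<in> X e \<and> Q e x) (\<lambda>e. \<exists>!x. x \<in> X' e \<and> Q' e x)"
proof -
  have "tr_form \<Gamma> (\<lambda>e. \<exists>z\<in>X e. \<forall>x\<in>X e. Q e x \<longleftrightarrow> x = z) (\<lambda>e. \<exists>z\<in>X' e. \<forall>x\<in>X' e. Q' e x \<longleftrightarrow> x = z)"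
    by (intro star_intros assms tr_set_valid[OF assms(1)])
  moreover have "(\<exists>z\<in>Y. \<forall>x\<in>Y. R x \<longleftrightarrow> x = z) \<longleftrightarrow> (\<exists>!x. x \<in> Y \<and> R x)" for Y :: "'u set" and R
    by metis
  ultimately show ?thesis by (simp add: tr_form_cong)
qed

lemma tr_form_ex1_mem [star_intros]:
  assumes "tr_set \<Gamma> X X'" "tr_set (ext_ctx \<Gamma>) (\<lambda>e. X (fst e)) (\<lambda>e. X' (fst e))"
  shows "tr_form \<Gamma> (\<lambda>e. \<exists>!x. x \<in> X e) (\<lambda>e. \<exists>!x. x \<in> X' e)"
proof -
  have "tr_form \<Gamma> (\<lambda>e. \<exists>!x. x \<in> X e \<and> x = x) (\<lambda>e. \<exists>!x. x \<in> X' e \<and> x = x)"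
    by (intro star_intros assms tr_set_valid[OF assms(1)])
  then show ?thesis by simp
qed

text \<open>
  The transfer principle for a property without parameters.
\<close>

lemma transferI:
  assumes "tr_form closed_ctx (\<lambda>e. P) (\<lambda>e. P')" shows "P \<longleftrightarrow> P'"
proof -
  from assms obtain p where p: "set_formula p \<subseteq> V" "free_vars p = {}"
    "\<forall>v. P = sat v p \<and> P' = sat v (map_formula star p)"
    unfolding tr_form_def closed_ctx_def by auto
  then have "statement_in S p" by (simp add: statement_in_def)
  then have "sat v p \<longleftrightarrow> sat v (map_formula star p)" for v
    using enl unfolding enlargement_def by blast
  then show ?thesis using p(3) by blast
qed

lemma star_app: "f \<in> V \<Longrightarrow> x \<in> V \<Longrightarrow> app f x \<in> V \<Longrightarrow> star (app f x) = app (star f) (star x)"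
proof -
  assume "f \<in> V" "x \<in> V" "app f x \<in> V"
  note c = this
  have "app f x = app f x \<longleftrightarrow> star (app f x) = app (star f) (star x)"
    by (rule transferI) (intro star_intros c)
  then show ?thesis by simp
qed

end

section \<open>First-order form of the axioms\<close>

text \<open>
  An abelian group on a carrier whose neutral element is not named. In the characterizations of
  the categorical axioms below every quantifier ranges over objects or over a set of arrows.
\<close>

definition abgrp :: "'a set \<Rightarrow> ('a \<Rightarrow> 'a \<Rightarrow> 'a) \<Rightarrow> bool" where
  "abgrp X ad \<longleftrightarrow> (\<forall>x\<in>X. \<forall>y\<in>X. ad x y \<in> X \<and> ad x y = ad y x) \<and>
     (\<forall>x\<in>X. \<forall>y\<in>X. \<forall>z\<in>X. ad (ad x y) z = ad x (ad y z)) \<and>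
     (\<exists>z\<in>X. \<forall>x\<in>X. ad z x = x \<and> (\<exists>y\<in>X. ad y x = z))"

lemma comm_group_iff:
  "(\<exists>z. comm_group \<lparr>carrier = X, monoid.mult = ad, one = z\<rparr>) \<longleftrightarrow> abgrp X ad"
proof
  assume "\<exists>z. comm_group \<lparr>carrier = X, monoid.mult = ad, one = z\<rparr>"
  then obtain z where "comm_group \<lparr>carrier = X, monoid.mult = ad, one = z\<rparr>" by blast
  then interpret G: comm_group "\<lparr>carrier = X, monoid.mult = ad, one = z\<rparr>" .
  show "abgrp X ad"
    unfolding abgrp_def
    using G.m_closed G.m_comm G.m_assoc G.one_closed G.l_one G.l_inv_ex by simp metis
next
  assume A: "abgrp X ad"
  then obtain z where z: "z \<in> X" "\<forall>x\<in>X. ad z x = x \<and> (\<exists>y\<in>X. ad y x = z)"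
    unfolding abgrp_def by blast
  have "comm_group \<lparr>carrier = X, monoid.mult = ad, one = z\<rparr>"
    by (rule comm_groupI) (use A z in \<open>auto simp: abgrp_def\<close>)
  then show "\<exists>z. comm_group \<lparr>carrier = X, monoid.mult = ad, one = z\<rparr>" ..
qed

lemma abgrp_image:
  assumes "abgrp X ad" "h ` X = Y" "\<And>x y. x \<in> X \<Longrightarrow> y \<in> X \<Longrightarrow> ad' (h x) (h y) = h (ad x y)"
  shows "abgrp Y ad'"
proof -
  obtain z where z: "z \<in> X" "\<forall>x\<in>X. ad z x = x \<and> (\<exists>y\<in>X. ad y x = z)"
    using assms(1) unfolding abgrp_def by blast
  have "\<forall>x\<in>Y. ad' (h z) x = x \<and> (\<exists>y\<in>Y. ad' y x = h z)"
    using z assms(2,3) by (metis image_iff)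
  moreover have "h z \<in> Y" using z assms(2) by blast
  moreover have "(\<forall>x\<in>Y. \<forall>y\<in>Y. ad' x y \<in> Y \<and> ad' x y = ad' y x)"
    "(\<forall>x\<in>Y. \<forall>y\<in>Y. \<forall>z\<in>Y. ad' (ad' x y) z = ad' x (ad' y z))"
    using assms(1,3) unfolding assms(2)[symmetric] abgrp_def by auto
  ultimately show ?thesis unfolding abgrp_def by blast
qed

text \<open>
  The only idempotent of an abelian group is the neutral element.
\<close>

lemma abgrp_idem:
  assumes "abgrp X ad" "x \<in> X" "ad x x = x" "g \<in> X" shows "ad x g = g"
  using assms unfolding abgrp_def by metis

lemma abgrp_diff:
  assumes "abgrp X ad" "x \<in> X" "y \<in> X" shows "\<exists>d\<in>X. ad d y = x"
proof -
  obtain z where z: "z \<in> X" "\<forall>x\<in>X. ad z x = x \<and> (\<exists>y\<in>X. ad y x = z)"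
    using assms(1) unfolding abgrp_def by blast
  obtain y' where y': "y' \<in> X" "ad y' y = z" using z assms(3) by blast
  have "ad (ad x y') y = ad x (ad y' y)" using assms y'(1) unfolding abgrp_def by blast
  also have "\<dots> = ad x z" by (simp only: y'(2))
  also have "\<dots> = ad z x" using assms z(1) unfolding abgrp_def by blast
  also have "\<dots> = x" using z assms(2) by blast
  finally show ?thesis using assms y' unfolding abgrp_def by blast
qed

lemma category_iff: "category C \<longleftrightarrow>
    (\<forall>f\<in>arr C. src C f \<in> obj C \<and> tgt C f \<in> obj C) \<and> (\<forall>a\<in>obj C. idt C a \<in> mor C a a) \<and>
    (\<forall>f\<in>arr C. \<forall>g\<in>arr C. src C g = tgt C f \<longrightarrow> cmp C g f \<in> mor C (src C f) (tgt C g)) \<and>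
    (\<forall>f\<in>arr C. cmp C f (idt C (src C f)) = f \<and> cmp C (idt C (tgt C f)) f = f) \<and>
    (\<forall>f\<in>arr C. \<forall>g\<in>arr C. \<forall>h\<in>arr C. src C g = tgt C f \<and> src C h = tgt C g \<longrightarrow>
       cmp C h (cmp C g f) = cmp C (cmp C h g) f)"
  unfolding category_def mor_def by (intro iffI conjI allI impI ballI; force)

lemma preadditive_category_iff: "preadditive_category C \<longleftrightarrow> category C \<and>
    (\<forall>a\<in>obj C. \<forall>b\<in>obj C. abgrp (mor C a b) (padd C)) \<and>
    (\<forall>f\<in>arr C. \<forall>f'\<in>mor C (src C f) (tgt C f). \<forall>g\<in>arr C. src C g = tgt C f \<longrightarrow>
       cmp C g (padd C f f') = padd C (cmp C g f) (cmp C g f')) \<and>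
    (\<forall>f\<in>arr C. \<forall>g\<in>arr C. \<forall>g'\<in>mor C (src C g) (tgt C g). src C g = tgt C f \<longrightarrow>
       cmp C (padd C g g') f = padd C (cmp C g f) (cmp C g' f))"
  unfolding preadditive_category_def preadditive_category_axioms_def comm_group_iff mor_def
  by (intro iffI conjI allI impI ballI; simp)

lemma additive_category_iff: "additive_category C \<longleftrightarrow> preadditive_category C \<and>
    (\<exists>z\<in>obj C. zero_object C z) \<and>
    (\<forall>a\<in>obj C. \<forall>b\<in>obj C. \<exists>p\<in>obj C. \<exists>i\<in>arr C. \<exists>j\<in>arr C. \<exists>q\<in>arr C. \<exists>r\<in>arr C.
       is_biproduct C a b p i j q r)"
proof -
  have 1: "(\<exists>z. zero_object C z) \<longleftrightarrow> (\<exists>z\<in>obj C. zero_object C z)"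
    by (auto simp: zero_object_def)
  have 2: "(\<exists>p i j q r. is_biproduct C a b p i j q r) \<longleftrightarrow>
    (\<exists>p\<in>obj C. \<exists>i\<in>arr C. \<exists>j\<in>arr C. \<exists>q\<in>arr C. \<exists>r\<in>arr C. is_biproduct C a b p i j q r)" for a b
    unfolding is_biproduct_def mor_def by blast
  show ?thesis
    unfolding additive_category_def additive_category_axioms_def 1 2 by blast
qed

lemma monic_iff: "monic C f \<longleftrightarrow> f \<in> arr C \<and> (\<forall>g\<in>arr C. tgt C g = src C f \<longrightarrow>
    (\<forall>h\<in>mor C (src C g) (src C f). cmp C f g = cmp C f h \<longrightarrow> g = h))"
  unfolding monic_def mor_def by auto

lemma epic_iff: "epic C f \<longleftrightarrow> f \<in> arr C \<and> (\<forall>g\<in>arr C. src C g = tgt C f \<longrightarrow>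
    (\<forall>h\<in>mor C (tgt C f) (tgt C g). cmp C g f = cmp C h f \<longrightarrow> g = h))"
  unfolding epic_def mor_def by auto

lemma abelian_category_iff: "abelian_category C \<longleftrightarrow> additive_category C \<and>
    (\<forall>f\<in>arr C. (\<exists>k\<in>arr C. is_kernel C k f) \<and> (\<exists>k\<in>arr C. is_cokernel C k f)) \<and>
    (\<forall>f\<in>arr C. (monic C f \<longrightarrow> (\<exists>g\<in>arr C. is_kernel C f g)) \<and>
       (epic C f \<longrightarrow> (\<exists>g\<in>arr C. is_cokernel C f g)))"
proof -
  have k: "is_kernel C k f \<Longrightarrow> k \<in> arr C \<and> f \<in> arr C" "is_cokernel C k f \<Longrightarrow> k \<in> arr C \<and> f \<in> arr C"
    "monic C f \<Longrightarrow> f \<in> arr C" "epic C f \<Longrightarrow> f \<in> arr C" for k f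
    by (auto simp: is_kernel_def is_cokernel_def monic_def epic_def)
  show ?thesis
    unfolding abelian_category_def abelian_category_axioms_def by (meson k)
qed

lemma (in category) arr_mor: "f \<in> arr C \<Longrightarrow> f \<in> mor C (src C f) (tgt C f)"
  by (simp add: mor_def)

lemma is_functor_comp:
  assumes "is_functor C1 C2 F1" "is_functor C2 C3 F2" shows "is_functor C1 C3 (functor_comp F2 F1)"
  using assms unfolding is_functor_def functor_comp_def mor_def by simp

lemma full_subcategory_category:
  assumes "category C" shows "category (full_subcategory C T)"
proof -
  interpret category C by fact
  have m: "mor (full_subcategory C T) a b = (if a \<in> T \<and> b \<in> T then mor C a b else {})" for a b
    by (auto simp: mor_def full_subcategory_def)
  have c: "cmp (full_subcategory C T) = cmp C" "idt (full_subcategory C T) = idt C"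
    by (simp_all add: full_subcategory_def)
  show ?thesis
  proof
    fix f assume "f \<in> arr (full_subcategory C T)"
    then show "src (full_subcategory C T) f \<in> obj (full_subcategory C T)"
      "tgt (full_subcategory C T) f \<in> obj (full_subcategory C T)"
      using src_obj tgt_obj by (auto simp: full_subcategory_def)
  next
    fix a assume "a \<in> obj (full_subcategory C T)"
    then show "idt (full_subcategory C T) a \<in> mor (full_subcategory C T) a a"
      using idt_mor unfolding m by (auto simp: full_subcategory_def)
  qed (auto simp: m c split: if_splits intro: cmp_mor cmp_idt idt_cmp cmp_assoc)
qed

lemma (in preadditive_category) mor_abgrp: "a \<in> obj C \<Longrightarrow> b \<in> obj C \<Longrightarrow> abgrp (mor C a b) (padd C)"
  using mor_comm_group by (simp add: comm_group_iff[symmetric])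

lemma (in category) mor_obj: "f \<in> mor C a b \<Longrightarrow> a \<in> obj C \<and> b \<in> obj C \<and> f \<in> arr C \<and> src C f = a \<and> tgt C f = b"
  using src_obj tgt_obj by (auto simp: mor_def)

lemma (in preadditive_category) padd_mor:
  "f \<in> mor C a b \<Longrightarrow> g \<in> mor C a b \<Longrightarrow> padd C f g \<in> mor C a b"
  using mor_abgrp mor_obj unfolding abgrp_def by metis

section \<open>Isomorphisms of categories\<close>

lemma ex1_image:
  assumes "inj_on h X"
  shows "(\<exists>!y. y \<in> h ` X \<and> Q y) \<longleftrightarrow> (\<exists>!x. x \<in> X \<and> Q (h x))"
proof
  assume "\<exists>!y. y \<in> h ` X \<and> Q y"
  then obtain z where z: "z \<in> h ` X \<and> Q z" "\<forall>y. y \<in> h ` X \<and> Q y \<longrightarrow> y = z" by (rule ex1E)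
  then obtain x where x: "x \<in> X" "Q (h x)" "\<forall>y. y \<in> h ` X \<and> Q y \<longrightarrow> y = h x" by blast
  show "\<exists>!x. x \<in> X \<and> Q (h x)"
  proof (rule ex1I)
    show "x \<in> X \<and> Q (h x)" using x by simp
    fix y assume y: "y \<in> X \<and> Q (h y)"
    then have "h y = h x" using x(3) by blast
    then show "y = x" using assms x(1) y by (meson inj_onD)
  qed
next
  assume "\<exists>!x. x \<in> X \<and> Q (h x)"
  then obtain x where x: "x \<in> X \<and> Q (h x)" "\<forall>y. y \<in> X \<and> Q (h y) \<longrightarrow> y = x" by (rule ex1E)
  show "\<exists>!y. y \<in> h ` X \<and> Q y"
  proof (rule ex1I)
    show "h x \<in> h ` X \<and> Q (h x)" using x by blast
    fix y assume "y \<in> h ` X \<and> Q y"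
    then show "y = h x" using x(2) by blast
  qed
qed

text \<open>
  \<open>D\<close> is the image of \<open>C\<close> under relabellings of objects and arrows that are injective. Nothing else
  is assumed of \<open>D\<close>; all of its structure is transported from \<open>C\<close>.
\<close>

locale preadditive_iso = preadditive_category C
  for C :: "('o, 'm, 'x) lin_category_scheme" +
  fixes D :: "('p, 'n, 'y) lin_category_scheme" and \<phi> :: "'o \<Rightarrow> 'p" and \<psi> :: "'m \<Rightarrow> 'n"
  assumes obj_D: "obj D = \<phi> ` obj C" and inj_obj: "inj_on \<phi> (obj C)"
    and arr_D: "arr D = \<psi> ` arr C" and inj_arr: "inj_on \<psi> (arr C)"
    and src_D: "f \<in> arr C \<Longrightarrow> src D (\<psi> f) = \<phi> (src C f)"
    and tgt_D: "f \<in> arr C \<Longrightarrow> tgt D (\<psi> f) = \<phi> (tgt C f)"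
    and idt_D: "a \<in> obj C \<Longrightarrow> idt D (\<phi> a) = \<psi> (idt C a)"
    and cmp_D: "f \<in> arr C \<Longrightarrow> g \<in> arr C \<Longrightarrow> src C g = tgt C f \<Longrightarrow> cmp D (\<psi> g) (\<psi> f) = \<psi> (cmp C g f)"
    and padd_D: "f \<in> mor C a b \<Longrightarrow> g \<in> mor C a b \<Longrightarrow> padd D (\<psi> f) (\<psi> g) = \<psi> (padd C f g)"
begin

lemma obj_eq: "a \<in> obj C \<Longrightarrow> b \<in> obj C \<Longrightarrow> \<phi> a = \<phi> b \<longleftrightarrow> a = b"
  using inj_obj by (simp add: inj_on_eq_iff)

lemma arr_eq: "f \<in> arr C \<Longrightarrow> g \<in> arr C \<Longrightarrow> \<psi> f = \<psi> g \<longleftrightarrow> f = g"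
  using inj_arr by (simp add: inj_on_eq_iff)

lemma mor_D: "a \<in> obj C \<Longrightarrow> b \<in> obj C \<Longrightarrow> mor D (\<phi> a) (\<phi> b) = \<psi> ` mor C a b"
  unfolding mor_def arr_D using src_D tgt_D obj_eq src_obj tgt_obj by auto

lemma cmp_arr: "f \<in> arr C \<Longrightarrow> g \<in> arr C \<Longrightarrow> src C g = tgt C f \<Longrightarrow>
    cmp C g f \<in> arr C \<and> src C (cmp C g f) = src C f \<and> tgt C (cmp C g f) = tgt C g"
  using cmp_mor[of f "src C f" "tgt C f" g "tgt C g"] by (auto simp: mor_def)

lemma idt_arr: "a \<in> obj C \<Longrightarrow> idt C a \<in> arr C \<and> src C (idt C a) = a \<and> tgt C (idt C a) = a"
  using idt_mor by (auto simp: mor_def)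

lemma padd_arr: "f \<in> arr C \<Longrightarrow> g \<in> arr C \<Longrightarrow> src C g = src C f \<Longrightarrow> tgt C g = tgt C f \<Longrightarrow>
    padd C f g \<in> arr C \<and> src C (padd C f g) = src C f \<and> tgt C (padd C f g) = tgt C f"
  using padd_mor[of f "src C f" "tgt C f" g] by (auto simp: mor_def)

lemma padd_D': "f \<in> arr C \<Longrightarrow> g \<in> arr C \<Longrightarrow> src C g = src C f \<Longrightarrow> tgt C g = tgt C f \<Longrightarrow>
    padd D (\<psi> f) (\<psi> g) = \<psi> (padd C f g)"
  using padd_D[of f "src C f" "tgt C f" g] by (auto simp: mor_def)

lemmas iso_simps = obj_eq arr_eq src_D tgt_D idt_D cmp_D padd_D' cmp_arr idt_arr padd_arr
  src_obj tgt_obj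

lemma ball_mor: "a \<in> obj C \<Longrightarrow> b \<in> obj C \<Longrightarrow> (\<forall>f\<in>mor D (\<phi> a) (\<phi> b). Q f) \<longleftrightarrow> (\<forall>f\<in>mor C a b. Q (\<psi> f))"
  by (auto simp: mor_D)

lemma ex1_mor:
  assumes "a \<in> obj C" "b \<in> obj C"
  shows "(\<exists>!f. f \<in> mor D (\<phi> a) (\<phi> b) \<and> Q f) \<longleftrightarrow> (\<exists>!f. f \<in> mor C a b \<and> Q (\<psi> f))"
proof -
  have "inj_on \<psi> (mor C a b)" by (rule inj_on_subset[OF inj_arr]) (auto simp: mor_def)
  then show ?thesis unfolding mor_D[OF assms] by (rule ex1_image)
qed

lemma category_D: "category D"
proof -
  have ci: "cmp C f (idt C (src C f)) = f" "cmp C (idt C (tgt C f)) f = f" if "f \<in> arr C" for f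
    using that by (auto intro: cmp_idt[OF arr_mor] idt_cmp[OF arr_mor])
  have as: "cmp C h (cmp C g f) = cmp C (cmp C h g) f"
    if "f \<in> arr C" "g \<in> arr C" "h \<in> arr C" "src C g = tgt C f" "src C h = tgt C g" for f g h
    using that cmp_assoc[of f "src C f" "tgt C f" g "tgt C g" h "tgt C h"] by (simp add: mor_def)
  show ?thesis
    unfolding category_iff obj_D arr_D ball_simps mor_def mem_Collect_eq
    by (intro conjI ballI impI) (simp_all add: iso_simps ci as)
qed

lemma preadditive_D: "preadditive_category D"
  unfolding preadditive_category_iff
proof (intro conjI ballI impI category_D)
  fix a b assume "a \<in> obj D" "b \<in> obj D"
  then obtain a0 b0 where ab: "a = \<phi> a0" "b = \<phi> b0" "a0 \<in> obj C" "b0 \<in> obj C" by (auto simp: obj_D)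
  show "abgrp (mor D a b) (padd D)"
    unfolding ab(1,2) mor_D[OF ab(3,4)]
    by (rule abgrp_image[OF mor_abgrp[OF ab(3,4)] refl]) (simp add: padd_D)
next
  fix f f' g assume f: "f \<in> arr D" "f' \<in> mor D (src D f) (tgt D f)" "g \<in> arr D" "src D g = tgt D f"
  then obtain f0 f0' g0 where "f = \<psi> f0" "f' = \<psi> f0'" "g = \<psi> g0" "f0 \<in> arr C" "f0' \<in> arr C" "g0 \<in> arr C"
    by (auto simp: mor_def arr_D)
  then show "cmp D g (padd D f f') = padd D (cmp D g f) (cmp D g f')"
    using f cmp_padd_right[of f0 "src C f0" "tgt C f0" f0' g0 "tgt C g0"]
    by (auto simp: mor_def iso_simps)
next
  fix f f' g assume f: "g \<in> arr D" "f \<in> arr D" "f' \<in> mor D (src D f) (tgt D f)" "src D f = tgt D g"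
  then obtain f0 f0' g0 where "f = \<psi> f0" "f' = \<psi> f0'" "g = \<psi> g0" "f0 \<in> arr C" "f0' \<in> arr C" "g0 \<in> arr C"
    by (auto simp: mor_def arr_D)
  then show "cmp D (padd D f f') g = padd D (cmp D f g) (cmp D f' g)"
    using f cmp_padd_left[of g0 "src C g0" "tgt C g0" f0 "tgt C f0" f0']
    by (auto simp: mor_def iso_simps)
qed

lemma zero_arrow_D: "f \<in> arr C \<Longrightarrow> zero_arrow D (\<psi> f) \<longleftrightarrow> zero_arrow C f"
  unfolding zero_arrow_def
  by (auto simp: ball_mor iso_simps arr_D) (auto simp: mor_def iso_simps)

lemma is_kernel_D:
  assumes "k \<in> arr C" "f \<in> arr C" shows "is_kernel D (\<psi> k) (\<psi> f) \<longleftrightarrow> is_kernel C k f"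
proof -
  have e: "(u \<in> mor C (src C h) (src C k) \<and> cmp D (\<psi> k) (\<psi> u) = \<psi> h) \<longleftrightarrow>
      (u \<in> mor C (src C h) (src C k) \<and> cmp C k u = h)" if "h \<in> arr C" for h u
    using that assms by (auto simp: mor_def iso_simps)
  have z: "(tgt C h = src C f \<and> zero_arrow D (cmp D (\<psi> f) (\<psi> h))) \<longleftrightarrow>
      (tgt C h = src C f \<and> zero_arrow C (cmp C f h))" if "h \<in> arr C" for h
    using that assms by (auto simp: iso_simps zero_arrow_D)
  have "(\<forall>h\<in>arr C. tgt C h = src C f \<and> zero_arrow D (cmp D (\<psi> f) (\<psi> h)) \<longrightarrow>
        (\<exists>!u. u \<in> mor C (src C h) (src C k) \<and> cmp D (\<psi> k) (\<psi> u) = \<psi> h)) \<longleftrightarrow>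
      (\<forall>h\<in>arr C. tgt C h = src C f \<and> zero_arrow C (cmp C f h) \<longrightarrow>
        (\<exists>!u. u \<in> mor C (src C h) (src C k) \<and> cmp C k u = h))"
    by (intro ball_cong refl) (simp add: e z)
  then show ?thesis
    unfolding is_kernel_def arr_D using assms
    by (simp add: iso_simps zero_arrow_D ex1_mor cong: conj_cong)
qed

lemma is_cokernel_D:
  assumes "k \<in> arr C" "f \<in> arr C" shows "is_cokernel D (\<psi> k) (\<psi> f) \<longleftrightarrow> is_cokernel C k f"
proof -
  have e: "(u \<in> mor C (tgt C k) (tgt C h) \<and> cmp D (\<psi> u) (\<psi> k) = \<psi> h) \<longleftrightarrow>
      (u \<in> mor C (tgt C k) (tgt C h) \<and> cmp C u k = h)" if "h \<in> arr C" for h u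
    using that assms by (auto simp: mor_def iso_simps)
  have z: "(src C h = tgt C f \<and> zero_arrow D (cmp D (\<psi> h) (\<psi> f))) \<longleftrightarrow>
      (src C h = tgt C f \<and> zero_arrow C (cmp C h f))" if "h \<in> arr C" for h
    using that assms by (auto simp: iso_simps zero_arrow_D)
  have "(\<forall>h\<in>arr C. src C h = tgt C f \<and> zero_arrow D (cmp D (\<psi> h) (\<psi> f)) \<longrightarrow>
        (\<exists>!u. u \<in> mor C (tgt C k) (tgt C h) \<and> cmp D (\<psi> u) (\<psi> k) = \<psi> h)) \<longleftrightarrow>
      (\<forall>h\<in>arr C. src C h = tgt C f \<and> zero_arrow C (cmp C h f) \<longrightarrow>
        (\<exists>!u. u \<in> mor C (tgt C k) (tgt C h) \<and> cmp C u k = h))"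
    by (intro ball_cong refl) (simp add: e z)
  then show ?thesis
    unfolding is_cokernel_def arr_D using assms
    by (simp add: iso_simps zero_arrow_D ex1_mor cong: conj_cong)
qed

lemma short_exact_D:
  "f \<in> arr C \<Longrightarrow> g \<in> arr C \<Longrightarrow> short_exact D (\<psi> f) (\<psi> g) \<longleftrightarrow> short_exact C f g"
  by (simp add: short_exact_def is_kernel_D is_cokernel_D)

lemma monic_D: "f \<in> arr C \<Longrightarrow> monic D (\<psi> f) \<longleftrightarrow> monic C f"
  unfolding monic_iff arr_D by (auto simp: ball_mor iso_simps) (auto simp: mor_def iso_simps)

lemma epic_D: "f \<in> arr C \<Longrightarrow> epic D (\<psi> f) \<longleftrightarrow> epic C f"
  unfolding epic_iff arr_D by (auto simp: ball_mor iso_simps) (auto simp: mor_def iso_simps)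

lemma zero_object_D: "z \<in> obj C \<Longrightarrow> zero_object D (\<phi> z) \<longleftrightarrow> zero_object C z"
  unfolding zero_object_def obj_D
  using ex1_mor[of _ _ "\<lambda>_. True"] by simp

lemma is_biproduct_D:
  assumes "a \<in> obj C" "b \<in> obj C" "is_biproduct C a b p i j q r"
  shows "is_biproduct D (\<phi> a) (\<phi> b) (\<phi> p) (\<psi> i) (\<psi> j) (\<psi> q) (\<psi> r)"
  using assms unfolding is_biproduct_def mor_def by (auto simp: iso_simps obj_D arr_D)

lemma abelian_D:
  assumes "abelian_category C" shows "abelian_category D"
proof -
  interpret C: abelian_category C by fact
  have "additive_category D"
    unfolding additive_category_iff
  proof (intro conjI ballI preadditive_D)
    show "\<exists>z\<in>obj D. zero_object D z"
      using C.ex_zero_object zero_object_D by (auto simp: obj_D zero_object_def)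
    fix a b assume "a \<in> obj D" "b \<in> obj D"
    then obtain a0 b0 where ab: "a = \<phi> a0" "b = \<phi> b0" "a0 \<in> obj C" "b0 \<in> obj C" by (auto simp: obj_D)
    from C.ex_biproduct[OF ab(3,4)] obtain p i j q r where "is_biproduct C a0 b0 p i j q r" by blast
    from is_biproduct_D[OF ab(3,4) this] have "is_biproduct D a b (\<phi> p) (\<psi> i) (\<psi> j) (\<psi> q) (\<psi> r)"
      by (simp add: ab)
    then show "\<exists>p\<in>obj D. \<exists>i\<in>arr D. \<exists>j\<in>arr D. \<exists>q\<in>arr D. \<exists>r\<in>arr D. is_biproduct D a b p i j q r"
      unfolding is_biproduct_def mor_def by blast
  qed
  then show ?thesis
    using assms unfolding abelian_category_iff[of D] abelian_category_iff[of C] arr_D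
    by (auto simp: is_kernel_D is_cokernel_D monic_D epic_D)
qed

end

section \<open>Modules\<close>

text \<open>
  The axioms of an \<open>R\<close>-module for operations on a set; the ring axioms for \<open>R\<close> are not included.
\<close>

definition module_ops ::
    "('r, 'x) ring_scheme \<Rightarrow> 'm set \<Rightarrow> ('m \<Rightarrow> 'm \<Rightarrow> 'm) \<Rightarrow> ('r \<Rightarrow> 'm \<Rightarrow> 'm) \<Rightarrow> bool" where
  "module_ops R X ad sm \<longleftrightarrow> abgrp X ad \<and>
     (\<forall>r\<in>carrier R. \<forall>x\<in>X. sm r x \<in> X) \<and>
     (\<forall>r\<in>carrier R. \<forall>s\<in>carrier R. \<forall>x\<in>X. sm (r \<oplus>\<^bsub>R\<^esub> s) x = ad (sm r x) (sm s x)) \<and>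
     (\<forall>r\<in>carrier R. \<forall>x\<in>X. \<forall>y\<in>X. sm r (ad x y) = ad (sm r x) (sm r y)) \<and>
     (\<forall>r\<in>carrier R. \<forall>s\<in>carrier R. \<forall>x\<in>X. sm (r \<otimes>\<^bsub>R\<^esub> s) x = sm r (sm s x)) \<and>
     (\<forall>x\<in>X. sm \<one>\<^bsub>R\<^esub> x = x)"

lemma mk_module_simps [simp]:
  "carrier (mk_module R X ad sm) = X"
  "x \<in> X \<Longrightarrow> y \<in> X \<Longrightarrow> add (mk_module R X ad sm) x y = ad x y"
  "r \<in> carrier R \<Longrightarrow> x \<in> X \<Longrightarrow> smult (mk_module R X ad sm) r x = sm r x"
  by (simp_all add: mk_module_def)

lemma mk_module_cong:
  assumes "X = Y" "\<And>x y. x \<in> X \<Longrightarrow> y \<in> X \<Longrightarrow> ad x y = ad' x y"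
    "\<And>r x. r \<in> carrier R \<Longrightarrow> x \<in> X \<Longrightarrow> sm r x = sm' r x"
  shows "mk_module R X ad sm = mk_module R Y ad' sm'"
proof -
  have "(z \<in> X \<and> (\<forall>x\<in>X. ad z x = x)) = (z \<in> X \<and> (\<forall>x\<in>X. ad' z x = x))" for z
    using assms(2) by auto
  then show ?thesis using assms by (auto simp: mk_module_def fun_eq_iff)
qed

lemma mk_module_in_modules:
  assumes "ring R" "module_ops R X ad sm" shows "mk_module R X ad sm \<in> modules R"
proof -
  let ?M = "mk_module R X ad sm"
  have A: "abgrp X ad" using assms by (simp add: module_ops_def)
  then obtain z where z: "z \<in> X" "\<forall>x\<in>X. ad z x = x \<and> (\<exists>y\<in>X. ad y x = z)"
    unfolding abgrp_def by blast
  have "zero ?M = z"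
    unfolding mk_module_def using z A by (auto simp: abgrp_def intro!: the_equality)
  then have ag: "abelian_group ?M"
    using A z by (intro abelian_groupI) (auto simp: abgrp_def)
  interpret R: ring R by fact
  have "left_module R ?M"
    using assms ag A unfolding left_module_def left_module_axioms_def module_ops_def abgrp_def by simp
  moreover have "?M = mk_module R (carrier ?M) (add ?M) (smult ?M)"
    unfolding mk_module_simps(1) by (rule mk_module_cong) auto
  ultimately show ?thesis by (simp add: modules_def)
qed

lemma modulesD:
  assumes "M \<in> modules R"
  shows "left_module R M" "ring R" "abelian_group M"
    "M = mk_module R (carrier M) (add M) (smult M)" "module_ops R (carrier M) (add M) (smult M)"
proof -
  show l: "left_module R M" and "M = mk_module R (carrier M) (add M) (smult M)"
    using assms by (simp_all add: modules_def)
  then interpret left_module R M by simp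
  show "ring R" "abelian_group M" by unfold_locales
  have "\<exists>y\<in>carrier M. y \<oplus>\<^bsub>M\<^esub> x = \<zero>\<^bsub>M\<^esub>" if "x \<in> carrier M" for x
    using that by (intro bexI[of _ "\<ominus>\<^bsub>M\<^esub> x"]) (auto simp: M.l_neg)
  then have "\<exists>z\<in>carrier M. \<forall>x\<in>carrier M. z \<oplus>\<^bsub>M\<^esub> x = x \<and> (\<exists>y\<in>carrier M. y \<oplus>\<^bsub>M\<^esub> x = z)"
    by (intro bexI[of _ "\<zero>\<^bsub>M\<^esub>"]) auto
  then have "abgrp (carrier M) (add M)"
    unfolding abgrp_def by (auto simp: M.a_assoc intro: M.a_comm)
  then show "module_ops R (carrier M) (add M) (smult M)"
    unfolding module_ops_def
    by (simp add: smult_closed smult_l_distr smult_r_distr smult_assoc1 smult_one)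
qed

text \<open>
  A surjection that is compatible with the operations carries the module axioms along. This covers
  quotients as well as transport along bijections.
\<close>

lemma module_ops_image:
  assumes "module_ops R X ad sm" "h ` X = Y"
    and ad: "\<And>x y. x \<in> X \<Longrightarrow> y \<in> X \<Longrightarrow> ad' (h x) (h y) = h (ad x y)"
    and sm: "\<And>r x. r \<in> carrier R \<Longrightarrow> x \<in> X \<Longrightarrow> sm' r (h x) = h (sm r x)"
    and R: "ring R"
  shows "module_ops R Y ad' sm'"
proof -
  interpret ring R by fact
  have "abgrp Y ad'" by (rule abgrp_image[where X = X and ad = ad and h = h]) (use assms in \<open>auto simp: module_ops_def\<close>)
  then show ?thesis
    using assms(1) unfolding module_ops_def abgrp_def assms(2)[symmetric]
    by (simp add: ad sm)
qed

context left_module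
begin

lemma smult_r_zero: "r \<in> carrier R \<Longrightarrow> r \<odot>\<^bsub>M\<^esub> \<zero>\<^bsub>M\<^esub> = \<zero>\<^bsub>M\<^esub>"
  using smult_r_distr[of r "\<zero>\<^bsub>M\<^esub>" "\<zero>\<^bsub>M\<^esub>"] smult_closed[of r "\<zero>\<^bsub>M\<^esub>"]
  by (simp add: M.add.l_cancel_one')

lemma smult_r_minus:
  "r \<in> carrier R \<Longrightarrow> x \<in> carrier M \<Longrightarrow> r \<odot>\<^bsub>M\<^esub> (\<ominus>\<^bsub>M\<^esub> x) = \<ominus>\<^bsub>M\<^esub> (r \<odot>\<^bsub>M\<^esub> x)"
  using smult_r_distr[of r "\<ominus>\<^bsub>M\<^esub> x" x]
  by (simp add: M.l_neg smult_r_zero smult_closed M.minus_equality)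

end

lemma mod_homD:
  assumes "h \<in> mod_hom R M N"
  shows "x \<in> carrier M \<Longrightarrow> h x \<in> carrier N"
    "x \<in> carrier M \<Longrightarrow> y \<in> carrier M \<Longrightarrow> h (x \<oplus>\<^bsub>M\<^esub> y) = h x \<oplus>\<^bsub>N\<^esub> h y"
    "r \<in> carrier R \<Longrightarrow> x \<in> carrier M \<Longrightarrow> h (r \<odot>\<^bsub>M\<^esub> x) = r \<odot>\<^bsub>N\<^esub> h x"
  using assms by (auto simp: mod_hom_def)

lemma mod_hom_zero:
  assumes "h \<in> mod_hom R M N" "abelian_group M" "abelian_group N"
  shows "h \<zero>\<^bsub>M\<^esub> = \<zero>\<^bsub>N\<^esub>"
proof -
  interpret M: abelian_group M by fact
  interpret N: abelian_group N by fact
  show ?thesis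
    using mod_homD(2)[OF assms(1), of "\<zero>\<^bsub>M\<^esub>" "\<zero>\<^bsub>M\<^esub>"] mod_homD(1)[OF assms(1), of "\<zero>\<^bsub>M\<^esub>"]
    by (simp add: N.add.l_cancel_one')
qed

lemma mod_hom_minus:
  assumes "h \<in> mod_hom R M N" "abelian_group M" "abelian_group N" "x \<in> carrier M"
  shows "h (\<ominus>\<^bsub>M\<^esub> x) = \<ominus>\<^bsub>N\<^esub> h x"
proof -
  interpret M: abelian_group M by fact
  interpret N: abelian_group N by fact
  show ?thesis
    using mod_homD(2)[OF assms(1), of "\<ominus>\<^bsub>M\<^esub> x" x] mod_homD(1)[OF assms(1)] assms(4)
    by (simp add: M.l_neg mod_hom_zero[OF assms(1-3)] N.minus_equality)
qed

lemma LMod_simps [simp]: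
  "obj (LMod R) = modules R" "src (LMod R) = msrc" "tgt (LMod R) = mtgt"
  "idt (LMod R) M = \<lparr>msrc = M, mmap = (\<lambda>x\<in>carrier M. x), mtgt = M\<rparr>"
  "cmp (LMod R) g f = \<lparr>msrc = msrc f, mmap = compose (carrier (msrc f)) (mmap g) (mmap f), mtgt = mtgt g\<rparr>"
  "padd (LMod R) f g = \<lparr>msrc = msrc f,
     mmap = (\<lambda>x\<in>carrier (msrc f). mmap f x \<oplus>\<^bsub>mtgt f\<^esub> mmap g x), mtgt = mtgt f\<rparr>"
  by (simp_all add: LMod_def)

lemma LMod_arr_iff: "f \<in> arr (LMod R) \<longleftrightarrow> msrc f \<in> modules R \<and> mtgt f \<in> modules R \<and>
    mmap f \<in> mod_hom R (msrc f) (mtgt f) \<and> mmap f \<in> extensional (carrier (msrc f))"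
  by (simp add: LMod_def)

lemma LMod_mor_iff: "f \<in> mor (LMod R) M N \<longleftrightarrow> msrc f = M \<and> mtgt f = N \<and> M \<in> modules R \<and> N \<in> modules R \<and>
    mmap f \<in> mod_hom R M N \<and> mmap f \<in> extensional (carrier M)"
  by (auto simp: mor_def LMod_arr_iff)

lemma LMod_arr_eqI:
  assumes "f \<in> arr (LMod R)" "g \<in> arr (LMod R)" "msrc f = msrc g" "mtgt f = mtgt g"
    "\<And>x. x \<in> carrier (msrc f) \<Longrightarrow> mmap f x = mmap g x"
  shows "f = g"
proof -
  have "mmap f = mmap g"
    by (rule extensionalityI[of _ "carrier (msrc f)"]) (use assms in \<open>auto simp: LMod_arr_iff\<close>)
  then show ?thesis using assms by (intro mod_arrow.equality) auto
qed

lemma LMod_arr_restrict: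
  assumes "M \<in> modules R" "N \<in> modules R" "h \<in> mod_hom R M N"
  shows "\<lparr>msrc = M, mmap = restrict h (carrier M), mtgt = N\<rparr> \<in> mor (LMod R) M N"
proof -
  interpret left_module R M using modulesD(1) assms(1) .
  show ?thesis
    using assms by (auto simp: LMod_mor_iff mod_hom_def smult_closed)
qed

lemma mod_hom_compose: "h \<in> mod_hom R M N \<Longrightarrow> k \<in> mod_hom R N P \<Longrightarrow> (\<lambda>x. k (h x)) \<in> mod_hom R M P"
  by (auto simp: mod_hom_def Pi_iff)

lemma LMod_cmp_mor:
  assumes "f \<in> arr (LMod R)" "g \<in> arr (LMod R)" "msrc g = mtgt f"
  shows "\<lparr>msrc = msrc f, mmap = compose (carrier (msrc f)) (mmap g) (mmap f), mtgt = mtgt g\<rparr>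
     \<in> mor (LMod R) (msrc f) (mtgt g)"
  unfolding compose_def
  by (rule LMod_arr_restrict) (use assms in \<open>auto simp: LMod_arr_iff intro: mod_hom_compose\<close>)

lemma LMod_category:
  fixes R :: "('r, 'x) ring_scheme"
  shows "category (LMod R :: (('r, 'm) module, ('r, 'm) mod_arrow) lin_category)"
  unfolding category_iff
proof (intro conjI ballI impI)
  fix f g h :: "('r, 'm) mod_arrow" assume f: "f \<in> arr (LMod R)"
  show "src (LMod R) f \<in> obj (LMod R)" "tgt (LMod R) f \<in> obj (LMod R)"
    using f by (auto simp: LMod_arr_iff)
  have c: "mmap f x \<in> carrier (mtgt f)" if "x \<in> carrier (msrc f)" for x
    using f that by (auto simp: LMod_arr_iff mod_hom_def)
  show "cmp (LMod R) f (idt (LMod R) (src (LMod R) f)) = f"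
    "cmp (LMod R) (idt (LMod R) (tgt (LMod R) f)) f = f"
    by (rule mod_arrow.equality; use f c in
      \<open>auto simp: LMod_arr_iff compose_def restrict_def extensional_def fun_eq_iff\<close>)+
  assume g: "g \<in> arr (LMod R)"
  show "src (LMod R) g = tgt (LMod R) f \<Longrightarrow> cmp (LMod R) g f \<in> mor (LMod R) (src (LMod R) f) (tgt (LMod R) g)"
    using LMod_cmp_mor[OF f g] by simp
  show "cmp (LMod R) h (cmp (LMod R) g f) = cmp (LMod R) (cmp (LMod R) h g) f"
    if "src (LMod R) g = tgt (LMod R) f \<and> src (LMod R) h = tgt (LMod R) g"
    using that c by (auto simp: compose_def fun_eq_iff restrict_def)
next
  fix M :: "('r, 'm) module" assume M: "M \<in> obj (LMod R)"
  then have "(\<lambda>x. x) \<in> mod_hom R M M" by (simp add: mod_hom_def)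
  then show "idt (LMod R) M \<in> mor (LMod R) M M"
    using LMod_arr_restrict M by fastforce
qed

lemma LMod_zero_mor:
  assumes "M \<in> modules R" "N \<in> modules R"
  shows "\<lparr>msrc = M, mmap = (\<lambda>x\<in>carrier M. \<zero>\<^bsub>N\<^esub>), mtgt = N\<rparr> \<in> mor (LMod R) M N"
proof -
  interpret left_module R N using modulesD(1) assms(2) .
  have "(\<lambda>x. \<zero>\<^bsub>N\<^esub>) \<in> mod_hom R M N" by (simp add: mod_hom_def smult_r_zero)
  then show ?thesis using LMod_arr_restrict assms by fastforce
qed

lemma LMod_mor_abgrp:
  assumes "M \<in> modules R" "N \<in> modules R"
  shows "abgrp (mor (LMod R) M N) (padd (LMod R))"
proof -
  interpret M: left_module R M using modulesD(1) assms(1) .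
  interpret N: left_module R N using modulesD(1) assms(2) .
  let ?z = "\<lparr>msrc = M, mmap = (\<lambda>x\<in>carrier M. \<zero>\<^bsub>N\<^esub>), mtgt = N\<rparr>"
  have z: "?z \<in> mor (LMod R) M N" using LMod_zero_mor assms by blast
  have cl: "padd (LMod R) f g \<in> mor (LMod R) M N"
    if "f \<in> mor (LMod R) M N" "g \<in> mor (LMod R) M N" for f g
  proof -
    have "(\<lambda>x. mmap f x \<oplus>\<^bsub>N\<^esub> mmap g x) \<in> mod_hom R M N"
      using that by (auto simp: LMod_mor_iff mod_hom_def Pi_iff N.smult_closed N.smult_r_distr N.M.a_ac)
    then show ?thesis using LMod_arr_restrict[OF assms] that by (auto simp: LMod_mor_iff)
  qed
  have c: "mmap f x \<in> carrier N" if "f \<in> mor (LMod R) M N" "x \<in> carrier M" for f x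
    using that by (auto simp: LMod_mor_iff mod_hom_def)
  have mn: "msrc f = M" "mtgt f = N" if "f \<in> mor (LMod R) M N" for f
    using that by (auto simp: LMod_mor_iff)
  have zf: "padd (LMod R) ?z f = f" if f: "f \<in> mor (LMod R) M N" for f
    by (rule LMod_arr_eqI[where R = R]) (use f z cl[OF z f] mn[OF f] c[OF f] in \<open>auto simp: mor_def\<close>)
  have ng: "\<exists>g\<in>mor (LMod R) M N. padd (LMod R) g f = ?z" if f: "f \<in> mor (LMod R) M N" for f
  proof -
    have "(\<lambda>x. \<ominus>\<^bsub>N\<^esub> mmap f x) \<in> mod_hom R M N"
      using f by (auto simp: LMod_mor_iff mod_hom_def Pi_iff N.smult_closed N.smult_r_minus N.M.minus_add)
    from LMod_arr_restrict[OF assms this]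
    have g: "\<lparr>msrc = M, mmap = (\<lambda>x\<in>carrier M. \<ominus>\<^bsub>N\<^esub> mmap f x), mtgt = N\<rparr> \<in> mor (LMod R) M N" (is "?g \<in> _") .
    have "padd (LMod R) ?g f = ?z"
      by (rule LMod_arr_eqI[where R = R])
        (use f z g cl[OF g f] mn[OF f] c[OF f] in \<open>auto simp: mor_def N.M.l_neg\<close>)
    then show ?thesis using g by blast
  qed
  have comm: "padd (LMod R) f g = padd (LMod R) g f"
    if "f \<in> mor (LMod R) M N" "g \<in> mor (LMod R) M N" for f g
    using mn[OF that(1)] mn[OF that(2)] c[OF that(1)] c[OF that(2)]
    by (auto simp: fun_eq_iff restrict_def N.M.a_comm)
  have assoc: "padd (LMod R) (padd (LMod R) f g) h = padd (LMod R) f (padd (LMod R) g h)"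
    if "f \<in> mor (LMod R) M N" "g \<in> mor (LMod R) M N" "h \<in> mor (LMod R) M N" for f g h
    using mn[OF that(1)] mn[OF that(2)] c[OF that(1)] c[OF that(2)] c[OF that(3)]
    by (auto simp: fun_eq_iff restrict_def N.M.a_assoc)
  show ?thesis
    unfolding abgrp_def using z cl zf ng comm assoc by blast
qed

lemma LMod_preadditive:
  fixes R :: "('r, 'x) ring_scheme"
  shows "preadditive_category (LMod R :: (('r, 'm) module, ('r, 'm) mod_arrow) lin_category)"
  unfolding preadditive_category_iff
proof (intro conjI ballI impI LMod_category)
  fix M N :: "('r, 'm) module" assume "M \<in> obj (LMod R)" "N \<in> obj (LMod R)"
  then show "abgrp (mor (LMod R) M N) (padd (LMod R))" by (simp add: LMod_mor_abgrp)
qed (auto simp: mor_def LMod_arr_iff mod_hom_def Pi_iff compose_def restrict_def fun_eq_iff)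

lemma LMod_zero_arrow_iff:
  assumes "f \<in> arr (LMod R)"
  shows "zero_arrow (LMod R) f \<longleftrightarrow> (\<forall>x\<in>carrier (msrc f). mmap f x = \<zero>\<^bsub>mtgt f\<^esub>)"
proof
  from assms have mod: "msrc f \<in> modules R" "mtgt f \<in> modules R" by (auto simp: LMod_arr_iff)
  interpret N: left_module R "mtgt f" using modulesD(1) mod(2) .
  {
    assume "zero_arrow (LMod R) f"
    then have "padd (LMod R) f f = f" using assms by (simp add: zero_arrow_def mor_def)
    from arg_cong[OF this, of mmap] have "mmap f x \<oplus>\<^bsub>mtgt f\<^esub> mmap f x = mmap f x" if "x \<in> carrier (msrc f)" for x
      using that by (simp add: fun_eq_iff restrict_def) metis
    then show "\<forall>x\<in>carrier (msrc f). mmap f x = \<zero>\<^bsub>mtgt f\<^esub>"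
      using assms by (auto simp: LMod_arr_iff mod_hom_def Pi_iff)
  next
    assume z: "\<forall>x\<in>carrier (msrc f). mmap f x = \<zero>\<^bsub>mtgt f\<^esub>"
    have "padd (LMod R) f g = g" if "g \<in> mor (LMod R) (msrc f) (mtgt f)" for g
    proof (rule LMod_arr_eqI[where R = R])
      show "padd (LMod R) f g \<in> arr (LMod R)"
        using LMod_mor_abgrp[OF mod] that assms unfolding abgrp_def mor_def by force
    qed (use that z mod_homD(1)[of "mmap g" R "msrc f" "mtgt f"] in \<open>auto simp: LMod_mor_iff LMod_arr_iff\<close>)
    then show "zero_arrow (LMod R) f" using assms by (simp add: zero_arrow_def)
  }
qed

text \<open>
  Injectivity and exactness in the middle, both elementwise, make an arrow a kernel; the next lemma
  is the dual statement.
\<close>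

lemma LMod_is_kernelI:
  assumes k: "k \<in> arr (LMod R)" and f: "f \<in> arr (LMod R)" and kf: "mtgt k = msrc f"
    and inj: "inj_on (mmap k) (carrier (msrc k))"
    and im: "mmap k ` carrier (msrc k) = {x \<in> carrier (msrc f). mmap f x = \<zero>\<^bsub>mtgt f\<^esub>}"
  shows "is_kernel (LMod R) k f"
  unfolding is_kernel_def
proof (intro conjI ballI impI k f)
  let ?K = "msrc k"
  have K: "?K \<in> modules R" and kh: "mmap k \<in> mod_hom R ?K (msrc f)" using k kf by (auto simp: LMod_arr_iff)
  interpret K: left_module R ?K using modulesD(1) K .
  show "tgt (LMod R) k = src (LMod R) f" by (simp add: kf)
  have kfa: "cmp (LMod R) f k \<in> arr (LMod R)" using LMod_cmp_mor[OF k f] kf by (simp add: mor_def)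
  show "zero_arrow (LMod R) (cmp (LMod R) f k)"
    unfolding LMod_zero_arrow_iff[OF kfa] using im by (auto simp: compose_def)
  fix h assume h: "h \<in> arr (LMod R)" and "tgt (LMod R) h = src (LMod R) f \<and> zero_arrow (LMod R) (cmp (LMod R) f h)"
  then have hf: "mtgt h = msrc f" and z: "zero_arrow (LMod R) (cmp (LMod R) f h)" by auto
  have "cmp (LMod R) f h \<in> arr (LMod R)" using LMod_cmp_mor[OF h f] hf by (simp add: mor_def)
  from z[unfolded LMod_zero_arrow_iff[OF this]]
  have hz: "mmap f (mmap h x) = \<zero>\<^bsub>mtgt f\<^esub>" if "x \<in> carrier (msrc h)" for x
    using that by (simp add: compose_def)
  have hh: "mmap h \<in> mod_hom R (msrc h) (msrc f)" "msrc h \<in> modules R" using h hf by (auto simp: LMod_arr_iff)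
  interpret H: left_module R "msrc h" using modulesD(1) hh(2) .
  define u where "u = (\<lambda>x. inv_into (carrier ?K) (mmap k) (mmap h x))"
  have "mmap h x \<in> mmap k ` carrier ?K" if "x \<in> carrier (msrc h)" for x
    unfolding im using hz[OF that] mod_homD(1)[OF hh(1) that] by simp
  then have u: "u x \<in> carrier ?K" "mmap k (u x) = mmap h x" if "x \<in> carrier (msrc h)" for x
    unfolding u_def using that by (auto intro: inv_into_into f_inv_into_f)
  have uu: "u x = y" if "x \<in> carrier (msrc h)" "y \<in> carrier ?K" "mmap k y = mmap h x" for x y
    using inj_onD[OF inj, of "u x" y] that u by auto
  have "u \<in> mod_hom R (msrc h) ?K"
    unfolding mod_hom_def
    by (auto simp: u mod_homD[OF kh] mod_homD[OF hh(1)] K.smult_closed H.smult_closed intro!: uu)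
  from LMod_arr_restrict[OF hh(2) K this]
  have ua: "\<lparr>msrc = msrc h, mmap = restrict u (carrier (msrc h)), mtgt = ?K\<rparr> \<in> mor (LMod R) (msrc h) ?K"
    (is "?u \<in> _") .
  have ku: "cmp (LMod R) k ?u = h"
    by (rule mod_arrow.equality)
      (use h hf kf u in \<open>auto simp: LMod_arr_iff compose_def fun_eq_iff restrict_def extensional_def\<close>)
  have uniq: "w = ?u" if w: "w \<in> mor (LMod R) (msrc h) ?K" "cmp (LMod R) k w = h" for w
  proof (rule LMod_arr_eqI[where R = R])
    fix x assume "x \<in> carrier (msrc w)"
    with w have x: "x \<in> carrier (msrc h)" by (simp add: LMod_mor_iff)
    have "mmap k (mmap w x) = mmap h x"
      using arg_cong[OF w(2), of "\<lambda>v. mmap v x"] w(1) x by (simp add: compose_def LMod_mor_iff)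
    moreover have "mmap w x \<in> carrier ?K" using w x by (auto simp: LMod_mor_iff mod_hom_def)
    ultimately show "mmap w x = mmap ?u x" using uu x by simp
  qed (use w ua in \<open>auto simp: mor_def\<close>)
  show "\<exists>!u. u \<in> mor (LMod R) (src (LMod R) h) (src (LMod R) k) \<and> cmp (LMod R) k u = h"
    unfolding LMod_simps(2) by (rule ex1I[of _ ?u]) (use ua ku uniq in blast)+
qed

lemma LMod_is_cokernelI:
  assumes k: "k \<in> arr (LMod R)" and f: "f \<in> arr (LMod R)" and kf: "msrc k = mtgt f"
    and surj: "mmap k ` carrier (msrc k) = carrier (mtgt k)"
    and im: "mmap f ` carrier (msrc f) = {x \<in> carrier (msrc k). mmap k x = \<zero>\<^bsub>mtgt k\<^esub>}"
  shows "is_cokernel (LMod R) k f"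
  unfolding is_cokernel_def
proof (intro conjI ballI impI k f)
  let ?K = "mtgt k" and ?N = "msrc k"
  have K: "?K \<in> modules R" "?N \<in> modules R" and kh: "mmap k \<in> mod_hom R ?N ?K"
    using k by (auto simp: LMod_arr_iff)
  interpret K: left_module R ?K using modulesD(1) K(1) .
  interpret N: left_module R ?N using modulesD(1) K(2) .
  show "src (LMod R) k = tgt (LMod R) f" by (simp add: kf)
  have kfa: "cmp (LMod R) k f \<in> arr (LMod R)" using LMod_cmp_mor[OF f k] kf by (simp add: mor_def)
  show "zero_arrow (LMod R) (cmp (LMod R) k f)"
    unfolding LMod_zero_arrow_iff[OF kfa] using im by (auto simp: compose_def)
  fix h assume h: "h \<in> arr (LMod R)" and "src (LMod R) h = tgt (LMod R) f \<and> zero_arrow (LMod R) (cmp (LMod R) h f)"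
  then have hf: "msrc h = ?N" and z: "zero_arrow (LMod R) (cmp (LMod R) h f)" using kf by auto
  have "cmp (LMod R) h f \<in> arr (LMod R)" using LMod_cmp_mor[OF f h] hf kf by (simp add: mor_def)
  from z[unfolded LMod_zero_arrow_iff[OF this]]
  have hz: "mmap h (mmap f x) = \<zero>\<^bsub>mtgt h\<^esub>" if "x \<in> carrier (msrc f)" for x
    using that by (simp add: compose_def)
  have hh: "mmap h \<in> mod_hom R ?N (mtgt h)" "mtgt h \<in> modules R" using h hf by (auto simp: LMod_arr_iff)
  interpret H: left_module R "mtgt h" using modulesD(1) hh(2) .
  have ker: "mmap h x = mmap h y" if xy: "x \<in> carrier ?N" "y \<in> carrier ?N" "mmap k x = mmap k y" for x y
  proof -
    let ?d = "x \<oplus>\<^bsub>?N\<^esub> \<ominus>\<^bsub>?N\<^esub> y"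
    have "mmap k ?d = \<zero>\<^bsub>?K\<^esub>"
      using xy by (simp add: mod_homD[OF kh] mod_hom_minus[OF kh] N.M.abelian_group_axioms
          K.M.abelian_group_axioms K.M.r_neg)
    then have "?d \<in> mmap f ` carrier (msrc f)" using xy by (simp add: im)
    then have "mmap h ?d = \<zero>\<^bsub>mtgt h\<^esub>" using hz by auto
    then have "mmap h x \<oplus>\<^bsub>mtgt h\<^esub> \<ominus>\<^bsub>mtgt h\<^esub> mmap h y = \<zero>\<^bsub>mtgt h\<^esub>"
      using xy by (simp add: mod_homD[OF hh(1)] mod_hom_minus[OF hh(1)] N.M.abelian_group_axioms
          H.M.abelian_group_axioms)
    then show ?thesis
      using xy mod_homD(1)[OF hh(1)] by (metis H.M.minus_equality H.M.minus_minus H.M.add.inv_closed)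
  qed
  define u where "u = (\<lambda>y. mmap h (inv_into (carrier ?N) (mmap k) y))"
  have u: "u (mmap k x) = mmap h x" if "x \<in> carrier ?N" for x
    unfolding u_def by (rule ker) (use that in \<open>auto intro: inv_into_into f_inv_into_f\<close>)
  have "u \<in> mod_hom R ?K (mtgt h)"
    unfolding mod_hom_def surj[symmetric]
    by (auto simp: u mod_homD[OF hh(1)] mod_homD(2,3)[OF kh, symmetric] N.smult_closed)
  from LMod_arr_restrict[OF K(1) hh(2) this]
  have ua: "\<lparr>msrc = ?K, mmap = restrict u (carrier ?K), mtgt = mtgt h\<rparr> \<in> mor (LMod R) ?K (mtgt h)"
    (is "?u \<in> _") .
  have ku: "cmp (LMod R) ?u k = h"
    by (rule mod_arrow.equality)
      (use h hf kf u mod_homD(1)[OF kh] in \<open>auto simp: LMod_arr_iff compose_def fun_eq_iff restrict_def extensional_def\<close>)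
  have uniq: "w = ?u" if w: "w \<in> mor (LMod R) ?K (mtgt h)" "cmp (LMod R) w k = h" for w
  proof (rule LMod_arr_eqI[where R = R])
    fix x assume "x \<in> carrier (msrc w)"
    with w have "x \<in> carrier ?K" by (simp add: LMod_mor_iff)
    then obtain y where y: "y \<in> carrier ?N" "x = mmap k y" using surj by auto
    have "mmap w (mmap k y) = mmap h y"
      using arg_cong[OF w(2), of "\<lambda>v. mmap v y"] w(1) y by (simp add: compose_def LMod_mor_iff)
    then show "mmap w x = mmap ?u x" using y u mod_homD(1)[OF kh] by simp
  qed (use w ua in \<open>auto simp: mor_def\<close>)
  show "\<exists>!u. u \<in> mor (LMod R) (tgt (LMod R) k) (tgt (LMod R) h) \<and> cmp (LMod R) u k = h"
    unfolding LMod_simps(3) by (rule ex1I[of _ ?u]) (use ua ku uniq in blast)+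
qed

text \<open>
  The elements of a quotient are represented by chosen members of the cosets, so that the quotient
  has elements of the same type and is an object of the same category.
\<close>

lemma ex_quotient_module:
  assumes P: "P \<in> modules R" and H: "H \<subseteq> carrier P" "\<zero>\<^bsub>P\<^esub> \<in> H"
    "\<And>x y. x \<in> H \<Longrightarrow> y \<in> H \<Longrightarrow> x \<oplus>\<^bsub>P\<^esub> y \<in> H" "\<And>x. x \<in> H \<Longrightarrow> \<ominus>\<^bsub>P\<^esub> x \<in> H"
    "\<And>r x. r \<in> carrier R \<Longrightarrow> x \<in> H \<Longrightarrow> r \<odot>\<^bsub>P\<^esub> x \<in> H"
  shows "\<exists>Q q. Q \<in> modules R \<and> q \<in> mor (LMod R) P Q \<and>
    (\<forall>x\<in>carrier P. mmap q x = \<zero>\<^bsub>Q\<^esub> \<longleftrightarrow> x \<in> H)"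
proof -
  interpret P: left_module R P using modulesD(1) P .
  \<comment> \<open>\<open>rep\<close> picks one representative of each coset of \<open>H\<close>.\<close>
  define rep where "rep x = (SOME y. y \<in> carrier P \<and> (\<exists>h\<in>H. y = h \<oplus>\<^bsub>P\<^esub> x))" for x
  have rep: "rep x \<in> carrier P \<and> (\<exists>h\<in>H. rep x = h \<oplus>\<^bsub>P\<^esub> x)" if "x \<in> carrier P" for x
    unfolding rep_def
    by (rule someI[of _ x]) (use H(2) that in \<open>auto intro!: bexI[of _ "\<zero>\<^bsub>P\<^esub>"]\<close>)
  have rep_eq: "rep (h \<oplus>\<^bsub>P\<^esub> x) = rep x" if "h \<in> H" "x \<in> carrier P" for h x
  proof -
    have "(\<exists>k\<in>H. y = k \<oplus>\<^bsub>P\<^esub> (h \<oplus>\<^bsub>P\<^esub> x)) \<longleftrightarrow> (\<exists>k\<in>H. y = k \<oplus>\<^bsub>P\<^esub> x)" for y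
    proof
      assume "\<exists>k\<in>H. y = k \<oplus>\<^bsub>P\<^esub> (h \<oplus>\<^bsub>P\<^esub> x)"
      then obtain k where "k \<in> H" "y = k \<oplus>\<^bsub>P\<^esub> (h \<oplus>\<^bsub>P\<^esub> x)" by blast
      then show "\<exists>k\<in>H. y = k \<oplus>\<^bsub>P\<^esub> x"
        using that H by (intro bexI[of _ "k \<oplus>\<^bsub>P\<^esub> h"]) (auto simp: P.M.a_assoc subset_iff)
    next
      assume "\<exists>k\<in>H. y = k \<oplus>\<^bsub>P\<^esub> x"
      then obtain k where k: "k \<in> H" "y = k \<oplus>\<^bsub>P\<^esub> x" by blast
      have "k \<in> carrier P" "h \<in> carrier P" using k that H by auto
      then have "(k \<oplus>\<^bsub>P\<^esub> \<ominus>\<^bsub>P\<^esub> h) \<oplus>\<^bsub>P\<^esub> (h \<oplus>\<^bsub>P\<^esub> x) = k \<oplus>\<^bsub>P\<^esub> x"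
        using that by (simp add: P.M.a_assoc P.M.r_neg1)
      then show "\<exists>k\<in>H. y = k \<oplus>\<^bsub>P\<^esub> (h \<oplus>\<^bsub>P\<^esub> x)"
        using k that H by (intro bexI[of _ "k \<oplus>\<^bsub>P\<^esub> \<ominus>\<^bsub>P\<^esub> h"]) auto
    qed
    then show ?thesis by (simp add: rep_def)
  qed
  have rep_add: "rep (rep x \<oplus>\<^bsub>P\<^esub> rep y) = rep (x \<oplus>\<^bsub>P\<^esub> y)" if xy: "x \<in> carrier P" "y \<in> carrier P" for x y
  proof -
    obtain h k where hk: "h \<in> H" "rep x = h \<oplus>\<^bsub>P\<^esub> x" "k \<in> H" "rep y = k \<oplus>\<^bsub>P\<^esub> y"
      using rep[OF xy(1)] rep[OF xy(2)] by blast
    have "h \<in> carrier P" "k \<in> carrier P" using hk H by auto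
    then have "rep x \<oplus>\<^bsub>P\<^esub> rep y = (h \<oplus>\<^bsub>P\<^esub> k) \<oplus>\<^bsub>P\<^esub> (x \<oplus>\<^bsub>P\<^esub> y)"
      using that by (simp add: hk P.M.a_ac)
    then show ?thesis using rep_eq[of "h \<oplus>\<^bsub>P\<^esub> k" "x \<oplus>\<^bsub>P\<^esub> y"] hk H that by simp
  qed
  have rep_smult: "rep (r \<odot>\<^bsub>P\<^esub> rep x) = rep (r \<odot>\<^bsub>P\<^esub> x)" if rx: "r \<in> carrier R" "x \<in> carrier P" for r x
  proof -
    obtain h where hk: "h \<in> H" "rep x = h \<oplus>\<^bsub>P\<^esub> x"
      using rep[OF rx(2)] by blast
    have "h \<in> carrier P" using hk H by auto
    then have "r \<odot>\<^bsub>P\<^esub> rep x = (r \<odot>\<^bsub>P\<^esub> h) \<oplus>\<^bsub>P\<^esub> (r \<odot>\<^bsub>P\<^esub> x)"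
      using that by (simp add: hk P.smult_r_distr)
    then show ?thesis using rep_eq[of "r \<odot>\<^bsub>P\<^esub> h" "r \<odot>\<^bsub>P\<^esub> x"] hk H that by (simp add: P.smult_closed)
  qed
  define Q where "Q = mk_module R (rep ` carrier P) (\<lambda>x y. rep (x \<oplus>\<^bsub>P\<^esub> y)) (\<lambda>r x. rep (r \<odot>\<^bsub>P\<^esub> x))"
  have "module_ops R (rep ` carrier P) (\<lambda>x y. rep (x \<oplus>\<^bsub>P\<^esub> y)) (\<lambda>r x. rep (r \<odot>\<^bsub>P\<^esub> x))"
    by (rule module_ops_image[OF modulesD(5)[OF P] refl]) (use rep_add rep_smult modulesD(2)[OF P] in auto)
  then have Q: "Q \<in> modules R" unfolding Q_def by (rule mk_module_in_modules[OF modulesD(2)[OF P]])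
  interpret Q: left_module R Q using modulesD(1) Q .
  have hom: "rep \<in> mod_hom R P Q"
    unfolding mod_hom_def Q_def using rep_add rep_smult by auto
  have "rep x = \<zero>\<^bsub>Q\<^esub> \<longleftrightarrow> x \<in> H" if x: "x \<in> carrier P" for x
  proof -
    have z: "\<zero>\<^bsub>Q\<^esub> = rep \<zero>\<^bsub>P\<^esub>"
      using mod_hom_zero[OF hom P.M.abelian_group_axioms Q.M.abelian_group_axioms] by simp
    have "x \<in> H" if "rep x = rep \<zero>\<^bsub>P\<^esub>"
    proof -
      obtain h k where hk: "h \<in> H" "rep x = h \<oplus>\<^bsub>P\<^esub> x" "k \<in> H" "rep \<zero>\<^bsub>P\<^esub> = k \<oplus>\<^bsub>P\<^esub> \<zero>\<^bsub>P\<^esub>"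
        using rep[OF x] rep[OF P.M.zero_closed] by blast
      then have c: "h \<in> carrier P" "k \<in> carrier P" using H by auto
      then have "h \<oplus>\<^bsub>P\<^esub> x = k" using hk that by simp
      then have "\<ominus>\<^bsub>P\<^esub> h \<oplus>\<^bsub>P\<^esub> k = x" using c x by (auto simp: P.M.r_neg1)
      then show ?thesis using hk H by blast
    qed
    moreover have "rep x = rep \<zero>\<^bsub>P\<^esub>" if "x \<in> H" using rep_eq[OF that P.M.zero_closed] x by simp
    ultimately show ?thesis using z by auto
  qed
  then show ?thesis using Q LMod_arr_restrict[OF P Q hom]
    by (intro exI[of _ Q] exI[of _ "\<lparr>msrc = P, mmap = restrict rep (carrier P), mtgt = Q\<rparr>"]) simp
qed

text \<open>
  The quotient by the image of \<open>g\<close> receives two arrows that vanish on this image, the projection and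
  zero. Since a cokernel is epic, they agree.
\<close>

lemma LMod_cokernel_surj:
  assumes "is_cokernel (LMod R) g f"
  shows "mmap g ` carrier (msrc g) = carrier (mtgt g)"
proof -
  let ?N = "msrc g" and ?P = "mtgt g"
  have g: "g \<in> arr (LMod R)" and f: "f \<in> arr (LMod R)" and gf: "?N = mtgt f"
    using assms by (auto simp: is_cokernel_def)
  have N: "?N \<in> modules R" and P: "?P \<in> modules R" and gh: "mmap g \<in> mod_hom R ?N ?P"
    using g by (auto simp: LMod_arr_iff)
  interpret N: left_module R ?N using modulesD(1) N .
  interpret P: left_module R ?P using modulesD(1) P .
  have ab: "abelian_group ?N" "abelian_group ?P"
    by (rule N.M.abelian_group_axioms P.M.abelian_group_axioms)+
  let ?H = "mmap g ` carrier ?N"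
  have H1: "?H \<subseteq> carrier ?P"
    using mod_homD(1)[OF gh] by auto
  have H2: "\<zero>\<^bsub>?P\<^esub> \<in> ?H"
    using imageI[OF N.M.zero_closed, of "mmap g"] mod_hom_zero[OF gh ab] by simp
  have H3: "x \<oplus>\<^bsub>?P\<^esub> y \<in> ?H" if "x \<in> ?H" "y \<in> ?H" for x y
    using that by (auto simp: mod_homD(2)[OF gh, symmetric])
  have H4: "\<ominus>\<^bsub>?P\<^esub> x \<in> ?H" if "x \<in> ?H" for x
    using that by (auto simp: mod_hom_minus[OF gh ab, symmetric])
  have H5: "r \<odot>\<^bsub>?P\<^esub> x \<in> ?H" if "r \<in> carrier R" "x \<in> ?H" for r x
    using that by (auto simp: mod_homD(3)[OF gh, symmetric] N.smult_closed)
  obtain Q q where Q: "Q \<in> modules R" and q: "q \<in> mor (LMod R) ?P Q"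
    and qz: "\<forall>x\<in>carrier ?P. mmap q x = \<zero>\<^bsub>Q\<^esub> \<longleftrightarrow> x \<in> ?H"
    using ex_quotient_module[OF P H1 H2 H3 H4 H5] by blast
  let ?h = "\<lparr>msrc = ?N, mmap = (\<lambda>x\<in>carrier ?N. \<zero>\<^bsub>Q\<^esub>), mtgt = Q\<rparr>"
  let ?z = "\<lparr>msrc = ?P, mmap = (\<lambda>x\<in>carrier ?P. \<zero>\<^bsub>Q\<^esub>), mtgt = Q\<rparr>"
  have h: "?h \<in> arr (LMod R)" and z: "?z \<in> mor (LMod R) ?P Q"
    using LMod_zero_mor[OF N Q] LMod_zero_mor[OF P Q] by (auto simp: mor_def)
  have fc: "mmap f x \<in> carrier ?N" if "x \<in> carrier (msrc f)" for x
    using f that gf by (auto simp: LMod_arr_iff mod_hom_def)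
  have "cmp (LMod R) ?h f \<in> arr (LMod R)" using LMod_cmp_mor[OF f h] gf by (simp add: mor_def)
  then have "zero_arrow (LMod R) (cmp (LMod R) ?h f)"
    by (simp add: LMod_zero_arrow_iff) (use fc in \<open>auto simp: compose_def\<close>)
  then have "\<exists>!u. u \<in> mor (LMod R) ?P Q \<and> cmp (LMod R) u g = ?h"
  proof -
    have "\<forall>h\<in>arr (LMod R). src (LMod R) h = tgt (LMod R) f \<and> zero_arrow (LMod R) (cmp (LMod R) h f) \<longrightarrow>
        (\<exists>!u. u \<in> mor (LMod R) (tgt (LMod R) g) (tgt (LMod R) h) \<and> cmp (LMod R) u g = h)"
      using assms unfolding is_cokernel_def by blast
    from bspec[OF this h] show ?thesis
      using \<open>zero_arrow (LMod R) (cmp (LMod R) ?h f)\<close> gf by simp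
  qed
  \<comment> \<open>Both the projection and zero compose with \<open>g\<close> to zero, and there is only one such arrow.\<close>
  moreover have "cmp (LMod R) q g = ?h"
    using q qz mod_homD(1)[OF gh] by (auto simp: LMod_mor_iff compose_def fun_eq_iff restrict_def)
  moreover have "cmp (LMod R) ?z g = ?h"
    using mod_homD(1)[OF gh] by (auto simp: LMod_mor_iff compose_def fun_eq_iff restrict_def)
  ultimately have "q = ?z" using q z by (elim ex1E) metis
  then have "mmap q x = \<zero>\<^bsub>Q\<^esub>" if "x \<in> carrier ?P" for x using that by simp
  then show ?thesis using qz H1 by blast
qed

section \<open>Kernels and epimorphisms in abelian categories\<close>

context preadditive_category
begin

lemma zero_arrow_iff_idem:
  assumes "f \<in> arr C" shows "zero_arrow C f \<longleftrightarrow> padd C f f = f"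
  using assms abgrp_idem[OF mor_abgrp[OF src_obj[OF assms] tgt_obj[OF assms]] arr_mor[OF assms]]
  unfolding zero_arrow_def by (auto simp: mor_def)

lemma zero_arrow_cmp_left:
  assumes "zero_arrow C g" "f \<in> mor C a b" "g \<in> mor C b c" shows "zero_arrow C (cmp C g f)"
proof -
  have "cmp C g f \<in> arr C" using cmp_mor[OF assms(2,3)] by (simp add: mor_def)
  moreover have "padd C g g = g" using assms by (simp add: zero_arrow_def mor_def)
  ultimately show ?thesis
    using cmp_padd_left[OF assms(2,3,3)] by (simp add: zero_arrow_iff_idem)
qed

lemma zero_arrow_cmp_right:
  assumes "zero_arrow C f" "f \<in> mor C a b" "g \<in> mor C b c" shows "zero_arrow C (cmp C g f)"
proof -
  have "cmp C g f \<in> arr C" using cmp_mor[OF assms(2,3)] by (simp add: mor_def)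
  moreover have "padd C f f = f" using assms by (simp add: zero_arrow_def mor_def)
  ultimately show ?thesis
    using cmp_padd_right[OF assms(2,2,3)] by (simp add: zero_arrow_iff_idem)
qed

lemma is_kernelD:
  assumes "is_kernel C k f"
  shows "k \<in> mor C (src C k) (src C f)" "f \<in> mor C (src C f) (tgt C f)" "zero_arrow C (cmp C f k)"
    "h \<in> mor C a (src C f) \<Longrightarrow> zero_arrow C (cmp C f h) \<Longrightarrow> \<exists>!u. u \<in> mor C a (src C k) \<and> cmp C k u = h"
proof -
  have "\<forall>h\<in>arr C. tgt C h = src C f \<and> zero_arrow C (cmp C f h) \<longrightarrow>
      (\<exists>!u. u \<in> mor C (src C h) (src C k) \<and> cmp C k u = h)"
    using assms unfolding is_kernel_def by (elim conjE)
  from bspec[OF this, of h]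
  show "h \<in> mor C a (src C f) \<Longrightarrow> zero_arrow C (cmp C f h) \<Longrightarrow> \<exists>!u. u \<in> mor C a (src C k) \<and> cmp C k u = h"
    by (simp add: mor_def)
qed (use assms in \<open>simp_all add: is_kernel_def mor_def\<close>)

lemma is_cokernelD:
  assumes "is_cokernel C k f"
  shows "k \<in> mor C (tgt C f) (tgt C k)" "f \<in> mor C (src C f) (tgt C f)" "zero_arrow C (cmp C k f)"
    "h \<in> mor C (tgt C f) a \<Longrightarrow> zero_arrow C (cmp C h f) \<Longrightarrow> \<exists>!u. u \<in> mor C (tgt C k) a \<and> cmp C u k = h"
proof -
  have "\<forall>h\<in>arr C. src C h = tgt C f \<and> zero_arrow C (cmp C h f) \<longrightarrow>
      (\<exists>!u. u \<in> mor C (tgt C k) (tgt C h) \<and> cmp C u k = h)"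
    using assms unfolding is_cokernel_def by (elim conjE)
  from bspec[OF this, of h]
  show "h \<in> mor C (tgt C f) a \<Longrightarrow> zero_arrow C (cmp C h f) \<Longrightarrow> \<exists>!u. u \<in> mor C (tgt C k) a \<and> cmp C u k = h"
    by (simp add: mor_def)
qed (use assms in \<open>simp_all add: is_cokernel_def mor_def\<close>)

lemma kernel_monic:
  assumes k: "is_kernel C k f" and u: "u \<in> mor C a (src C k)" "v \<in> mor C a (src C k)" "cmp C k u = cmp C k v"
  shows "u = v"
proof -
  note kf = is_kernelD[OF k]
  have h: "cmp C k u \<in> mor C a (src C f)" by (rule cmp_mor[OF u(1) kf(1)])
  have "zero_arrow C (cmp C f (cmp C k u))"
    unfolding cmp_assoc[OF u(1) kf(1,2)]
    by (rule zero_arrow_cmp_left[OF kf(3) u(1) cmp_mor[OF kf(1,2)]])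
  from kf(4)[OF h this] show ?thesis using u by auto
qed

lemma cokernel_epic:
  assumes k: "is_cokernel C k f" shows "epic C k"
  unfolding epic_def
proof (intro conjI allI ballI impI)
  note kf = is_cokernelD[OF k]
  show "k \<in> arr C" using kf(1) by (simp add: mor_def)
  fix a u v assume u: "u \<in> mor C (tgt C k) a" "v \<in> mor C (tgt C k) a" "cmp C u k = cmp C v k"
  have h: "cmp C u k \<in> mor C (tgt C f) a" by (rule cmp_mor[OF kf(1) u(1)])
  have "zero_arrow C (cmp C (cmp C u k) f)"
    unfolding cmp_assoc[OF kf(2,1) u(1), symmetric]
    by (rule zero_arrow_cmp_right[OF kf(3) cmp_mor[OF kf(2,1)] u(1)])
  from kf(4)[OF h this] show "u = v" using u by auto
qed

end

lemma (in abelian_category) epic_short_exact: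
  assumes "epic C f" shows "\<exists>k. short_exact C k f"
proof -
  obtain g where g: "is_cokernel C f g" using epic_is_cokernel[OF assms] by blast
  note fg = is_cokernelD[OF g]
  obtain k where k: "is_kernel C k f" using ex_kernel fg(1) by (auto simp: mor_def)
  note kf = is_kernelD[OF k]
  have sf: "src C f = tgt C g" using fg(1) by (simp add: mor_def)
  obtain u where u: "u \<in> mor C (src C g) (src C k)" "cmp C k u = g"
    using kf(4)[of g "src C g"] fg(2,3) sf by auto
  have "is_cokernel C f k"
    unfolding is_cokernel_def
  proof (intro conjI ballI impI)
    show "f \<in> arr C" "k \<in> arr C" "src C f = tgt C k" "zero_arrow C (cmp C f k)"
      using kf by (auto simp: mor_def)
    fix h assume "h \<in> arr C" "src C h = tgt C k \<and> zero_arrow C (cmp C h k)"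
    then have h: "h \<in> mor C (tgt C g) (tgt C h)" "zero_arrow C (cmp C h k)"
      using kf(1) sf by (auto simp: mor_def)
    have k': "k \<in> mor C (src C k) (tgt C g)" using kf(1) sf by simp
    have "zero_arrow C (cmp C h g)"
      unfolding u(2)[symmetric] cmp_assoc[OF u(1) k' h(1)]
      by (rule zero_arrow_cmp_left[OF h(2) u(1) cmp_mor[OF k' h(1)]])
    then show "\<exists>!u. u \<in> mor C (tgt C f) (tgt C h) \<and> cmp C u f = h" by (rule fg(4)[OF h(1)])
  qed
  then show ?thesis using k by (auto simp: short_exact_def)
qed

text \<open>
  A faithful functor that is injective on objects is an isomorphism onto its image, and abelianness
  passes along isomorphisms.
\<close>

lemma identifies_with_abelian_subcategoryI:
  assumes "abelian_category C" "exact_functor C D F" "faithful_functor C D F"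
    and inj: "inj_on (fob F) (obj C)"
  shows "identifies_with_abelian_subcategory C D F"
proof -
  interpret C: abelian_category C by fact
  let ?I = "image_category C D F"
  have fu: "is_functor C D F" and add: "additive_functor C D F"
    using assms by (auto simp: exact_functor_def additive_functor_def)
  have far: "f \<in> arr C \<Longrightarrow> far F f \<in> mor D (fob F (src C f)) (fob F (tgt C f))" for f
    using fu by (auto simp: is_functor_def)
  have fob: "a \<in> obj C \<Longrightarrow> fob F a \<in> obj D" for a using fu by (auto simp: is_functor_def)
  have inja: "inj_on (far F) (arr C)"
  proof (rule inj_onI)
    fix f g assume fg: "f \<in> arr C" "g \<in> arr C" "far F f = far F g"
    then have "fob F (src C f) = fob F (src C g)" "fob F (tgt C f) = fob F (tgt C g)"
      using far[of f] far[of g] by (auto simp: mor_def)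
    then have "src C f = src C g" "tgt C f = tgt C g"
      using inj_onD[OF inj] fg(1,2) C.src_obj C.tgt_obj by blast+
    then have "f \<in> mor C (src C g) (tgt C g)" "g \<in> mor C (src C g) (tgt C g)"
      using fg by (auto simp: mor_def)
    then show "f = g"
      using assms(3) fg C.src_obj C.tgt_obj unfolding faithful_functor_def by (metis inj_onD)
  qed
  interpret I: preadditive_iso C ?I "fob F" "far F"
  proof
    show "inj_on (fob F) (obj C)" "inj_on (far F) (arr C)" by (fact inj inja)+
    show "f \<in> arr C \<Longrightarrow> g \<in> arr C \<Longrightarrow> src C g = tgt C f \<Longrightarrow>
        cmp ?I (far F g) (far F f) = far F (cmp C g f)" for f g
      using fu by (auto simp: is_functor_def image_category_def)
    show "f \<in> mor C a b \<Longrightarrow> g \<in> mor C a b \<Longrightarrow> padd ?I (far F f) (far F g) = far F (padd C f g)" for f g a b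
      using add C.mor_obj[of f a b] by (auto simp: additive_functor_def image_category_def)
  qed (use fu far in \<open>auto simp: is_functor_def image_category_def mor_def\<close>)
  have ab: "abelian_category ?I" by (rule I.abelian_D) fact
  have mor_sub: "mor ?I a b \<subseteq> mor D a b" for a b
    using far by (auto simp: image_category_def mor_def)
  have "is_functor ?I D \<lparr>fob = id, far = id\<rparr>"
    using I.category_D fu mor_sub fob far
    by (auto simp: is_functor_def image_category_def mor_def)
  moreover have "preadditive_category D" using add by (simp add: additive_functor_def)
  moreover have "short_exact D f g" if "short_exact ?I f g" for f g
  proof -
    have "f \<in> arr ?I" "g \<in> arr ?I" using that by (auto simp: short_exact_def is_kernel_def)
    then obtain f0 g0 where "f0 \<in> arr C" "g0 \<in> arr C" "f = far F f0" "g = far F g0"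
      by (auto simp: I.arr_D)
    then show ?thesis using that I.short_exact_D assms(2) by (auto simp: exact_functor_def)
  qed
  ultimately have "exact_functor ?I D \<lparr>fob = id, far = id\<rparr>"
    using I.preadditive_D by (auto simp: exact_functor_def additive_functor_def image_category_def)
  moreover have "is_functor C ?I F"
    using fu I.category_D far by (auto simp: is_functor_def image_category_def mor_def)
  ultimately show ?thesis
    using ab inj inja
    by (auto simp: identifies_with_abelian_subcategory_def abelian_subcategory_def
        category_isomorphism_def bij_betw_def image_category_def)
qed

section \<open>Functors represented by a projective generator\<close>

text \<open>
  The situation shared by \<open>cat_of A\<close> and its enlargement: \<open>\<RR>\<close> is a projective generator of an
  abelian category, and the groups \<open>Mor(\<RR>, a)\<close> carry \<open>R\<close>-module structures for which composition is linear.
\<close>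

locale represented_modules = abelian_category C
  for C :: "('u::set_universe, 'u) lin_category" +
  fixes R :: "'u ring" and \<RR> :: 'u and mdl :: "'u \<Rightarrow> ('u, 'u) module"
  assumes RR_obj: "\<RR> \<in> obj C"
    and mdl_module: "a \<in> obj C \<Longrightarrow> mdl a \<in> modules R"
    and mdl_carrier: "a \<in> obj C \<Longrightarrow> carrier (mdl a) = mor C \<RR> a"
    and mdl_add: "a \<in> obj C \<Longrightarrow> f \<in> mor C \<RR> a \<Longrightarrow> g \<in> mor C \<RR> a \<Longrightarrow> f \<oplus>\<^bsub>mdl a\<^esub> g = padd C f g"
    and mdl_smult: "h \<in> arr C \<Longrightarrow> r \<in> carrier R \<Longrightarrow> x \<in> mor C \<RR> (src C h) \<Longrightarrow>
      cmp C h (r \<odot>\<^bsub>mdl (src C h)\<^esub> x) = r \<odot>\<^bsub>mdl (tgt C h)\<^esub> cmp C h x"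
    and generator: "f \<in> mor C a b \<Longrightarrow> g \<in> mor C a b \<Longrightarrow>
      (\<And>x. x \<in> mor C \<RR> a \<Longrightarrow> cmp C f x = cmp C g x) \<Longrightarrow> f = g"
    and projective: "epic C f \<Longrightarrow> x \<in> mor C \<RR> (tgt C f) \<Longrightarrow> \<exists>y\<in>mor C \<RR> (src C f). cmp C f y = x"
begin

abbreviation H :: "('u, 'u, ('u, 'u) module, ('u, 'u) mod_arrow) functor_map" where
  "H \<equiv> represented_functor C \<RR> mdl"

lemma H_simps [simp]:
  "fob H = mdl"
  "msrc (far H h) = mdl (src C h)" "mtgt (far H h) = mdl (tgt C h)"
  "mmap (far H h) = (\<lambda>f\<in>mor C \<RR> (src C h). cmp C h f)"
  by (simp_all add: represented_functor_def)

lemma H_mor: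
  assumes "h \<in> arr C" shows "far H h \<in> mor (LMod R) (mdl (src C h)) (mdl (tgt C h))"
proof -
  note so = src_obj[OF assms] and to = tgt_obj[OF assms]
  have "cmp C h \<in> mod_hom R (mdl (src C h)) (mdl (tgt C h))"
    unfolding mod_hom_def
    using assms so to cmp_mor[OF _ arr_mor[OF assms]] cmp_padd_right[OF _ _ arr_mor[OF assms]]
    by (simp add: mdl_carrier mdl_add mdl_smult)
  from LMod_arr_restrict[OF mdl_module[OF so] mdl_module[OF to] this]
  show ?thesis using so by (simp add: represented_functor_def mdl_carrier)
qed

lemma H_arr: "h \<in> arr C \<Longrightarrow> far H h \<in> arr (LMod R)"
  using H_mor by (simp add: mor_def)

lemma H_functor: "is_functor C (LMod R) H"
  unfolding is_functor_def
proof (intro conjI ballI impI category_axioms LMod_category)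
  fix a assume a: "a \<in> obj C"
  show "fob H a \<in> obj (LMod R)" using a by (simp add: mdl_module)
  have "idt C a \<in> arr C" "src C (idt C a) = a" "tgt C (idt C a) = a"
    using idt_mor[OF a] by (auto simp: mor_def)
  then show "far H (idt C a) = idt (LMod R) (fob H a)"
    using a idt_cmp by (intro mod_arrow.equality) (auto simp: mdl_carrier fun_eq_iff restrict_def)
next
  fix f assume f: "f \<in> arr C"
  show "far H f \<in> mor (LMod R) (fob H (src C f)) (fob H (tgt C f))" using H_mor[OF f] by simp
  fix g assume g: "g \<in> arr C" "src C g = tgt C f"
  have fm: "f \<in> mor C (src C f) (tgt C f)" and gm: "g \<in> mor C (tgt C f) (tgt C g)"
    using f g by (auto simp: mor_def)
  have s: "src C (cmp C g f) = src C f" "tgt C (cmp C g f) = tgt C g"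
    using cmp_mor[OF fm gm] by (auto simp: mor_def)
  show "far H (cmp C g f) = cmp (LMod R) (far H g) (far H f)"
    using s g cmp_assoc[OF _ fm gm] cmp_mor[OF _ fm] src_obj[OF f]
    by (intro mod_arrow.equality) (auto simp: mdl_carrier fun_eq_iff restrict_def compose_def)
qed

lemma H_faithful: "faithful_functor C (LMod R) H"
  unfolding faithful_functor_def
proof (intro conjI ballI H_functor inj_onI)
  fix a b f g assume "a \<in> obj C" "b \<in> obj C" and fg: "f \<in> mor C a b" "g \<in> mor C a b" "far H f = far H g"
  have "cmp C f x = cmp C g x" if x: "x \<in> mor C \<RR> a" for x
    using arg_cong[OF fg(3), of "\<lambda>u. mmap u x"] x fg(1,2) by (auto simp: mor_def)
  then show "f = g" by (rule generator[OF fg(1,2)])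
qed

lemma zero_mdl:
  assumes a: "a \<in> obj C" and x: "x \<in> mor C \<RR> a"
  shows "zero_arrow C x \<longleftrightarrow> x = \<zero>\<^bsub>mdl a\<^esub>"
proof -
  interpret M: left_module R "mdl a" using modulesD(1) mdl_module[OF a] .
  have xa: "x \<in> arr C" "src C x = \<RR>" "tgt C x = a" using x by (auto simp: mor_def)
  have "padd C x x = x \<longleftrightarrow> x = \<zero>\<^bsub>mdl a\<^esub>"
    using M.M.add.l_cancel_one'[of x x] x by (auto simp: mdl_carrier[OF a] mdl_add[OF a x x, symmetric])
  then show ?thesis using zero_arrow_iff_idem[OF xa(1)] by simp
qed

text \<open>
  A represented functor is left exact in any case; projectivity of \<open>\<RR>\<close> gives surjectivity on the right.
\<close>

lemma H_exact: "exact_functor C (LMod R) H"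
  unfolding exact_functor_def additive_functor_def
proof (intro conjI allI ballI impI preadditive_category_axioms LMod_preadditive H_functor)
  fix a b f g assume a: "a \<in> obj C" and b: "b \<in> obj C" and f: "f \<in> mor C a b" and g: "g \<in> mor C a b"
  note p = padd_mor[OF f g]
  show "far H (padd C f g) = padd (LMod R) (far H f) (far H g)"
    using f g p a b cmp_padd_left[OF _ f g] cmp_mor[OF _ f] cmp_mor[OF _ g]
    by (intro mod_arrow.equality) (auto simp: mor_def mdl_carrier mdl_add fun_eq_iff restrict_def)
next
  fix f g assume "short_exact C f g"
  then have k: "is_kernel C f g" and c: "is_cokernel C g f" by (auto simp: short_exact_def)
  note kf = is_kernelD[OF k]
  have fa: "f \<in> arr C" and ga: "g \<in> arr C" and fg: "tgt C f = src C g" using kf by (auto simp: mor_def)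
  note o = src_obj[OF fa] src_obj[OF ga] tgt_obj[OF ga]
  have epi: "epic C g" by (rule cokernel_epic[OF c])
  have eq: "cmp C f ` mor C \<RR> (src C f) = {x \<in> mor C \<RR> (src C g). cmp C g x = \<zero>\<^bsub>mdl (tgt C g)\<^esub>}"
  proof (intro equalityI subsetI CollectI conjI)
    fix x assume "x \<in> cmp C f ` mor C \<RR> (src C f)"
    then obtain y where y: "y \<in> mor C \<RR> (src C f)" "x = cmp C f y" by blast
    show x: "x \<in> mor C \<RR> (src C g)" unfolding y(2) by (rule cmp_mor[OF y(1) kf(1)])
    have "zero_arrow C (cmp C g x)"
      unfolding y(2) cmp_assoc[OF y(1) kf(1,2)]
      by (rule zero_arrow_cmp_left[OF kf(3) y(1) cmp_mor[OF kf(1,2)]])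
    then show "cmp C g x = \<zero>\<^bsub>mdl (tgt C g)\<^esub>"
      using zero_mdl[OF o(3) cmp_mor[OF x kf(2)]] by simp
  next
    fix x assume "x \<in> {x \<in> mor C \<RR> (src C g). cmp C g x = \<zero>\<^bsub>mdl (tgt C g)\<^esub>}"
    then have x: "x \<in> mor C \<RR> (src C g)" "cmp C g x = \<zero>\<^bsub>mdl (tgt C g)\<^esub>" by auto
    then have "zero_arrow C (cmp C g x)" using zero_mdl[OF o(3) cmp_mor[OF x(1) kf(2)]] by simp
    from kf(4)[OF x(1) this] show "x \<in> cmp C f ` mor C \<RR> (src C f)" by blast
  qed
  have inj: "inj_on (cmp C f) (mor C \<RR> (src C f))"
    by (rule inj_onI) (rule kernel_monic[OF k])
  have surj: "cmp C g ` mor C \<RR> (src C g) = mor C \<RR> (tgt C g)"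
    using projective[OF epi] cmp_mor[OF _ kf(2)] by blast
  have "is_kernel (LMod R) (far H f) (far H g)"
    by (rule LMod_is_kernelI) (use fa ga fg H_arr eq inj o in \<open>simp_all add: mdl_carrier inj_on_def\<close>, blast)
  moreover have "is_cokernel (LMod R) (far H g) (far H f)"
    by (rule LMod_is_cokernelI) (use fa ga fg H_arr eq surj o in \<open>simp_all add: mdl_carrier\<close>, blast)
  ultimately show "short_exact (LMod R) (far H f) (far H g)" by (simp add: short_exact_def)
qed

lemma mdl_inj: "inj_on mdl (obj C)"
proof (rule inj_onI)
  fix a b assume ab: "a \<in> obj C" "b \<in> obj C" "mdl a = mdl b"
  then have "mor C \<RR> a = mor C \<RR> b" using mdl_carrier by metis
  \<comment> \<open>The module determines its carrier, a nonempty set of arrows with target \<open>a\<close>.\<close>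
  moreover obtain f where "f \<in> mor C \<RR> a" using mor_abgrp[OF RR_obj ab(1)] by (auto simp: abgrp_def)
  ultimately show "a = b" by (auto simp: mor_def)
qed

lemma H_identifies: "identifies_with_abelian_subcategory C (LMod R) H"
  by (rule identifies_with_abelian_subcategoryI[OF abelian_category_axioms H_exact H_faithful])
    (simp add: mdl_inj)

text \<open>
  Arrows into a subobject inject, arrows into a quotient lift by projectivity, and for an extension
  the fibres of \<open>Mor(\<RR>, b) \<rightarrow> Mor(\<RR>, c)\<close> are empty or cosets of the image of \<open>Mor(\<RR>, a)\<close>.
\<close>

lemma H_serre: "serre_subcategory (fin_subcategory C H) C"
proof -
  let ?B = "fin_subcategory C H"
  have B: "obj ?B = {a \<in> obj C. finite (mor C \<RR> a)}"
    by (auto simp: fin_subcategory_def full_subcategory_def mdl_carrier)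
  have full: "?B = full_subcategory C (obj ?B)"
    unfolding fin_subcategory_def full_subcategory_def
    using src_obj tgt_obj by (intro lin_category.equality) (auto simp: mdl_carrier)
  \<comment> \<open>There is only one arrow into a zero object, so the subcategory has an object.\<close>
  obtain z where z: "zero_object C z" using ex_zero_object by blast
  then have zo: "z \<in> obj C" and "\<exists>!f. f \<in> mor C \<RR> z" using RR_obj by (auto simp: zero_object_def)
  then obtain f where "\<And>g. g \<in> mor C \<RR> z \<Longrightarrow> g = f" by blast
  then have "mor C \<RR> z \<subseteq> {f}" by blast
  then have "z \<in> obj ?B" using zo B finite_subset by blast
  moreover have "src C f \<in> obj ?B" if f: "monic C f" "tgt C f \<in> obj ?B" for f
  proof -
    have fa: "f \<in> arr C" using f by (simp add: monic_def)
    have "inj_on (cmp C f) (mor C \<RR> (src C f))"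
      using f(1) unfolding monic_def inj_on_def by blast
    moreover have "cmp C f ` mor C \<RR> (src C f) \<subseteq> mor C \<RR> (tgt C f)"
      using cmp_mor[OF _ arr_mor[OF fa]] by blast
    ultimately show ?thesis using f(2) src_obj[OF fa] by (auto simp: B intro: inj_on_finite)
  qed
  moreover have "tgt C f \<in> obj ?B" if f: "epic C f" "src C f \<in> obj ?B" for f
  proof -
    have fa: "f \<in> arr C" using f by (simp add: epic_def)
    have "mor C \<RR> (tgt C f) \<subseteq> cmp C f ` mor C \<RR> (src C f)"
      using projective[OF f(1)] by blast
    then show ?thesis using f(2) tgt_obj[OF fa] by (auto simp: B intro: finite_surj)
  qed
  moreover have "tgt C f \<in> obj ?B" if se: "short_exact C f g" and fin: "src C f \<in> obj ?B" "tgt C g \<in> obj ?B" for f g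
  proof -
    have k: "is_kernel C f g" using se by (simp add: short_exact_def)
    note kf = is_kernelD[OF k]
    have fa: "f \<in> arr C" and ga: "g \<in> arr C" and fg: "tgt C f = src C g" using kf by (auto simp: mor_def)
    let ?X = "mor C \<RR> (src C f)" and ?Y = "mor C \<RR> (src C g)" and ?Z = "mor C \<RR> (tgt C g)"
    have fX: "finite ?X" and fZ: "finite ?Z" using fin by (auto simp: B)
    have ab: "abgrp ?Y (padd C)" by (rule mor_abgrp[OF RR_obj src_obj[OF ga]])
    have "finite {y \<in> ?Y. cmp C g y = z}" for z
    proof (cases "\<exists>y0\<in>?Y. cmp C g y0 = z")
      case True
      then obtain y0 where y0: "y0 \<in> ?Y" "cmp C g y0 = z" by blast
      \<comment> \<open>The fibre over \<open>z\<close> is the image of \<open>?X\<close> translated by one of its points.\<close>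
      have "{y \<in> ?Y. cmp C g y = z} \<subseteq> (\<lambda>x. padd C (cmp C f x) y0) ` ?X"
      proof safe
        fix y assume y: "y \<in> ?Y" "z = cmp C g y"
        obtain d where d: "d \<in> ?Y" "padd C d y0 = y"
          using abgrp_diff[OF ab y(1) y0(1)] by blast
        have "padd C (cmp C g d) (cmp C g y) = cmp C g y"
          using cmp_padd_right[OF d(1) y0(1) kf(2)] d y y0 by simp
        moreover have "cmp C g d \<in> ?Z" "cmp C g y \<in> ?Z" using cmp_mor[OF _ kf(2)] d y by auto
        moreover have "abgrp ?Z (padd C)" by (rule mor_abgrp[OF RR_obj tgt_obj[OF ga]])
        ultimately have "padd C (cmp C g d) (cmp C g d) = cmp C g d"
          unfolding abgrp_def by metis
        then have "zero_arrow C (cmp C g d)"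
          using zero_arrow_iff_idem \<open>cmp C g d \<in> ?Z\<close> by (simp add: mor_def)
        from kf(4)[OF d(1) this] obtain x where "x \<in> ?X" "cmp C f x = d" by blast
        then show "y \<in> (\<lambda>x. padd C (cmp C f x) y0) ` ?X" using d by blast
      qed
      then show ?thesis using fX by (rule finite_surj[rotated])
    next
      case False
      then have "{y \<in> ?Y. cmp C g y = z} = {}" by blast
      then show ?thesis by (metis finite.emptyI)
    qed
    moreover have "?Y = (\<Union>z\<in>?Z. {y \<in> ?Y. cmp C g y = z})" using cmp_mor[OF _ kf(2)] by blast
    ultimately have "finite ?Y" using fZ by (metis (no_types, lifting) finite_UN_I)
    then show ?thesis using fg src_obj[OF ga] by (simp add: B)
  qed
  ultimately show ?thesis
    unfolding serre_subcategory_def using abelian_category_axioms full B by blast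
qed

end

section \<open>The functor represented by the preimage of the ring\<close>

text \<open>
  A fully faithful exact functor \<open>F\<close> to \<open>R\<close>-modules whose value at \<open>\<RR>\<close> is isomorphic to \<open>R\<close>.
\<close>

locale module_embedding =
  fixes A :: "'u::set_universe small_cat" and R :: "'u ring"
    and F :: "('u, 'u, ('u, 'v) module, ('u, 'v) mod_arrow) functor_map"
    and \<RR> :: 'u and \<psi> :: "'v \<Rightarrow> 'u"
  assumes ring_R: "ring R" and abelian_A: "abelian_category (cat_of A)"
    and F_exact: "exact_functor (cat_of A) (LMod R) F"
    and F_full: "full_functor (cat_of A) (LMod R) F"
    and F_faithful: "faithful_functor (cat_of A) (LMod R) F"
    and RR_obj: "\<RR> \<in> obj (cat_of A)"
    and psi_iso: "\<psi> \<in> mod_iso R (fob F \<RR>) (regular_module R)"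
begin

sublocale C: abelian_category "cat_of A" by (rule abelian_A)
sublocale R: ring R by (rule ring_R)

abbreviation C :: "('u, 'u) lin_category" where "C \<equiv> cat_of A"
abbreviation \<theta> :: "'u \<Rightarrow> 'v" where "\<theta> \<equiv> transport R F \<RR> \<psi>"
abbreviation X :: "'u \<Rightarrow> 'u set" where "X \<equiv> mor C \<RR>"

text \<open>
  The preimage of \<open>1\<close> under \<open>\<psi>\<close>, a free generator of the module \<open>F \<RR>\<close>.
\<close>

definition unit_elem :: 'v where
  "unit_elem = inv_into (carrier (fob F \<RR>)) \<psi> \<one>\<^bsub>R\<^esub>"

lemma theta_eq: "\<theta> f = mmap (far F f) unit_elem"
  by (simp add: transport_def unit_elem_def)

lemma F_mor: "f \<in> mor C a b \<Longrightarrow> far F f \<in> mor (LMod R) (fob F a) (fob F b)"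
  using F_faithful by (auto simp: faithful_functor_def is_functor_def mor_def)

lemma F_obj: "a \<in> obj C \<Longrightarrow> fob F a \<in> modules R"
  using F_faithful by (auto simp: faithful_functor_def is_functor_def)

lemma F_hom: "f \<in> mor C a b \<Longrightarrow> mmap (far F f) \<in> mod_hom R (fob F a) (fob F b)"
  using F_mor by (auto simp: LMod_mor_iff)

lemma F_cmp:
  "f \<in> mor C a b \<Longrightarrow> g \<in> mor C b c \<Longrightarrow> x \<in> carrier (fob F a) \<Longrightarrow>
    mmap (far F (cmp C g f)) x = mmap (far F g) (mmap (far F f) x)"
  using F_faithful F_mor[of f a b] by (auto simp: faithful_functor_def is_functor_def mor_def compose_def)

lemma F_padd:
  assumes "f \<in> mor C a b" "g \<in> mor C a b" "x \<in> carrier (fob F a)"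
  shows "mmap (far F (padd C f g)) x = mmap (far F f) x \<oplus>\<^bsub>fob F b\<^esub> mmap (far F g) x"
proof -
  have "far F (padd C f g) = padd (LMod R) (far F f) (far F g)"
    using F_exact assms C.mor_obj[OF assms(1)] by (auto simp: exact_functor_def additive_functor_def)
  then show ?thesis using assms F_mor[OF assms(1)] by (simp add: LMod_mor_iff)
qed

lemma psi:
  "bij_betw \<psi> (carrier (fob F \<RR>)) (carrier R)"
  "x \<in> carrier (fob F \<RR>) \<Longrightarrow> \<psi> x \<in> carrier R"
  "x \<in> carrier (fob F \<RR>) \<Longrightarrow> y \<in> carrier (fob F \<RR>) \<Longrightarrow> \<psi> (x \<oplus>\<^bsub>fob F \<RR>\<^esub> y) = \<psi> x \<oplus>\<^bsub>R\<^esub> \<psi> y"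
  "r \<in> carrier R \<Longrightarrow> x \<in> carrier (fob F \<RR>) \<Longrightarrow> \<psi> (r \<odot>\<^bsub>fob F \<RR>\<^esub> x) = r \<otimes>\<^bsub>R\<^esub> \<psi> x"
  using psi_iso by (auto simp: mod_iso_def mod_hom_def regular_module_def Pi_iff)

lemma unit_elem: "unit_elem \<in> carrier (fob F \<RR>)" "\<psi> unit_elem = \<one>\<^bsub>R\<^esub>"
  using psi(1) unfolding unit_elem_def bij_betw_def
  by (auto intro: inv_into_into f_inv_into_f)

lemma unit_generates:
  assumes "x \<in> carrier (fob F \<RR>)" shows "x = \<psi> x \<odot>\<^bsub>fob F \<RR>\<^esub> unit_elem"
proof -
  interpret M: left_module R "fob F \<RR>" using modulesD(1) F_obj[OF RR_obj] .
  have "\<psi> (\<psi> x \<odot>\<^bsub>fob F \<RR>\<^esub> unit_elem) = \<psi> x"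
    using psi(2,4) unit_elem assms by simp
  then show ?thesis
    using psi(1,2) unit_elem(1) assms M.smult_closed unfolding bij_betw_def by (metis inj_onD)
qed

lemma theta_carrier: "f \<in> X a \<Longrightarrow> \<theta> f \<in> carrier (fob F a)"
  using mod_homD(1)[OF F_hom] unit_elem(1) by (simp add: theta_eq)

lemma theta_padd: "f \<in> X a \<Longrightarrow> g \<in> X a \<Longrightarrow> \<theta> (padd C f g) = \<theta> f \<oplus>\<^bsub>fob F a\<^esub> \<theta> g"
  using F_padd unit_elem(1) by (simp add: theta_eq)

lemma theta_cmp: "f \<in> X a \<Longrightarrow> h \<in> mor C a b \<Longrightarrow> \<theta> (cmp C h f) = mmap (far F h) (\<theta> f)"
  using F_cmp unit_elem(1) by (simp add: theta_eq)

text \<open>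
  Full faithfulness of \<open>F\<close> together with the freeness of \<open>F \<RR>\<close> on \<open>unit_elem\<close>.
\<close>

lemma theta_bij:
  assumes a: "a \<in> obj C" shows "bij_betw \<theta> (X a) (carrier (fob F a))"
  unfolding bij_betw_def
proof (intro conjI equalityI subsetI inj_onI)
  interpret M: left_module R "fob F \<RR>" using modulesD(1) F_obj[OF RR_obj] .
  interpret N: left_module R "fob F a" using modulesD(1) F_obj[OF a] .
  fix f g assume fg: "f \<in> X a" "g \<in> X a" "\<theta> f = \<theta> g"
  have "far F f = far F g"
  proof (rule LMod_arr_eqI[where R = R])
    fix x assume "x \<in> carrier (msrc (far F f))"
    then have x: "x \<in> carrier (fob F \<RR>)" using F_mor[OF fg(1)] by (simp add: LMod_mor_iff)
    have "mmap (far F h) x = \<psi> x \<odot>\<^bsub>fob F a\<^esub> \<theta> h" if "h \<in> X a" for h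
      using mod_homD(3)[OF F_hom[OF that] psi(2)[OF x] unit_elem(1)] unit_generates[OF x]
      by (simp add: theta_eq)
    then show "mmap (far F f) x = mmap (far F g) x" using fg by simp
  qed (use F_mor[OF fg(1)] F_mor[OF fg(2)] in \<open>auto simp: mor_def\<close>)
  then show "f = g" using F_faithful fg RR_obj a unfolding faithful_functor_def by (blast dest: inj_onD)
next
  fix y assume "y \<in> \<theta> ` X a" then show "y \<in> carrier (fob F a)" using theta_carrier by auto
next
  interpret M: left_module R "fob F \<RR>" using modulesD(1) F_obj[OF RR_obj] .
  interpret N: left_module R "fob F a" using modulesD(1) F_obj[OF a] .
  fix y assume y: "y \<in> carrier (fob F a)"
  \<comment> \<open>The homomorphism that sends the generator of \<open>F \<RR>\<close> to \<open>y\<close> comes from an arrow by fullness.\<close>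
  have "(\<lambda>x. \<psi> x \<odot>\<^bsub>fob F a\<^esub> y) \<in> mod_hom R (fob F \<RR>) (fob F a)"
    using y by (auto simp: mod_hom_def psi N.smult_closed N.smult_l_distr N.smult_assoc1)
  from LMod_arr_restrict[OF F_obj[OF RR_obj] F_obj[OF a] this] obtain f where
    f: "f \<in> X a" "far F f = \<lparr>msrc = fob F \<RR>, mmap = \<lambda>x\<in>carrier (fob F \<RR>). \<psi> x \<odot>\<^bsub>fob F a\<^esub> y, mtgt = fob F a\<rparr>"
    using F_full RR_obj a unfolding full_functor_def by (metis (no_types, lifting) imageE)
  have "\<theta> f = y" using y by (simp add: theta_eq f(2) unit_elem N.smult_one)
  then show "y \<in> \<theta> ` X a" using f(1) by blast
qed

abbreviation Gm :: "'u \<Rightarrow> ('u, 'u) module" where "Gm \<equiv> G_module A R F \<RR> \<psi>"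

lemma inv_theta:
  assumes "a \<in> obj C" "y \<in> carrier (fob F a)"
  shows "inv_into (X a) \<theta> y \<in> X a" "\<theta> (inv_into (X a) \<theta> y) = y"
  using theta_bij[OF assms(1)] assms(2) unfolding bij_betw_def by (auto intro: inv_into_into f_inv_into_f)

lemma theta_inj: "a \<in> obj C \<Longrightarrow> f \<in> X a \<Longrightarrow> g \<in> X a \<Longrightarrow> \<theta> f = \<theta> g \<Longrightarrow> f = g"
  using theta_bij unfolding bij_betw_def by (blast dest: inj_onD)

lemma inv_theta_theta: "a \<in> obj C \<Longrightarrow> f \<in> X a \<Longrightarrow> inv_into (X a) \<theta> (\<theta> f) = f"
  using inv_theta theta_inj theta_carrier by meson

lemma Gm_simps:
  assumes a: "a \<in> obj C"
  shows "carrier (Gm a) = X a"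
    "f \<in> X a \<Longrightarrow> g \<in> X a \<Longrightarrow> f \<oplus>\<^bsub>Gm a\<^esub> g = padd C f g"
    "r \<in> carrier R \<Longrightarrow> f \<in> X a \<Longrightarrow> r \<odot>\<^bsub>Gm a\<^esub> f \<in> X a"
    "r \<in> carrier R \<Longrightarrow> f \<in> X a \<Longrightarrow> \<theta> (r \<odot>\<^bsub>Gm a\<^esub> f) = r \<odot>\<^bsub>fob F a\<^esub> \<theta> f"
proof -
  interpret N: left_module R "fob F a" using modulesD(1) F_obj[OF a] .
  show "carrier (Gm a) = X a" by (simp add: G_module_def Let_def)
  show "f \<in> X a \<Longrightarrow> g \<in> X a \<Longrightarrow> f \<oplus>\<^bsub>Gm a\<^esub> g = padd C f g"
    using inv_theta_theta[OF a C.padd_mor, of f g] by (simp add: G_module_def Let_def theta_padd)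
  show "r \<in> carrier R \<Longrightarrow> f \<in> X a \<Longrightarrow> r \<odot>\<^bsub>Gm a\<^esub> f \<in> X a"
    "r \<in> carrier R \<Longrightarrow> f \<in> X a \<Longrightarrow> \<theta> (r \<odot>\<^bsub>Gm a\<^esub> f) = r \<odot>\<^bsub>fob F a\<^esub> \<theta> f"
    using inv_theta[OF a] theta_carrier N.smult_closed by (auto simp: G_module_def Let_def)
qed

lemma Gm_module: assumes a: "a \<in> obj C" shows "Gm a \<in> modules R"
proof -
  interpret N: left_module R "fob F a" using modulesD(1) F_obj[OF a] .
  have "inv_into (X a) \<theta> ` carrier (fob F a) = X a"
    using inv_theta[OF a] inv_theta_theta[OF a] theta_carrier by (auto simp: image_iff) metis
  then have "module_ops R (X a) (\<lambda>f g. inv_into (X a) \<theta> (\<theta> f \<oplus>\<^bsub>fob F a\<^esub> \<theta> g))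
     (\<lambda>r f. inv_into (X a) \<theta> (r \<odot>\<^bsub>fob F a\<^esub> \<theta> f))"
    by (rule module_ops_image[OF modulesD(5)[OF F_obj[OF a]]])
      (simp_all add: inv_theta[OF a] ring_R)
  then show ?thesis unfolding G_module_def Let_def by (rule mk_module_in_modules[OF ring_R])
qed

lemma Gm_smult_cmp:
  assumes "h \<in> mor C a b" "r \<in> carrier R" "x \<in> X a"
  shows "cmp C h (r \<odot>\<^bsub>Gm a\<^esub> x) = r \<odot>\<^bsub>Gm b\<^esub> cmp C h x"
proof -
  have o: "a \<in> obj C" "b \<in> obj C" using C.mor_obj[OF assms(1)] by auto
  note hx = C.cmp_mor[OF assms(3,1)] and rx = Gm_simps(3)[OF o(1) assms(2,3)]
  show ?thesis
    by (rule theta_inj[OF o(2) C.cmp_mor[OF rx assms(1)] Gm_simps(3)[OF o(2) assms(2) hx]])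
      (simp add: theta_cmp[OF rx assms(1)] theta_cmp[OF assms(3,1)] Gm_simps(4)[OF o(1) assms(2,3)]
        Gm_simps(4)[OF o(2) assms(2) hx] mod_homD(3)[OF F_hom[OF assms(1)]] assms(2) theta_carrier[OF assms(3)])
qed

text \<open>
  An epic arrow is part of a short exact sequence, which \<open>F\<close> preserves; as cokernels of modules are
  surjective, an element of \<open>F (tgt f)\<close> lifts, and \<open>\<theta>\<close> translates this to arrows.
\<close>

lemma RR_projective:
  assumes f: "epic C f" and x: "x \<in> X (tgt C f)"
  shows "\<exists>y\<in>X (src C f). cmp C f y = x"
proof -
  obtain k where "short_exact C k f" using C.epic_short_exact[OF f] by blast
  then have "is_cokernel (LMod R) (far F f) (far F k)"
    using F_exact by (auto simp: exact_functor_def short_exact_def)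
  from LMod_cokernel_surj[OF this]
  have s: "mmap (far F f) ` carrier (msrc (far F f)) = carrier (mtgt (far F f))" .
  have fa: "f \<in> mor C (src C f) (tgt C f)" using f by (simp add: epic_def mor_def)
  note o = C.mor_obj[OF fa]
  from s have s: "mmap (far F f) ` carrier (fob F (src C f)) = carrier (fob F (tgt C f))"
    using F_mor[OF fa] by (simp add: LMod_mor_iff)
  have "\<theta> x \<in> mmap (far F f) ` carrier (fob F (src C f))"
    unfolding s by (rule theta_carrier[OF x])
  then obtain z where z: "z \<in> carrier (fob F (src C f))" "mmap (far F f) z = \<theta> x" by auto
  define y where "y = inv_into (X (src C f)) \<theta> z"
  have y: "y \<in> X (src C f)" "\<theta> y = z" unfolding y_def using inv_theta o z by auto
  have "cmp C f y = x"
    by (rule theta_inj[OF _ C.cmp_mor[OF y(1) fa] x]) (use o z y theta_cmp[OF y(1) fa] in simp_all)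
  then show ?thesis using y(1) by blast
qed

lemma RR_generator:
  assumes f: "f \<in> mor C a b" and g: "g \<in> mor C a b" and eq: "\<And>x. x \<in> X a \<Longrightarrow> cmp C f x = cmp C g x"
  shows "f = g"
proof -
  have o: "a \<in> obj C" "b \<in> obj C" using C.mor_obj[OF f] by auto
  have "far F f = far F g"
  proof (rule LMod_arr_eqI[where R = R])
    fix z assume "z \<in> carrier (msrc (far F f))"
    then have z: "z \<in> carrier (fob F a)" using F_mor[OF f] by (simp add: LMod_mor_iff)
    define x where "x = inv_into (X a) \<theta> z"
    have x: "x \<in> X a" "\<theta> x = z" unfolding x_def using inv_theta o z by auto
    show "mmap (far F f) z = mmap (far F g) z"
      using theta_cmp[OF x(1) f] theta_cmp[OF x(1) g] eq[OF x(1)] x(2) by simp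
  qed (use F_mor[OF f] F_mor[OF g] in \<open>auto simp: mor_def\<close>)
  then show "f = g" using F_faithful f g o unfolding faithful_functor_def by (blast dest: inj_onD)
qed

sublocale G: represented_modules C R \<RR> Gm
proof unfold_locales
  show "f \<in> mor C a b \<Longrightarrow> g \<in> mor C a b \<Longrightarrow>
      (\<And>x. x \<in> X a \<Longrightarrow> cmp C f x = cmp C g x) \<Longrightarrow> f = g" for f g a b
    by (rule RR_generator)
  show "h \<in> arr C \<Longrightarrow> r \<in> carrier R \<Longrightarrow> x \<in> X (src C h) \<Longrightarrow>
      cmp C h (r \<odot>\<^bsub>Gm (src C h)\<^esub> x) = r \<odot>\<^bsub>Gm (tgt C h)\<^esub> cmp C h x" for h r x
    by (rule Gm_smult_cmp[OF C.arr_mor])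
qed (auto intro: RR_obj Gm_module RR_projective simp: Gm_simps)

lemma G_functor_eq: "G_functor A R F \<RR> \<psi> = G.H"
  by (simp add: G_functor_def)

lemma G_nat_iso: "mod_nat_iso R C G.H F (\<lambda>a. \<theta>)"
  unfolding mod_nat_iso_def
proof (intro conjI ballI)
  fix a assume a: "a \<in> obj C"
  show "\<theta> \<in> mod_iso R (fob G.H a) (fob F a)"
    unfolding mod_iso_def mod_hom_def
    using theta_bij[OF a] theta_carrier by (auto simp: Gm_simps[OF a] theta_padd)
next
  fix f x assume f: "f \<in> arr C" and "x \<in> carrier (fob G.H (src C f))"
  then have "x \<in> X (src C f)" using C.src_obj Gm_simps(1) by simp
  then show "\<theta> (mmap (far G.H f) x) = mmap (far F f) (\<theta> x)"
    using theta_cmp[OF _ C.arr_mor[OF f]] by simp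
qed

lemma G_full: "full_functor C (LMod R) G.H"
  unfolding full_functor_def
proof (intro conjI ballI G.H_functor equalityI subsetI)
  fix a b u assume "u \<in> far G.H ` mor C a b"
  then show "u \<in> mor (LMod R) (fob G.H a) (fob G.H b)" using G.H_mor by (auto simp: mor_def)
next
  fix a b u assume a: "a \<in> obj C" and b: "b \<in> obj C" and "u \<in> mor (LMod R) (fob G.H a) (fob G.H b)"
  then have u: "msrc u = Gm a" "mtgt u = Gm b" "mmap u \<in> mod_hom R (Gm a) (Gm b)" "u \<in> arr (LMod R)"
    by (auto simp: LMod_mor_iff mor_def LMod_arr_iff)
  interpret M: left_module R "fob F a" using modulesD(1) F_obj[OF a] .
  let ?i = "inv_into (X a) \<theta>"
  note i = inv_theta[OF a] and ac = Gm_simps[OF a] and bc = Gm_simps[OF b]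
  have uX: "mmap u x \<in> X b" if "x \<in> X a" for x using mod_homD(1)[OF u(3)] that ac(1) bc(1) by simp
  have iadd: "?i (x \<oplus>\<^bsub>fob F a\<^esub> y) = ?i x \<oplus>\<^bsub>Gm a\<^esub> ?i y"
    if "x \<in> carrier (fob F a)" "y \<in> carrier (fob F a)" for x y
    by (rule theta_inj[OF a]) (use that i C.padd_mor in \<open>simp_all add: ac theta_padd[where a = a]\<close>)
  have ismult: "?i (r \<odot>\<^bsub>fob F a\<^esub> x) = r \<odot>\<^bsub>Gm a\<^esub> ?i x"
    if "r \<in> carrier R" "x \<in> carrier (fob F a)" for r x
    by (rule theta_inj[OF a]) (use that i M.smult_closed in \<open>simp_all add: ac\<close>)
  \<comment> \<open>Conjugating \<open>u\<close> by \<open>\<theta>\<close> gives a homomorphism \<open>F a \<rightarrow> F b\<close>, to which fullness of \<open>F\<close> applies.\<close>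
  have "(\<lambda>x. \<theta> (mmap u (?i x))) \<in> mod_hom R (fob F a) (fob F b)"
    unfolding mod_hom_def
    using theta_carrier uX i
    by (auto simp: iadd ismult mod_homD(2,3)[OF u(3)] ac(1) bc(2,4) theta_padd)
  from LMod_arr_restrict[OF F_obj[OF a] F_obj[OF b] this] obtain f where
    f: "f \<in> mor C a b" "far F f = \<lparr>msrc = fob F a, mmap = \<lambda>x\<in>carrier (fob F a). \<theta> (mmap u (?i x)), mtgt = fob F b\<rparr>"
    using F_full a b unfolding full_functor_def by (metis (no_types, lifting) imageE)
  have fs: "f \<in> arr C" "src C f = a" "tgt C f = b" using f(1) by (auto simp: mor_def)
  have "u = far G.H f"
  proof (rule LMod_arr_eqI[OF u(4) G.H_arr[OF fs(1)]])
    show "msrc u = msrc (far G.H f)" "mtgt u = mtgt (far G.H f)" using u fs by auto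
    fix x assume "x \<in> carrier (msrc u)"
    then have x: "x \<in> X a" using u ac by simp
    have "cmp C f x = mmap u x"
      by (rule theta_inj[OF b C.cmp_mor[OF x f(1)] uX[OF x]])
        (simp add: theta_cmp[OF x f(1)] f(2) theta_carrier[OF x] inv_theta_theta[OF a x])
    then show "mmap u x = mmap (far G.H f) x" using x fs by simp
  qed
  then show "u \<in> far G.H ` mor C a b" using f(1) by blast
qed

end

lemma (in module_embedding) G_LModS:
  assumes "\<And>a. a \<in> obj C \<Longrightarrow> set_in_superstructure S (X a)"
  shows "is_functor C (LModS S R) G.H"
proof -
  have m: "f \<in> mor (LModS S R) M N" if "f \<in> mor (LMod R) M N"
    "set_in_superstructure S (carrier M)" "set_in_superstructure S (carrier N)" for f M N
    using that by (auto simp: mor_def LModS_def full_subcategory_def)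
  have "category (LModS S R)"
    unfolding LModS_def by (rule full_subcategory_category[OF LMod_category])
  then show ?thesis
    using G.H_functor assms C.src_obj C.tgt_obj G.mdl_carrier m
    unfolding is_functor_def by (auto simp: LModS_def full_subcategory_def)
qed

section \<open>Transfer of small abelian categories\<close>

text \<open>
  The category of \<open>A\<close> with composition and addition given by function application, which a bounded
  formula can express. For a small category it differs from \<open>cat_of A\<close> only at pairs that are not
  composable or not parallel, where the description operator in \<open>cat_of A\<close> has an unspecified value.
\<close>

definition cat_app :: "'u::set_universe small_cat \<Rightarrow> ('u, 'u) lin_category" where
  "cat_app A = (cat_of A)\<lparr>cmp := \<lambda>g f. app (cmpS A) (opair g f), padd := \<lambda>f g. app (addS A) (opair f g)\<rparr>"

lemma cat_app_simps:
  "obj (cat_app A) = obj (cat_of A)" "arr (cat_app A) = arr (cat_of A)"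
  "src (cat_app A) = src (cat_of A)" "tgt (cat_app A) = tgt (cat_of A)"
  "idt (cat_app A) = idt (cat_of A)"
  "cmp (cat_app A) g f = app (cmpS A) (opair g f)"
  "padd (cat_app A) f g = app (addS A) (opair f g)"
  by (simp_all add: cat_app_def)

lemma cat_of_simps:
  "obj (cat_of A) = app (srcS A) ` elems (Mors A) \<union> app (tgtS A) ` elems (Mors A)"
  "arr (cat_of A) = elems (Mors A)" "src (cat_of A) = app (srcS A)" "tgt (cat_of A) = app (tgtS A)"
  "idt (cat_of A) a = a"
  by (simp_all add: cat_of_def)

lemma mor_cat_app: "mor (cat_app A) a b = mor (cat_of A) a b"
  by (simp add: mor_def cat_app_simps)

lemma star_cat_simps [simp]:
  "Mors (star_cat star A) = star (Mors A)" "srcS (star_cat star A) = star (srcS A)"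
  "tgtS (star_cat star A) = star (tgtS A)" "cmpS (star_cat star A) = star (cmpS A)"
  "addS (star_cat star A) = star (addS A)"
  by (simp_all add: star_cat_def)

text \<open>
  \<open>c\<close> is a ternary relation on \<open>M\<close> that is the graph of a function at the pairs satisfying \<open>P\<close>.
\<close>

definition graph_on :: "'u::set_universe set \<Rightarrow> 'u \<Rightarrow> ('u \<Rightarrow> 'u \<Rightarrow> bool) \<Rightarrow> bool" where
  "graph_on M c P \<longleftrightarrow> (\<forall>p\<in>elems c. \<exists>x\<in>M. \<exists>y\<in>M. \<exists>z\<in>M. p = opair (opair x y) z) \<and>
     (\<forall>x\<in>M. \<forall>y\<in>M. P x y \<longrightarrow> (\<exists>!z. z \<in> M \<and> opair (opair x y) z \<in> elems c))"

lemma graph_onI: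
  assumes "\<forall>p\<in>elems c. \<exists>x\<in>N. \<exists>y\<in>N. \<exists>z\<in>N. p = otriple x y z \<and> Q x y"
    and "\<forall>x\<in>N. \<forall>y\<in>N. P x y \<longrightarrow> (\<exists>!z. otriple x y z \<in> elems c)"
  shows "graph_on N c P"
proof -
  have "(z \<in> N \<and> otriple x y z \<in> elems c) \<longleftrightarrow> otriple x y z \<in> elems c" for x y z
    using assms(1) by (fastforce simp: otriple_def)
  then show ?thesis using assms unfolding graph_on_def otriple_def by simp (metis)
qed

lemma graph_on_The:
  assumes "graph_on M c P" "x \<in> M" "y \<in> M" "P x y"
  shows "(THE z. otriple x y z \<in> elems c) = app c (opair x y)"
proof -
  have "\<exists>!z. z \<in> M \<and> opair (opair x y) z \<in> elems c" using assms unfolding graph_on_def by blast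
  moreover have "opair (opair x y) z \<in> elems c \<Longrightarrow> z \<in> M" for z
    using assms(1) unfolding graph_on_def by fastforce
  ultimately have "\<exists>!z. opair (opair x y) z \<in> elems c" by metis
  then show ?thesis by (simp add: app_def otriple_def)
qed

lemma cat_app_iso:
  assumes c: "graph_on (elems (Mors A)) (cmpS A) (\<lambda>g f. app (srcS A) g = app (tgtS A) f)"
    and a: "graph_on (elems (Mors A)) (addS A)
      (\<lambda>f g. app (srcS A) f = app (srcS A) g \<and> app (tgtS A) f = app (tgtS A) g)"
  shows "preadditive_category (cat_of A) \<Longrightarrow> preadditive_iso (cat_of A) (cat_app A) id id"
    and "preadditive_category (cat_app A) \<Longrightarrow> preadditive_iso (cat_app A) (cat_of A) id id"
proof -
  have cm: "cmp (cat_of A) g f = app (cmpS A) (opair g f)"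
    if "f \<in> arr (cat_of A)" "g \<in> arr (cat_of A)" "src (cat_of A) g = tgt (cat_of A) f" for f g
    using graph_on_The[OF c, of g f] that by (simp add: cat_of_def)
  have pm: "padd (cat_of A) f g = app (addS A) (opair f g)"
    if "f \<in> mor (cat_of A) a b" "g \<in> mor (cat_of A) a b" for f g a b
    using graph_on_The[OF a, of f g] that by (simp add: cat_of_def mor_def)
  show "preadditive_category (cat_of A) \<Longrightarrow> preadditive_iso (cat_of A) (cat_app A) id id"
    unfolding preadditive_iso_def preadditive_iso_axioms_def
    by (auto simp: cat_app_simps cm pm)
  show "preadditive_category (cat_app A) \<Longrightarrow> preadditive_iso (cat_app A) (cat_of A) id id"
    unfolding preadditive_iso_def preadditive_iso_axioms_def
    by (auto simp: cat_app_simps cm pm mor_cat_app)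
qed

text \<open>
  The rules below let the synthesis of formulas treat the vocabulary of category theory as if it
  were primitive; a primed name refers to the enlargement.
\<close>

locale enlarged_category = enlarged S star for S :: "'u::set_universe" and star +
  fixes A :: "'u small_cat"
  assumes small_A: "abelian_small_category S A"
begin

abbreviation A' :: "'u small_cat" where "A' \<equiv> star_cat star A"
abbreviation M :: "'u set" where "M \<equiv> elems (Mors A)"

lemma abelian_cat_of: "abelian_category (cat_of A)"
  using small_A by (simp add: abelian_small_category_def)

lemma Mors_V [star_intros]: "Mors A \<in> V"
  using small_A by (simp add: abelian_small_category_def small_category_def)

lemma M_bounded: "bounded_in S M"
  by (rule bounded_elems[OF base Mors_V])

lemma V_subset_Times:
  assumes "is_set c" "elems c \<subseteq> {opair x y | x y. x \<in> Y \<and> y \<in> Z}" "bounded_in S Y" "bounded_in S Z"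
  shows "c \<in> V"
proof -
  have "bounded_in S (elems c)"
    by (rule bounded_subset[OF base bounded_Times[OF base assms(3,4)] assms(2)])
  from bounded_mkset(2)[OF base this] show ?thesis by (simp add: mkset_elems assms(1))
qed

lemma srcS_V [star_intros]: "srcS A \<in> V" and tgtS_V [star_intros]: "tgtS A \<in> V"
  using small_A unfolding abelian_small_category_def small_category_def is_map_def
  by (auto intro!: V_subset_Times[OF _ _ M_bounded M_bounded])

lemma cmpS_V [star_intros]: "cmpS A \<in> V"
  using small_A unfolding abelian_small_category_def small_category_def otriple_def
  by (intro V_subset_Times[OF _ _ bounded_Times[OF base M_bounded M_bounded] M_bounded]) (blast+)

lemma addS_V [star_intros]: "addS A \<in> V"
  using small_A unfolding abelian_small_category_def otriple_def
  by (intro V_subset_Times[OF _ _ bounded_Times[OF base M_bounded M_bounded] M_bounded]) (blast+)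

lemma src_tgt_closed:
  "f \<in> M \<Longrightarrow> app (srcS A) f \<in> M" "f \<in> M \<Longrightarrow> app (tgtS A) f \<in> M"
proof -
  have *: "app g f \<in> elems (Mors A)" if "is_map g M M" "f \<in> M" for g
  proof -
    from that have "\<exists>!y. opair f y \<in> elems g" and e: "\<forall>p\<in>elems g. \<exists>x\<in>M. \<exists>y\<in>M. p = opair x y"
      by (auto simp: is_map_def)
    then have "opair f (app g f) \<in> elems g" by (simp add: app_def) (rule theI')
    then show ?thesis using e by force
  qed
  show "f \<in> M \<Longrightarrow> app (srcS A) f \<in> M" "f \<in> M \<Longrightarrow> app (tgtS A) f \<in> M"
    using small_A by (auto simp: abelian_small_category_def small_category_def intro!: *)
qed

lemma star_src_tgt_closed:
  "\<forall>f\<in>elems (star (Mors A)). app (star (srcS A)) f \<in> elems (star (Mors A)) \<and>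
     app (star (tgtS A)) f \<in> elems (star (Mors A))"
proof -
  have "(\<forall>f\<in>M. app (srcS A) f \<in> M \<and> app (tgtS A) f \<in> M) \<longleftrightarrow>
    (\<forall>f\<in>elems (star (Mors A)). app (star (srcS A)) f \<in> elems (star (Mors A)) \<and>
     app (star (tgtS A)) f \<in> elems (star (Mors A)))"
    by (rule transferI) (intro star_intros)
  then show ?thesis using src_tgt_closed by blast
qed

lemma tr_set_arr [star_intros]: "valid_ctx \<Gamma> \<Longrightarrow> tr_set \<Gamma> (\<lambda>e. arr (cat_app A)) (\<lambda>e. arr (cat_app A'))"
  unfolding cat_app_simps cat_of_simps star_cat_simps by (intro star_intros)

lemma tr_trm_src [star_intros]: "tr_trm \<Gamma> x x' \<Longrightarrow> tr_trm \<Gamma> (\<lambda>e. src (cat_app A) (x e)) (\<lambda>e. src (cat_app A') (x' e))"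
  unfolding cat_app_simps cat_of_simps star_cat_simps by (intro star_intros) (auto intro: tr_trm_valid star_intros)

lemma tr_trm_tgt [star_intros]: "tr_trm \<Gamma> x x' \<Longrightarrow> tr_trm \<Gamma> (\<lambda>e. tgt (cat_app A) (x e)) (\<lambda>e. tgt (cat_app A') (x' e))"
  unfolding cat_app_simps cat_of_simps star_cat_simps by (intro star_intros) (auto intro: tr_trm_valid star_intros)

lemma tr_trm_idt [star_intros]: "tr_trm \<Gamma> x x' \<Longrightarrow> tr_trm \<Gamma> (\<lambda>e. idt (cat_app A) (x e)) (\<lambda>e. idt (cat_app A') (x' e))"
  unfolding cat_app_simps cat_of_simps .

lemma tr_trm_cmp [star_intros]:
  assumes "tr_trm \<Gamma> x x'" "tr_trm \<Gamma> y y'"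
  shows "tr_trm \<Gamma> (\<lambda>e. cmp (cat_app A) (x e) (y e)) (\<lambda>e. cmp (cat_app A') (x' e) (y' e))"
  unfolding cat_app_simps cat_of_simps star_cat_simps by (intro star_intros assms tr_trm_valid[OF assms(1)])

lemma tr_trm_padd [star_intros]:
  assumes "tr_trm \<Gamma> x x'" "tr_trm \<Gamma> y y'"
  shows "tr_trm \<Gamma> (\<lambda>e. padd (cat_app A) (x e) (y e)) (\<lambda>e. padd (cat_app A') (x' e) (y' e))"
  unfolding cat_app_simps cat_of_simps star_cat_simps by (intro star_intros assms tr_trm_valid[OF assms(1)])

lemma tr_set_mor [star_intros]:
  assumes "tr_trm \<Gamma> a a'" "tr_trm \<Gamma> b b'"
  shows "tr_set \<Gamma> (\<lambda>e. mor (cat_app A) (a e) (b e)) (\<lambda>e. mor (cat_app A') (a' e) (b' e))"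
  unfolding mor_def by (intro star_intros assms tr_trm_valid[OF assms(1)])

lemma tr_set_obj [star_intros]:
  assumes "valid_ctx \<Gamma>" shows "tr_set \<Gamma> (\<lambda>e. obj (cat_app A)) (\<lambda>e. obj (cat_app A'))"
proof -
  have "obj (cat_app A) = {x \<in> M. \<exists>f\<in>M. x = app (srcS A) f \<or> x = app (tgtS A) f}"
    using src_tgt_closed by (auto simp: cat_app_simps cat_of_simps)
  moreover have "obj (cat_app A') = {x \<in> elems (star (Mors A)). \<exists>f\<in>elems (star (Mors A)).
      x = app (star (srcS A)) f \<or> x = app (star (tgtS A)) f}"
    using star_src_tgt_closed by (auto simp: cat_app_simps cat_of_simps)
  moreover have "tr_set \<Gamma> (\<lambda>e. {x \<in> M. \<exists>f\<in>M. x = app (srcS A) f \<or> x = app (tgtS A) f})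
    (\<lambda>e. {x \<in> elems (star (Mors A)). \<exists>f\<in>elems (star (Mors A)).
      x = app (star (srcS A)) f \<or> x = app (star (tgtS A)) f})"
    by (intro star_intros assms)
  ultimately show ?thesis by simp
qed

lemma tr_form_zero_arrow [star_intros]:
  assumes "tr_trm \<Gamma> f f'" shows "tr_form \<Gamma> (\<lambda>e. zero_arrow (cat_app A) (f e)) (\<lambda>e. zero_arrow (cat_app A') (f' e))"
  unfolding zero_arrow_def by (intro star_intros assms tr_trm_valid[OF assms(1)])

lemma tr_form_is_kernel [star_intros]:
  assumes "tr_trm \<Gamma> k k'" "tr_trm \<Gamma> f f'"
  shows "tr_form \<Gamma> (\<lambda>e. is_kernel (cat_app A) (k e) (f e)) (\<lambda>e. is_kernel (cat_app A') (k' e) (f' e))"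
  unfolding is_kernel_def by (intro star_intros assms tr_trm_valid[OF assms(1)])

lemma tr_form_is_cokernel [star_intros]:
  assumes "tr_trm \<Gamma> k k'" "tr_trm \<Gamma> f f'"
  shows "tr_form \<Gamma> (\<lambda>e. is_cokernel (cat_app A) (k e) (f e)) (\<lambda>e. is_cokernel (cat_app A') (k' e) (f' e))"
  unfolding is_cokernel_def by (intro star_intros assms tr_trm_valid[OF assms(1)])

lemma tr_form_monic [star_intros]:
  assumes "tr_trm \<Gamma> f f'" shows "tr_form \<Gamma> (\<lambda>e. monic (cat_app A) (f e)) (\<lambda>e. monic (cat_app A') (f' e))"
  unfolding monic_iff by (intro star_intros assms tr_trm_valid[OF assms(1)])

lemma tr_form_epic [star_intros]:
  assumes "tr_trm \<Gamma> f f'" shows "tr_form \<Gamma> (\<lambda>e. epic (cat_app A) (f e)) (\<lambda>e. epic (cat_app A') (f' e))"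
  unfolding epic_iff by (intro star_intros assms tr_trm_valid[OF assms(1)])

text \<open>
  All axioms of an abelian category form one bounded statement.
\<close>

lemma abelian_transfer: "abelian_category (cat_app A) \<longleftrightarrow> abelian_category (cat_app A')"
  unfolding abelian_category_iff additive_category_iff preadditive_category_iff category_iff
    zero_object_def is_biproduct_def abgrp_def
  by (rule transferI) (intro star_intros)

lemma graph_on_A:
  "graph_on M (cmpS A) (\<lambda>g f. app (srcS A) g = app (tgtS A) f)"
  "graph_on M (addS A) (\<lambda>f g. app (srcS A) f = app (srcS A) g \<and> app (tgtS A) f = app (tgtS A) g)"
proof -
  show "graph_on M (cmpS A) (\<lambda>g f. app (srcS A) g = app (tgtS A) f)"
    by (rule graph_onI[where Q = "\<lambda>g f. app (srcS A) g = app (tgtS A) f"])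
      (use small_A in \<open>unfold abelian_small_category_def small_category_def, blast+\<close>)
  show "graph_on M (addS A) (\<lambda>f g. app (srcS A) f = app (srcS A) g \<and> app (tgtS A) f = app (tgtS A) g)"
    by (rule graph_onI[where Q = "\<lambda>f g. app (srcS A) f = app (srcS A) g \<and> app (tgtS A) f = app (tgtS A) g"])
      (use small_A in \<open>unfold abelian_small_category_def, blast+\<close>)
qed

lemma graph_on_A':
  "graph_on (elems (Mors A')) (cmpS A') (\<lambda>g f. app (srcS A') g = app (tgtS A') f)"
  "graph_on (elems (Mors A')) (addS A')
     (\<lambda>f g. app (srcS A') f = app (srcS A') g \<and> app (tgtS A') f = app (tgtS A') g)"
proof -
  have "graph_on M (cmpS A) (\<lambda>g f. app (srcS A) g = app (tgtS A) f) \<longleftrightarrow>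
    graph_on (elems (Mors A')) (cmpS A') (\<lambda>g f. app (srcS A') g = app (tgtS A') f)"
    unfolding graph_on_def star_cat_simps by (rule transferI) (intro star_intros)
  then show "graph_on (elems (Mors A')) (cmpS A') (\<lambda>g f. app (srcS A') g = app (tgtS A') f)"
    using graph_on_A by blast
  have "graph_on M (addS A) (\<lambda>f g. app (srcS A) f = app (srcS A) g \<and> app (tgtS A) f = app (tgtS A) g) \<longleftrightarrow>
    graph_on (elems (Mors A')) (addS A')
      (\<lambda>f g. app (srcS A') f = app (srcS A') g \<and> app (tgtS A') f = app (tgtS A') g)"
    unfolding graph_on_def star_cat_simps by (rule transferI) (intro star_intros)
  then show "graph_on (elems (Mors A')) (addS A')
     (\<lambda>f g. app (srcS A') f = app (srcS A') g \<and> app (tgtS A') f = app (tgtS A') g)"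
    using graph_on_A by blast
qed

lemma abelian_imp_preadditive: "abelian_category D \<Longrightarrow> preadditive_category D"
  by (simp add: abelian_category_def additive_category_def)

sublocale iso_A: preadditive_iso "cat_of A" "cat_app A" id id
  by (rule cat_app_iso[OF graph_on_A]) (rule abelian_imp_preadditive[OF abelian_cat_of])

lemma abelian_cat_app: "abelian_category (cat_app A)" "abelian_category (cat_app A')"
  using iso_A.abelian_D[OF abelian_cat_of] abelian_transfer by blast+

sublocale iso_A': preadditive_iso "cat_app A'" "cat_of A'" id id
  by (rule cat_app_iso[OF graph_on_A']) (rule abelian_imp_preadditive[OF abelian_cat_app(2)])

lemma abelian_cat_of_star: "abelian_category (cat_of A')"
  by (rule iso_A'.abelian_D[OF abelian_cat_app(2)])

lemma cmp_app: "f \<in> mor (cat_of A) a b \<Longrightarrow> g \<in> mor (cat_of A) b c \<Longrightarrow>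
    cmp (cat_app A) g f = cmp (cat_of A) g f"
  using iso_A.cmp_D[of f g] by (simp add: mor_def)

lemma cmp_app': "f \<in> mor (cat_of A') a b \<Longrightarrow> g \<in> mor (cat_of A') b c \<Longrightarrow>
    cmp (cat_app A') g f = cmp (cat_of A') g f"
  using iso_A'.cmp_D[of f g] by (simp add: mor_def cat_app_simps)

lemma padd_app: "f \<in> mor (cat_of A) a b \<Longrightarrow> g \<in> mor (cat_of A) a b \<Longrightarrow>
    padd (cat_app A) f g = padd (cat_of A) f g"
  using iso_A.padd_D[of f a b g] by simp

lemma padd_app': "f \<in> mor (cat_of A') a b \<Longrightarrow> g \<in> mor (cat_of A') a b \<Longrightarrow>
    padd (cat_app A') f g = padd (cat_of A') f g"
  using iso_A'.padd_D[of f a b g] by (simp add: mor_cat_app)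

lemma obj_V: "a \<in> obj (cat_of A) \<Longrightarrow> a \<in> V" and arr_V: "f \<in> arr (cat_of A) \<Longrightarrow> f \<in> V"
  using bounded_elem[OF base M_bounded] src_tgt_closed by (auto simp: cat_of_simps)

lemma star_obj: "a \<in> obj (cat_of A) \<Longrightarrow> star a \<in> obj (cat_of A')"
proof -
  assume a: "a \<in> obj (cat_of A)"
  have "a \<in> obj (cat_app A) \<longleftrightarrow> star a \<in> obj (cat_app A')"
    by (rule transferI) (intro star_intros obj_V[OF a])
  then show ?thesis using a by (simp add: cat_app_simps)
qed

lemma star_arr:
  assumes "f \<in> arr (cat_of A)"
  shows "star f \<in> arr (cat_of A')" "src (cat_of A') (star f) = star (src (cat_of A) f)"
    "tgt (cat_of A') (star f) = star (tgt (cat_of A) f)"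
proof -
  have "f \<in> arr (cat_app A) \<longleftrightarrow> star f \<in> arr (cat_app A')"
    by (rule transferI) (intro star_intros arr_V[OF assms])
  then show "star f \<in> arr (cat_of A')" using assms by (simp add: cat_app_simps)
  show "src (cat_of A') (star f) = star (src (cat_of A) f)"
    "tgt (cat_of A') (star f) = star (tgt (cat_of A) f)"
    using star_app[OF srcS_V arr_V[OF assms]] star_app[OF tgtS_V arr_V[OF assms]]
      obj_V[OF iso_A.src_obj[OF assms]] obj_V[OF iso_A.tgt_obj[OF assms]]
    by (simp_all add: cat_of_simps)
qed

lemma star_functor: "is_functor (cat_of A) (cat_of A') (star_cat_functor star)"
proof -
  have "star (cmp (cat_of A) g f) = cmp (cat_of A') (star g) (star f)"
    if f: "f \<in> arr (cat_of A)" "g \<in> arr (cat_of A)" "src (cat_of A) g = tgt (cat_of A) f" for f g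
  proof -
    have fm: "f \<in> mor (cat_of A) (src (cat_of A) f) (tgt (cat_of A) f)"
      and gm: "g \<in> mor (cat_of A) (tgt (cat_of A) f) (tgt (cat_of A) g)" using f by (auto simp: mor_def)
    have h: "cmp (cat_of A) g f \<in> V" using iso_A.cmp_mor[OF fm gm] arr_V by (simp add: mor_def)
    have "cmp (cat_of A) g f = cmp (cat_app A) g f \<longleftrightarrow> star (cmp (cat_of A) g f) = cmp (cat_app A') (star g) (star f)"
      by (rule transferI) (intro star_intros h arr_V f)
    then show ?thesis
      using cmp_app[OF fm gm] cmp_app'[of "star f" "star (src (cat_of A) f)"
          "star (tgt (cat_of A) f)" "star g" "star (tgt (cat_of A) g)"]
        star_arr[OF f(1)] star_arr[OF f(2)] f(3) by (simp add: mor_def)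
  qed
  moreover have "category (cat_of A)" "category (cat_of A')"
    by (rule iso_A.category_axioms iso_A'.category_D)+
  ultimately show ?thesis
    unfolding is_functor_def by (auto simp: star_cat_functor_def mor_def star_obj star_arr cat_of_simps(5))
qed

end

section \<open>Transfer of rings and modules\<close>

lemma ring_iff: "ring R \<longleftrightarrow> abgrp (carrier R) (add R) \<and> \<zero>\<^bsub>R\<^esub> \<in> carrier R \<and>
    (\<forall>x\<in>carrier R. \<zero>\<^bsub>R\<^esub> \<oplus>\<^bsub>R\<^esub> x = x) \<and> \<one>\<^bsub>R\<^esub> \<in> carrier R \<and>
    (\<forall>x\<in>carrier R. \<one>\<^bsub>R\<^esub> \<otimes>\<^bsub>R\<^esub> x = x \<and> x \<otimes>\<^bsub>R\<^esub> \<one>\<^bsub>R\<^esub> = x) \<and>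
    (\<forall>x\<in>carrier R. \<forall>y\<in>carrier R. x \<otimes>\<^bsub>R\<^esub> y \<in> carrier R) \<and>
    (\<forall>x\<in>carrier R. \<forall>y\<in>carrier R. \<forall>z\<in>carrier R. (x \<otimes>\<^bsub>R\<^esub> y) \<otimes>\<^bsub>R\<^esub> z = x \<otimes>\<^bsub>R\<^esub> (y \<otimes>\<^bsub>R\<^esub> z) \<and>
       (x \<oplus>\<^bsub>R\<^esub> y) \<otimes>\<^bsub>R\<^esub> z = x \<otimes>\<^bsub>R\<^esub> z \<oplus>\<^bsub>R\<^esub> y \<otimes>\<^bsub>R\<^esub> z \<and>
       z \<otimes>\<^bsub>R\<^esub> (x \<oplus>\<^bsub>R\<^esub> y) = z \<otimes>\<^bsub>R\<^esub> x \<oplus>\<^bsub>R\<^esub> z \<otimes>\<^bsub>R\<^esub> y)"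
  (is "_ \<longleftrightarrow> ?ops")
proof
  assume "ring R"
  then interpret ring R .
  have "\<exists>y\<in>carrier R. y \<oplus>\<^bsub>R\<^esub> x = \<zero>\<^bsub>R\<^esub>" if "x \<in> carrier R" for x
    using that by (intro bexI[of _ "\<ominus>\<^bsub>R\<^esub> x"]) (auto simp: l_neg)
  then have "\<exists>z\<in>carrier R. \<forall>x\<in>carrier R. z \<oplus>\<^bsub>R\<^esub> x = x \<and> (\<exists>y\<in>carrier R. y \<oplus>\<^bsub>R\<^esub> x = z)"
    by (intro bexI[of _ "\<zero>\<^bsub>R\<^esub>"]) auto
  then have "abgrp (carrier R) (add R)"
    unfolding abgrp_def by (auto simp: a_assoc intro: a_comm)
  then show ?ops by (simp add: l_distr r_distr m_assoc)
next
  assume ops: ?ops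
  then have ab: "abgrp (carrier R) (add R)" by blast
  have z: "\<zero>\<^bsub>R\<^esub> \<in> carrier R" "\<forall>x\<in>carrier R. \<zero>\<^bsub>R\<^esub> \<oplus>\<^bsub>R\<^esub> x = x" using ops by blast+
  have cl: "\<forall>x\<in>carrier R. \<forall>y\<in>carrier R. x \<oplus>\<^bsub>R\<^esub> y \<in> carrier R \<and> x \<oplus>\<^bsub>R\<^esub> y = y \<oplus>\<^bsub>R\<^esub> x"
    "\<forall>x\<in>carrier R. \<forall>y\<in>carrier R. \<forall>z\<in>carrier R. (x \<oplus>\<^bsub>R\<^esub> y) \<oplus>\<^bsub>R\<^esub> z = x \<oplus>\<^bsub>R\<^esub> (y \<oplus>\<^bsub>R\<^esub> z)"
    using ab by (auto simp: abgrp_def)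
  have "abelian_group R"
  proof (rule abelian_groupI)
    fix x assume "x \<in> carrier R"
    then show "\<exists>y\<in>carrier R. y \<oplus>\<^bsub>R\<^esub> x = \<zero>\<^bsub>R\<^esub>" using abgrp_diff[OF ab z(1)] by blast
  qed (use cl z in blast)+
  moreover have "monoid R" by (rule monoidI) (use ops in blast)+
  ultimately show "ring R" by (rule ringI) (use ops in blast)+
qed

text \<open>
  The ring \<open>R\<close> with its operations read off from their graphs, as \<open>star_ring\<close> does with the images of
  these graphs. It agrees with \<open>R\<close> on the carrier.
\<close>

definition app_ring :: "'u::set_universe ring \<Rightarrow> 'u ring" where
  "app_ring R = \<lparr>carrier = elems (mkset (carrier R)),
      monoid.mult = (\<lambda>x y. app (graph2 (monoid.mult R) (carrier R) (carrier R)) (opair x y)),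
      one = \<one>\<^bsub>R\<^esub>, zero = \<zero>\<^bsub>R\<^esub>,
      add = (\<lambda>x y. app (graph2 (add R) (carrier R) (carrier R)) (opair x y))\<rparr>"

lemma module_ops_cong:
  assumes "ring R" "module_ops R X ad sm"
    and c: "carrier R' = carrier R" "\<one>\<^bsub>R'\<^esub> = \<one>\<^bsub>R\<^esub>"
    and r: "\<And>x y. x \<in> carrier R \<Longrightarrow> y \<in> carrier R \<Longrightarrow> x \<oplus>\<^bsub>R'\<^esub> y = x \<oplus>\<^bsub>R\<^esub> y"
      "\<And>x y. x \<in> carrier R \<Longrightarrow> y \<in> carrier R \<Longrightarrow> x \<otimes>\<^bsub>R'\<^esub> y = x \<otimes>\<^bsub>R\<^esub> y"
    and m: "\<And>x y. x \<in> X \<Longrightarrow> y \<in> X \<Longrightarrow> ad' x y = ad x y"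
      "\<And>r x. r \<in> carrier R \<Longrightarrow> x \<in> X \<Longrightarrow> sm' r x = sm r x"
  shows "module_ops R' X ad' sm'"
proof -
  interpret ring R by fact
  have ab: "abgrp X ad" using assms(2) by (simp add: module_ops_def)
  then have cl: "x \<in> X \<Longrightarrow> y \<in> X \<Longrightarrow> ad x y \<in> X" for x y by (simp add: abgrp_def)
  have "abgrp X ad'" by (rule abgrp_image[OF ab, of id]) (simp_all add: m)
  then show ?thesis
    using assms(2) unfolding module_ops_def by (simp add: c r m cl)
qed

lemma star_module_carrier [simp]:
  "carrier (star_module star R M) = elems (star (mkset (carrier M)))"
  by (simp add: star_module_def)

lemma star_module_ops:
  "x \<in> carrier (star_module star R M) \<Longrightarrow> y \<in> carrier (star_module star R M) \<Longrightarrow>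
     x \<oplus>\<^bsub>star_module star R M\<^esub> y = app (star (graph2 (add M) (carrier M) (carrier M))) (opair x y)"
  "r \<in> carrier (star_ring star R) \<Longrightarrow> x \<in> carrier (star_module star R M) \<Longrightarrow>
     r \<odot>\<^bsub>star_module star R M\<^esub> x = app (star (graph2 (smult M) (carrier R) (carrier M))) (opair r x)"
  by (simp_all add: star_module_def)

locale enlarged_ring = enlarged S star for S :: "'u::set_universe" and star +
  fixes R :: "'u ring"
  assumes ring_R: "ring R" and carrier_R: "set_in_superstructure S (carrier R)"
begin

sublocale R: ring R by (rule ring_R)

abbreviation R0 :: "'u ring" where "R0 \<equiv> app_ring R"
abbreviation R' :: "'u ring" where "R' \<equiv> star_ring star R"

lemma R_bounded: "bounded_in S (carrier R)"
  using carrier_R set_in_superstructure_iff[OF base] by simp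

lemma carrier_R_V [star_intros]: "mkset (carrier R) \<in> V"
  by (rule bounded_mkset(2)[OF base R_bounded])

lemma elems_carrier_R: "elems (mkset (carrier R)) = carrier R"
  by (rule small_mkset(2)[OF bounded_mkset(1)[OF base R_bounded]])

lemmas R_add_graph = graph2_superstructure[OF base R_bounded R_bounded R_bounded, of "add R", OF R.a_closed]
  and R_mult_graph = graph2_superstructure[OF base R_bounded R_bounded R_bounded, of "monoid.mult R", OF R.m_closed]

lemmas R_graphs_V [star_intros] = R_add_graph(1) R_mult_graph(1)

lemma R_consts_V [star_intros]: "\<one>\<^bsub>R\<^esub> \<in> V" "\<zero>\<^bsub>R\<^esub> \<in> V"
  using bounded_elem[OF base R_bounded] by auto

lemma R0_simps:
  "carrier R0 = carrier R" "\<one>\<^bsub>R0\<^esub> = \<one>\<^bsub>R\<^esub>" "\<zero>\<^bsub>R0\<^esub> = \<zero>\<^bsub>R\<^esub>"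
  "x \<in> carrier R \<Longrightarrow> y \<in> carrier R \<Longrightarrow> x \<oplus>\<^bsub>R0\<^esub> y = x \<oplus>\<^bsub>R\<^esub> y"
  "x \<in> carrier R \<Longrightarrow> y \<in> carrier R \<Longrightarrow> x \<otimes>\<^bsub>R0\<^esub> y = x \<otimes>\<^bsub>R\<^esub> y"
  by (simp_all add: app_ring_def elems_carrier_R R_add_graph(2) R_mult_graph(2))

lemma ring_R0: "ring R0"
proof -
  have "abgrp (carrier R) (add R0)"
    by (rule abgrp_image[where h = id and X = "carrier R" and ad = "add R"])
      (use ring_R in \<open>simp_all add: ring_iff[of R] R0_simps\<close>)
  then show ?thesis
    unfolding ring_iff[of R0] by (simp add: R0_simps R.m_assoc R.l_distr R.r_distr)
qed

lemma tr_set_R [star_intros]: "valid_ctx \<Gamma> \<Longrightarrow> tr_set \<Gamma> (\<lambda>e. carrier R0) (\<lambda>e. carrier R')"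
  unfolding app_ring_def star_ring_def partial_object.simps by (intro star_intros)

lemma tr_trm_R_one [star_intros]: "valid_ctx \<Gamma> \<Longrightarrow> tr_trm \<Gamma> (\<lambda>e. \<one>\<^bsub>R0\<^esub>) (\<lambda>e. \<one>\<^bsub>R'\<^esub>)"
  unfolding app_ring_def star_ring_def monoid.simps by (intro star_intros)

lemma tr_trm_R_zero [star_intros]: "valid_ctx \<Gamma> \<Longrightarrow> tr_trm \<Gamma> (\<lambda>e. \<zero>\<^bsub>R0\<^esub>) (\<lambda>e. \<zero>\<^bsub>R'\<^esub>)"
  unfolding app_ring_def star_ring_def ring.simps by (intro star_intros)

lemma tr_trm_R_add [star_intros]:
  assumes "tr_trm \<Gamma> x x'" "tr_trm \<Gamma> y y'"
  shows "tr_trm \<Gamma> (\<lambda>e. x e \<oplus>\<^bsub>R0\<^esub> y e) (\<lambda>e. x' e \<oplus>\<^bsub>R'\<^esub> y' e)"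
  unfolding app_ring_def star_ring_def ring.simps by (intro star_intros assms tr_trm_valid[OF assms(1)])

lemma tr_trm_R_mult [star_intros]:
  assumes "tr_trm \<Gamma> x x'" "tr_trm \<Gamma> y y'"
  shows "tr_trm \<Gamma> (\<lambda>e. x e \<otimes>\<^bsub>R0\<^esub> y e) (\<lambda>e. x' e \<otimes>\<^bsub>R'\<^esub> y' e)"
  unfolding app_ring_def star_ring_def monoid.simps by (intro star_intros assms tr_trm_valid[OF assms(1)])

lemma ring_R': "ring R'"
proof -
  have "ring R0 \<longleftrightarrow> ring R'"
    unfolding ring_iff abgrp_def by (rule transferI) (intro star_intros)
  then show ?thesis using ring_R0 by simp
qed

lemma app_module_ops:
  assumes "module_ops R X ad sm"
    "\<And>x y. x \<in> X \<Longrightarrow> y \<in> X \<Longrightarrow> ad' x y = ad x y"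
    "\<And>r x. r \<in> carrier R \<Longrightarrow> x \<in> X \<Longrightarrow> sm' r x = sm r x"
  shows "module_ops R0 X ad' sm'"
  by (rule module_ops_cong[OF ring_R assms(1)]) (simp_all add: R0_simps assms)

abbreviation add_graph :: "('u, 'u) module \<Rightarrow> 'u" where
  "add_graph N \<equiv> graph2 (add N) (carrier N) (carrier N)"
abbreviation smult_graph :: "('u, 'u) module \<Rightarrow> 'u" where
  "smult_graph N \<equiv> graph2 (smult N) (carrier R) (carrier N)"

lemma LModS_obj:
  assumes "N \<in> obj (LModS S R)"
  shows "N \<in> modules R" "bounded_in S (carrier N)" "mkset (carrier N) \<in> V"
    "elems (mkset (carrier N)) = carrier N"
    "add_graph N \<in> V" "smult_graph N \<in> V"
    "x \<in> carrier N \<Longrightarrow> y \<in> carrier N \<Longrightarrow> app (add_graph N) (opair x y) = x \<oplus>\<^bsub>N\<^esub> y"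
    "r \<in> carrier R \<Longrightarrow> y \<in> carrier N \<Longrightarrow> app (smult_graph N) (opair r y) = r \<odot>\<^bsub>N\<^esub> y"
proof -
  show m: "N \<in> modules R" and b: "bounded_in S (carrier N)"
    using assms set_in_superstructure_iff[OF base] by (auto simp: LModS_def full_subcategory_def)
  show "mkset (carrier N) \<in> V" by (rule bounded_mkset(2)[OF base b])
  show "elems (mkset (carrier N)) = carrier N"
    by (rule small_mkset(2)[OF bounded_mkset(1)[OF base b]])
  interpret N: left_module R N using modulesD(1) m .
  note a = graph2_superstructure[OF base b b b, of "add N", OF N.M.a_closed]
  note s = graph2_superstructure[OF base R_bounded b b, of "smult N", OF N.smult_closed]
  show "add_graph N \<in> V" "smult_graph N \<in> V" using a(1) s(1) by simp_all
  show "x \<in> carrier N \<Longrightarrow> y \<in> carrier N \<Longrightarrow> app (add_graph N) (opair x y) = x \<oplus>\<^bsub>N\<^esub> y"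
    "r \<in> carrier R \<Longrightarrow> y \<in> carrier N \<Longrightarrow> app (smult_graph N) (opair r y) = r \<odot>\<^bsub>N\<^esub> y"
    using a(2) s(2) by simp_all
qed

lemma star_module_modules:
  assumes N: "N \<in> obj (LModS S R)" shows "star_module star R N \<in> modules R'"
proof -
  note n = LModS_obj[OF N]
  have "module_ops R0 (elems (mkset (carrier N))) (\<lambda>x y. app (add_graph N) (opair x y))
      (\<lambda>r x. app (smult_graph N) (opair r x))"
    unfolding n(4) by (rule app_module_ops[OF modulesD(5)[OF n(1)]]) (simp_all add: n)
  moreover have "module_ops R0 (elems (mkset (carrier N))) (\<lambda>x y. app (add_graph N) (opair x y))
      (\<lambda>r x. app (smult_graph N) (opair r x)) \<longleftrightarrow>
    module_ops R' (elems (star (mkset (carrier N)))) (\<lambda>x y. app (star (add_graph N)) (opair x y))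
      (\<lambda>r x. app (star (smult_graph N)) (opair r x))"
    unfolding module_ops_def abgrp_def by (rule transferI) (intro star_intros n)
  ultimately show ?thesis
    unfolding star_module_def by (intro mk_module_in_modules[OF ring_R']) simp
qed

lemma LModS_arr:
  assumes "f \<in> arr (LModS S R)"
  shows "f \<in> arr (LMod R)" "msrc f \<in> obj (LModS S R)" "mtgt f \<in> obj (LModS S R)"
    "mmap f \<in> mod_hom R (msrc f) (mtgt f)"
    "graph1 (mmap f) (carrier (msrc f)) \<in> V"
    "x \<in> carrier (msrc f) \<Longrightarrow> app (graph1 (mmap f) (carrier (msrc f))) x = mmap f x"
proof -
  show f: "f \<in> arr (LMod R)" and m: "msrc f \<in> obj (LModS S R)" "mtgt f \<in> obj (LModS S R)"
    using assms by (auto simp: LModS_def full_subcategory_def LMod_arr_iff)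
  then show h: "mmap f \<in> mod_hom R (msrc f) (mtgt f)" by (simp add: LMod_arr_iff)
  note g = graph1_superstructure[OF base LModS_obj(2)[OF m(1)] LModS_obj(2)[OF m(2)], of "mmap f", OF mod_homD(1)[OF h]]
  show "graph1 (mmap f) (carrier (msrc f)) \<in> V" by (rule g(1))
  show "x \<in> carrier (msrc f) \<Longrightarrow> app (graph1 (mmap f) (carrier (msrc f))) x = mmap f x" by (rule g(2))
qed

lemma star_arrow_hom:
  assumes f: "f \<in> arr (LModS S R)"
  shows "app (star (graph1 (mmap f) (carrier (msrc f)))) \<in>
    mod_hom R' (star_module star R (msrc f)) (star_module star R (mtgt f))"
proof -
  let ?g = "graph1 (mmap f) (carrier (msrc f))" and ?M = "msrc f" and ?N = "mtgt f"
  note a = LModS_arr[OF f]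
  note m = LModS_obj[OF a(2)] and n = LModS_obj[OF a(3)]
  interpret M: left_module R ?M using modulesD(1) m(1) .
  have "(\<forall>x\<in>elems (mkset (carrier ?M)). app ?g x \<in> elems (mkset (carrier ?N))) \<and>
    (\<forall>x\<in>elems (mkset (carrier ?M)). \<forall>y\<in>elems (mkset (carrier ?M)).
       app ?g (app (add_graph ?M) (opair x y)) = app (add_graph ?N) (opair (app ?g x) (app ?g y))) \<and>
    (\<forall>r\<in>carrier R0. \<forall>x\<in>elems (mkset (carrier ?M)).
       app ?g (app (smult_graph ?M) (opair r x)) = app (smult_graph ?N) (opair r (app ?g x)))" (is ?P)
    unfolding m(4) n(4) R0_simps(1)
    using mod_homD[OF a(4)] by (simp add: a m n M.smult_closed)
  moreover have "?P \<longleftrightarrow> (\<forall>x\<in>elems (star (mkset (carrier ?M))). app (star ?g) x \<in> elems (star (mkset (carrier ?N)))) \<and>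
    (\<forall>x\<in>elems (star (mkset (carrier ?M))). \<forall>y\<in>elems (star (mkset (carrier ?M))).
       app (star ?g) (app (star (add_graph ?M)) (opair x y)) =
       app (star (add_graph ?N)) (opair (app (star ?g) x) (app (star ?g) y))) \<and>
    (\<forall>r\<in>carrier R'. \<forall>x\<in>elems (star (mkset (carrier ?M))).
       app (star ?g) (app (star (smult_graph ?M)) (opair r x)) =
       app (star (smult_graph ?N)) (opair r (app (star ?g) x)))"
    by (rule transferI) (intro star_intros a m n)
  ultimately show ?thesis
    unfolding mod_hom_def by (auto simp: star_module_ops)
qed

abbreviation SM :: "(('u, 'u) module, ('u, 'u) mod_arrow, ('u, 'u) module, ('u, 'u) mod_arrow) functor_map"
  where "SM \<equiv> star_module_functor star R"

lemma SM_simps [simp]: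
  "fob SM N = star_module star R N"
  "msrc (far SM f) = star_module star R (msrc f)" "mtgt (far SM f) = star_module star R (mtgt f)"
  "mmap (far SM f) = restrict (app (star (graph1 (mmap f) (carrier (msrc f)))))
     (elems (star (mkset (carrier (msrc f)))))"
  by (simp_all add: star_module_functor_def)

lemma SM_mor:
  assumes f: "f \<in> arr (LModS S R)"
  shows "far SM f \<in> mor (LMod R') (star_module star R (msrc f)) (star_module star R (mtgt f))"
  using LMod_arr_restrict[OF star_module_modules star_module_modules star_arrow_hom[OF f]] LModS_arr[OF f]
  by (simp add: star_module_functor_def)

lemma LModS_simps:
  "src (LModS S R) = msrc" "tgt (LModS S R) = mtgt" "idt (LModS S R) = idt (LMod R)"
  "cmp (LModS S R) = cmp (LMod R)"
  by (simp_all add: LModS_def full_subcategory_def)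

lemma LModS_category: "category (LModS S R)"
  unfolding LModS_def by (rule full_subcategory_category[OF LMod_category])

lemma SM_functor: "is_functor (LModS S R) (LMod R') SM"
  unfolding is_functor_def
proof (intro conjI ballI impI LModS_category LMod_category)
  interpret LS: category "LModS S R" by (rule LModS_category)
  {
    fix N assume N: "N \<in> obj (LModS S R)"
    show "fob SM N \<in> obj (LMod R')" using star_module_modules[OF N] by simp
    let ?i = "idt (LModS S R) N"
    have i: "?i \<in> arr (LModS S R)" "msrc ?i = N" using LS.idt_mor[OF N] by (auto simp: mor_def LModS_simps)
    note a = LModS_arr[OF i(1), unfolded i(2)] and n = LModS_obj[OF N]
    let ?g = "graph1 (mmap ?i) (carrier N)"
    have "(\<forall>x\<in>elems (mkset (carrier N)). app ?g x = x) \<longleftrightarrow> (\<forall>x\<in>elems (star (mkset (carrier N))). app (star ?g) x = x)"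
      by (rule transferI) (intro star_intros a n)
    moreover have "\<forall>x\<in>elems (mkset (carrier N)). app ?g x = x"
      unfolding n(4) using a(6) by (simp add: LModS_simps)
    ultimately show "far SM ?i = idt (LMod R') (fob SM N)"
      by (intro mod_arrow.equality) (auto simp: LModS_simps fun_eq_iff restrict_def)
  next
    fix f assume f: "f \<in> arr (LModS S R)"
    show "far SM f \<in> mor (LMod R') (fob SM (src (LModS S R) f)) (fob SM (tgt (LModS S R) f))"
      using SM_mor[OF f] by (simp add: LModS_simps)
    fix g assume g: "g \<in> arr (LModS S R)" and "src (LModS S R) g = tgt (LModS S R) f"
    then have gf: "msrc g = mtgt f" by (simp add: LModS_simps)
    let ?h = "cmp (LModS S R) g f"
    have h: "?h \<in> arr (LModS S R)" "msrc ?h = msrc f"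
      using LS.cmp_mor[OF LS.arr_mor[OF f], of g "mtgt g"] g gf by (auto simp: mor_def LModS_simps)
    note fa = LModS_arr[OF f] and ga = LModS_arr[OF g, unfolded gf] and ha = LModS_arr[OF h(1), unfolded h(2)]
    note m = LModS_obj[OF fa(2)]
    let ?F = "graph1 (mmap f) (carrier (msrc f))" and ?G = "graph1 (mmap g) (carrier (mtgt f))"
      and ?H = "graph1 (mmap ?h) (carrier (msrc f))"
    have "(\<forall>x\<in>elems (mkset (carrier (msrc f))). app ?H x = app ?G (app ?F x)) \<longleftrightarrow>
      (\<forall>x\<in>elems (star (mkset (carrier (msrc f)))). app (star ?H) x = app (star ?G) (app (star ?F) x))"
      by (rule transferI) (intro star_intros fa ga ha m)
    moreover have "\<forall>x\<in>elems (mkset (carrier (msrc f))). app ?H x = app ?G (app ?F x)"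
      unfolding m(4) using ha(6) ga(6) fa(6) mod_homD(1)[OF fa(4)]
      by (simp add: LModS_simps compose_def)
    ultimately have *: "\<forall>x\<in>elems (star (mkset (carrier (msrc f)))). app (star ?H) x = app (star ?G) (app (star ?F) x)"
      by blast
    have "app (star ?F) x \<in> elems (star (mkset (carrier (mtgt f))))" if "x \<in> elems (star (mkset (carrier (msrc f))))" for x
      using mod_homD(1)[OF star_arrow_hom[OF f]] that by simp
    with * show "far SM ?h = cmp (LMod R') (far SM g) (far SM f)"
      by (intro mod_arrow.equality)
        (auto simp: LModS_simps fun_eq_iff restrict_def compose_def gf)
  }
qed

end

section \<open>The functor represented by the image of the generator\<close>

text \<open>
  Being a projective generator, the linearity of composition, and the module axioms for all objects
  at once are bounded statements about \<open>A\<close>, so each of them passes to the enlargement.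
\<close>

locale enlarged_embedding = enlarged_category S star A + enlarged_ring S star R +
  module_embedding A R F \<RR> \<psi>
  for S :: "'u::set_universe" and star and A :: "'u small_cat" and R :: "'u ring"
    and F :: "('u, 'u, ('u, 'v) module, ('u, 'v) mod_arrow) functor_map"
    and \<RR> :: 'u and \<psi> :: "'v \<Rightarrow> 'u"
begin

lemma X_subset: "X a \<subseteq> M"
  by (auto simp: mor_def cat_of_simps)

lemma X_bounded: "bounded_in S (X a)"
  by (rule bounded_subset[OF base M_bounded X_subset])

lemma Gm_LModS: "a \<in> obj C \<Longrightarrow> Gm a \<in> obj (LModS S R)"
  using Gm_module X_bounded set_in_superstructure_iff[OF base]
  by (simp add: LModS_def full_subcategory_def Gm_simps(1))

lemma obj_bounded: "bounded_in S (obj C)"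
  by (rule bounded_subset[OF base M_bounded]) (auto simp: cat_of_simps src_tgt_closed)

lemma RR_V [star_intros]: "\<RR> \<in> V"
  by (rule obj_V[OF RR_obj])

abbreviation add_fam :: 'u where "add_fam \<equiv> add_family A Gm"
abbreviation smult_fam :: 'u where "smult_fam \<equiv> smult_family A R Gm"

lemma add_fam: "add_fam \<in> V" "a \<in> obj C \<Longrightarrow> app add_fam a = add_graph (Gm a)"
proof -
  let ?Z = "{opair p z | p z. p \<in> {opair x y | x y. x \<in> M \<and> y \<in> M} \<and> z \<in> M}"
  have Z: "bounded_in S ?Z" by (intro bounded_Times[OF base] M_bounded)
  have "x \<oplus>\<^bsub>Gm a\<^esub> y \<in> M" "x \<in> M" "y \<in> M" if "a \<in> obj C" "x \<in> X a" "y \<in> X a" for a x y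
    using iso_A.padd_mor[OF that(2,3)] Gm_simps(2)[OF that] that(2,3) X_subset by auto
  then have b: "bounded_in S ((\<lambda>a. add_graph (Gm a)) ` obj C)"
    unfolding graph2_def
    by (intro bounded_mkset_image[OF base Z]) (auto simp: Gm_simps(1))
  show "add_fam \<in> V" "a \<in> obj C \<Longrightarrow> app add_fam a = add_graph (Gm a)"
    unfolding add_family_def using graph1_superstructure[OF base obj_bounded b] by auto
qed

lemma smult_fam: "smult_fam \<in> V" "a \<in> obj C \<Longrightarrow> app smult_fam a = smult_graph (Gm a)"
proof -
  let ?Z = "{opair p z | p z. p \<in> {opair x y | x y. x \<in> carrier R \<and> y \<in> M} \<and> z \<in> M}"
  have Z: "bounded_in S ?Z" by (intro bounded_Times[OF base] M_bounded R_bounded)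
  have "r \<odot>\<^bsub>Gm a\<^esub> x \<in> M" "x \<in> M" if "a \<in> obj C" "r \<in> carrier R" "x \<in> X a" for a r x
    using Gm_simps(3)[OF that] that(3) X_subset by blast+
  then have b: "bounded_in S ((\<lambda>a. smult_graph (Gm a)) ` obj C)"
    unfolding graph2_def
    by (intro bounded_mkset_image[OF base Z]) (auto simp: Gm_simps(1))
  show "smult_fam \<in> V" "a \<in> obj C \<Longrightarrow> app smult_fam a = smult_graph (Gm a)"
    unfolding smult_family_def using graph1_superstructure[OF base obj_bounded b] by auto
qed

lemmas fam_V [star_intros] = add_fam(1) smult_fam(1)

lemma fam_app:
  "a \<in> obj C \<Longrightarrow> x \<in> X a \<Longrightarrow> y \<in> X a \<Longrightarrow> app (app add_fam a) (opair x y) = padd C x y"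
  "a \<in> obj C \<Longrightarrow> r \<in> carrier R \<Longrightarrow> x \<in> X a \<Longrightarrow> app (app smult_fam a) (opair r x) = r \<odot>\<^bsub>Gm a\<^esub> x"
  using LModS_obj(7,8)[OF Gm_LModS] by (simp_all add: add_fam(2) smult_fam(2) Gm_simps(1,2))

abbreviation C' :: "('u, 'u) lin_category" where "C' \<equiv> cat_of A'"
abbreviation X' :: "'u \<Rightarrow> 'u set" where "X' \<equiv> mor C' (star \<RR>)"
abbreviation Gt :: "'u \<Rightarrow> ('u, 'u) module" where "Gt \<equiv> Gtilde_module star A R F \<RR> \<psi>"

lemma star_RR: "star \<RR> \<in> obj C'"
  by (rule star_obj[OF RR_obj])

lemma star_module_ops_fam:
  assumes "a \<in> obj C'"
  shows "module_ops R' (X' a) (\<lambda>f g. app (app (star add_fam) a) (opair f g))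
    (\<lambda>r f. app (app (star smult_fam) a) (opair r f))"
proof -
  have "(\<forall>a\<in>obj (cat_app A). module_ops R0 (mor (cat_app A) \<RR> a) (\<lambda>f g. app (app add_fam a) (opair f g))
      (\<lambda>r f. app (app smult_fam a) (opair r f))) \<longleftrightarrow>
    (\<forall>a\<in>obj (cat_app A'). module_ops R' (mor (cat_app A') (star \<RR>) a)
      (\<lambda>f g. app (app (star add_fam) a) (opair f g)) (\<lambda>r f. app (app (star smult_fam) a) (opair r f)))"
    unfolding module_ops_def abgrp_def by (rule transferI) (intro star_intros)
  moreover have "module_ops R0 (mor (cat_app A) \<RR> a) (\<lambda>f g. app (app add_fam a) (opair f g))
      (\<lambda>r f. app (app smult_fam a) (opair r f))" if "a \<in> obj (cat_app A)" for a
  proof -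
    have a: "a \<in> obj C" using that by (simp add: cat_app_simps)
    show ?thesis
      unfolding mor_cat_app
      by (rule app_module_ops[OF modulesD(5)[OF Gm_module[OF a], unfolded Gm_simps(1)[OF a]]])
        (use a in \<open>simp_all add: fam_app Gm_simps\<close>)
  qed
  ultimately show ?thesis using assms by (simp add: cat_app_simps mor_cat_app)
qed

lemma star_fam_padd:
  assumes "a \<in> obj C'" "x \<in> X' a" "y \<in> X' a"
  shows "app (app (star add_fam) a) (opair x y) = padd C' x y"
proof -
  have "(\<forall>a\<in>obj (cat_app A). \<forall>x\<in>mor (cat_app A) \<RR> a. \<forall>y\<in>mor (cat_app A) \<RR> a.
      app (app add_fam a) (opair x y) = padd (cat_app A) x y) \<longleftrightarrow>
    (\<forall>a\<in>obj (cat_app A'). \<forall>x\<in>mor (cat_app A') (star \<RR>) a. \<forall>y\<in>mor (cat_app A') (star \<RR>) a.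
      app (app (star add_fam) a) (opair x y) = padd (cat_app A') x y)"
    by (rule transferI) (intro star_intros)
  moreover have "\<forall>a\<in>obj (cat_app A). \<forall>x\<in>mor (cat_app A) \<RR> a. \<forall>y\<in>mor (cat_app A) \<RR> a.
      app (app add_fam a) (opair x y) = padd (cat_app A) x y"
    unfolding mor_cat_app cat_app_simps(1) by (simp add: fam_app padd_app)
  ultimately have "app (app (star add_fam) a) (opair x y) = padd (cat_app A') x y"
    using assms by (simp add: cat_app_simps(1) mor_cat_app)
  then show ?thesis using padd_app' assms by simp
qed

lemma star_fam_smult:
  assumes "h \<in> arr C'" "r \<in> carrier R'" "x \<in> X' (src C' h)"
  shows "cmp C' h (app (app (star smult_fam) (src C' h)) (opair r x)) =
    app (app (star smult_fam) (tgt C' h)) (opair r (cmp C' h x))"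
proof -
  have "(\<forall>h\<in>arr (cat_app A). \<forall>r\<in>carrier R0. \<forall>x\<in>mor (cat_app A) \<RR> (src (cat_app A) h).
      cmp (cat_app A) h (app (app smult_fam (src (cat_app A) h)) (opair r x)) =
      app (app smult_fam (tgt (cat_app A) h)) (opair r (cmp (cat_app A) h x))) \<longleftrightarrow>
    (\<forall>h\<in>arr (cat_app A'). \<forall>r\<in>carrier R'. \<forall>x\<in>mor (cat_app A') (star \<RR>) (src (cat_app A') h).
      cmp (cat_app A') h (app (app (star smult_fam) (src (cat_app A') h)) (opair r x)) =
      app (app (star smult_fam) (tgt (cat_app A') h)) (opair r (cmp (cat_app A') h x)))"
    by (rule transferI) (intro star_intros)
  moreover have "cmp (cat_app A) h (app (app smult_fam (src C h)) (opair r x)) =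
      app (app smult_fam (tgt C h)) (opair r (cmp (cat_app A) h x))"
    if "h \<in> arr C" "r \<in> carrier R" "x \<in> X (src C h)" for h r x
  proof -
    note o = iso_A.src_obj[OF that(1)] iso_A.tgt_obj[OF that(1)] and hm = iso_A.arr_mor[OF that(1)]
    show ?thesis
      using G.mdl_smult[OF that] Gm_simps(3)[OF o(1) that(2,3)] iso_A.cmp_mor[OF that(3) hm]
      by (simp add: fam_app(2)[OF o(1) that(2,3)] fam_app(2)[OF o(2) that(2)] cmp_app[OF _ hm] cmp_app[OF that(3) hm])
  qed
  ultimately have e: "cmp (cat_app A') h (app (app (star smult_fam) (src C' h)) (opair r x)) =
      app (app (star smult_fam) (tgt C' h)) (opair r (cmp (cat_app A') h x))"
    using assms by (simp add: cat_app_simps(1-5) mor_cat_app R0_simps(1))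
  have hm: "h \<in> mor C' (src C' h) (tgt C' h)" using assms(1) by (simp add: mor_def)
  have o: "src C' h \<in> obj C'" using iso_A'.src_obj assms(1) by (simp add: cat_app_simps)
  have "app (app (star smult_fam) (src C' h)) (opair r x) \<in> X' (src C' h)"
    using star_module_ops_fam[OF o] assms by (simp add: module_ops_def)
  then show ?thesis using e cmp_app'[OF _ hm] assms(3) by simp
qed

lemma star_generator:
  assumes "f \<in> mor C' a b" "g \<in> mor C' a b" "\<And>x. x \<in> X' a \<Longrightarrow> cmp C' f x = cmp C' g x"
  shows "f = g"
proof -
  have "(\<forall>f\<in>arr (cat_app A). \<forall>g\<in>mor (cat_app A) (src (cat_app A) f) (tgt (cat_app A) f).
      (\<forall>x\<in>mor (cat_app A) \<RR> (src (cat_app A) f). cmp (cat_app A) f x = cmp (cat_app A) g x) \<longrightarrow> f = g) \<longleftrightarrow>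
    (\<forall>f\<in>arr (cat_app A'). \<forall>g\<in>mor (cat_app A') (src (cat_app A') f) (tgt (cat_app A') f).
      (\<forall>x\<in>mor (cat_app A') (star \<RR>) (src (cat_app A') f). cmp (cat_app A') f x = cmp (cat_app A') g x) \<longrightarrow> f = g)"
    by (rule transferI) (intro star_intros)
  moreover have "f = g" if "f \<in> arr C" "g \<in> mor C (src C f) (tgt C f)"
    "\<forall>x\<in>X (src C f). cmp (cat_app A) f x = cmp (cat_app A) g x" for f g
    by (rule RR_generator[OF iso_A.arr_mor[OF that(1)] that(2)])
      (use that(3) cmp_app[OF _ iso_A.arr_mor[OF that(1)]] cmp_app[OF _ that(2)] in simp)
  ultimately have "\<forall>f\<in>arr C'. \<forall>g\<in>mor C' (src C' f) (tgt C' f).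
      (\<forall>x\<in>X' (src C' f). cmp (cat_app A') f x = cmp (cat_app A') g x) \<longrightarrow> f = g"
    by (simp add: cat_app_simps(1-5) mor_cat_app)
  moreover have "f \<in> arr C'" "src C' f = a" "tgt C' f = b" using assms(1) by (auto simp: mor_def)
  moreover have "\<forall>x\<in>X' a. cmp (cat_app A') f x = cmp (cat_app A') g x"
    using assms(3) cmp_app'[OF _ assms(1)] cmp_app'[OF _ assms(2)] by simp
  ultimately show ?thesis using assms(2) by blast
qed

lemma star_projective:
  assumes "epic C' f" "x \<in> X' (tgt C' f)"
  shows "\<exists>y\<in>X' (src C' f). cmp C' f y = x"
proof -
  have "(\<forall>f\<in>arr (cat_app A). epic (cat_app A) f \<longrightarrow> (\<forall>x\<in>mor (cat_app A) \<RR> (tgt (cat_app A) f).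
      \<exists>y\<in>mor (cat_app A) \<RR> (src (cat_app A) f). cmp (cat_app A) f y = x)) \<longleftrightarrow>
    (\<forall>f\<in>arr (cat_app A'). epic (cat_app A') f \<longrightarrow> (\<forall>x\<in>mor (cat_app A') (star \<RR>) (tgt (cat_app A') f).
      \<exists>y\<in>mor (cat_app A') (star \<RR>) (src (cat_app A') f). cmp (cat_app A') f y = x))"
    by (rule transferI) (intro star_intros)
  moreover have "\<exists>y\<in>X (src C f). cmp (cat_app A) f y = x"
    if "f \<in> arr C" "epic (cat_app A) f" "x \<in> X (tgt C f)" for f x
  proof -
    have "epic C f" using that(2) iso_A.epic_D[OF that(1)] by simp
    then show ?thesis using RR_projective[OF _ that(3)] cmp_app[OF _ iso_A.arr_mor[OF that(1)]] by auto
  qed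
  ultimately have *: "\<forall>f\<in>arr C'. epic (cat_app A') f \<longrightarrow> (\<forall>x\<in>X' (tgt C' f).
      \<exists>y\<in>X' (src C' f). cmp (cat_app A') f y = x)"
    by (simp add: cat_app_simps(1-5) mor_cat_app)
  have f: "f \<in> arr C'" using assms(1) by (simp add: epic_def)
  then have "epic (cat_app A') f" using iso_A'.epic_D[of f] assms(1) by (simp add: cat_app_simps)
  then obtain y where "y \<in> X' (src C' f)" "cmp (cat_app A') f y = x" using * f assms(2) by blast
  then show ?thesis using cmp_app'[of y _ _ f "tgt C' f"] f by (auto simp: mor_def)
qed

lemma Gt_simps:
  "carrier (Gt a) = X' a"
  "x \<in> X' a \<Longrightarrow> y \<in> X' a \<Longrightarrow> x \<oplus>\<^bsub>Gt a\<^esub> y = app (app (star add_fam) a) (opair x y)"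
  "r \<in> carrier R' \<Longrightarrow> x \<in> X' a \<Longrightarrow> r \<odot>\<^bsub>Gt a\<^esub> x = app (app (star smult_fam) a) (opair r x)"
  by (simp_all add: Gtilde_module_def)

sublocale C': abelian_category C' by (rule abelian_cat_of_star)

sublocale Gt: represented_modules C' R' "star \<RR>" Gt
proof unfold_locales
  show "star \<RR> \<in> obj C'" by (rule star_RR)
  show "a \<in> obj C' \<Longrightarrow> Gt a \<in> modules R'" for a
    unfolding Gtilde_module_def by (rule mk_module_in_modules[OF ring_R' star_module_ops_fam])
  show "a \<in> obj C' \<Longrightarrow> carrier (Gt a) = X' a" for a by (rule Gt_simps)
  show "a \<in> obj C' \<Longrightarrow> f \<in> X' a \<Longrightarrow> g \<in> X' a \<Longrightarrow> f \<oplus>\<^bsub>Gt a\<^esub> g = padd C' f g" for a f g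
    by (simp add: Gt_simps star_fam_padd)
  show "h \<in> arr C' \<Longrightarrow> r \<in> carrier R' \<Longrightarrow> x \<in> X' (src C' h) \<Longrightarrow>
      cmp C' h (r \<odot>\<^bsub>Gt (src C' h)\<^esub> x) = r \<odot>\<^bsub>Gt (tgt C' h)\<^esub> cmp C' h x" for h r x
    using C'.cmp_mor[OF _ C'.arr_mor, of x "star \<RR>" h] by (simp add: Gt_simps star_fam_smult)
  show "f \<in> mor C' a b \<Longrightarrow> g \<in> mor C' a b \<Longrightarrow> (\<And>x. x \<in> X' a \<Longrightarrow> cmp C' f x = cmp C' g x) \<Longrightarrow> f = g" for f g a b
    by (rule star_generator)
  show "epic C' f \<Longrightarrow> x \<in> X' (tgt C' f) \<Longrightarrow> \<exists>y\<in>X' (src C' f). cmp C' f y = x" for f x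
    by (rule star_projective)
qed

lemma Gtilde_functor_eq: "Gtilde_functor star A R F \<RR> \<psi> = Gt.H"
  by (simp add: Gtilde_functor_def)

text \<open>
  Both sides have the operations given by the value of the enlarged family at \<open>star a\<close>: this value
  is the image of the value of the family at \<open>a\<close>.
\<close>

lemma star_Gm:
  assumes a: "a \<in> obj C" shows "star_module star R (Gm a) = Gt (star a)"
  unfolding star_module_def Gtilde_module_def
proof (rule mk_module_cong)
  note g = LModS_obj[OF Gm_LModS[OF a]]
  have "(\<forall>x\<in>elems (mkset (carrier (Gm a))). x \<in> mor (cat_app A) \<RR> a) \<and>
      (\<forall>x\<in>mor (cat_app A) \<RR> a. x \<in> elems (mkset (carrier (Gm a)))) \<longleftrightarrow>
    (\<forall>x\<in>elems (star (mkset (carrier (Gm a)))). x \<in> mor (cat_app A') (star \<RR>) (star a)) \<and>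
      (\<forall>x\<in>mor (cat_app A') (star \<RR>) (star a). x \<in> elems (star (mkset (carrier (Gm a)))))"
    by (rule transferI) (intro star_intros g obj_V[OF a])
  then show "elems (star (mkset (carrier (Gm a)))) = X' (star a)"
    unfolding g(4) mor_cat_app using Gm_simps(1)[OF a] by blast
  have "star (add_graph (Gm a)) = app (star add_fam) (star a)"
    using star_app[OF add_fam(1) obj_V[OF a]] g(5) by (simp add: add_fam(2)[OF a])
  then show "app (star (add_graph (Gm a))) (opair x y) = app (app (star add_fam) (star a)) (opair x y)" for x y
    by simp
  have "star (smult_graph (Gm a)) = app (star smult_fam) (star a)"
    using star_app[OF smult_fam(1) obj_V[OF a]] g(6) by (simp add: smult_fam(2)[OF a])
  then show "app (star (smult_graph (Gm a))) (opair r x) = app (app (star smult_fam) (star a)) (opair r x)" for r x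
    by simp
qed

lemma G_functor_LModS: "is_functor C (LModS S R) G.H"
  by (rule G_LModS) (simp add: set_in_superstructure_iff[OF base] X_bounded)

lemma star_G_arr:
  assumes h: "h \<in> arr C" shows "far SM (far G.H h) = far Gt.H (star h)"
proof (rule mod_arrow.equality)
  let ?a = "src C h" and ?b = "tgt C h"
  have a: "?a \<in> obj C" and b: "?b \<in> obj C" using h by (simp_all add: iso_A.src_obj iso_A.tgt_obj)
  have Gh: "far G.H h \<in> arr (LModS S R)" using G_functor_LModS h by (auto simp: is_functor_def mor_def)
  note g = LModS_obj[OF Gm_LModS[OF a]] and k = LModS_arr[OF Gh, simplified]
  show "msrc (far SM (far G.H h)) = msrc (far Gt.H (star h))"
    "mtgt (far SM (far G.H h)) = mtgt (far Gt.H (star h))"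
    using star_Gm a b star_arr[OF h] by simp_all
  let ?g = "graph1 (restrict (cmp C h) (X ?a)) (carrier (Gm ?a))"
  have "(\<forall>x\<in>elems (mkset (carrier (Gm ?a))). app ?g x = cmp (cat_app A) h x) \<longleftrightarrow>
    (\<forall>x\<in>elems (star (mkset (carrier (Gm ?a)))). app (star ?g) x = cmp (cat_app A') (star h) x)"
    by (rule transferI) (intro star_intros g k arr_V[OF h])
  moreover have "\<forall>x\<in>elems (mkset (carrier (Gm ?a))). app ?g x = cmp (cat_app A) h x"
    unfolding g(4) using k(6) cmp_app[OF _ iso_A.arr_mor[OF h]] by (simp add: Gm_simps(1)[OF a])
  ultimately have *: "\<forall>x\<in>elems (star (mkset (carrier (Gm ?a)))). app (star ?g) x = cmp (cat_app A') (star h) x"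
    by blast
  have c: "elems (star (mkset (carrier (Gm ?a)))) = X' (star ?a)"
    using arg_cong[OF star_Gm[OF a], of carrier] by (simp add: Gt_simps(1))
  have hm: "star h \<in> mor C' (star ?a) (star ?b)" using star_arr[OF h] by (simp add: mor_def)
  show "mmap (far SM (far G.H h)) = mmap (far Gt.H (star h))"
    using * cmp_app'[OF _ hm] star_arr[OF h] by (auto simp: c fun_eq_iff restrict_def)
qed simp

lemma star_G_equal:
  "functors_equal C (LMod R') (functor_comp SM G.H) (functor_comp Gt.H (star_cat_functor star))"
  unfolding functors_equal_def
  using is_functor_comp[OF G_functor_LModS SM_functor] is_functor_comp[OF star_functor Gt.H_functor]
    star_Gm star_G_arr
  by (simp add: functor_comp_def star_cat_functor_def)

lemma star_of_identified:
  assumes "N \<in> obj (image_category C (LMod R) G.H)"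
  shows "fob Gt.H (star (inv_into (obj C) (fob G.H) N)) = star_module star R N"
proof -
  obtain a where a: "a \<in> obj C" "N = Gm a" using assms by (auto simp: image_category_def)
  have "inv_into (obj C) Gm N = a" unfolding a(2) by (rule inv_into_f_f[OF G.mdl_inj a(1)])
  then show ?thesis using star_Gm[OF a(1)] a(2) by simp
qed

end

theorem proposition4p7:
  fixes S :: "'u::set_universe"
    and star :: "'u \<Rightarrow> 'u"
    and R :: "'u ring"
    and A :: "'u small_cat"
    and F :: "('u, 'u, ('u, 'v) module, ('u, 'v) mod_arrow) functor_map"
    and \<RR> :: 'u
    and \<psi> :: "'v \<Rightarrow> 'u"
  defines "G \<equiv> G_functor A R F \<RR> \<psi>"
    and "Gt \<equiv> Gtilde_functor star A R F \<RR> \<psi>"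
  assumes "enlargement S (star S) star"
    and "ring R" and "set_in_superstructure S (carrier R)"
    and "abelian_small_category S A"
    and "exact_functor (cat_of A) (LMod R) F"
    and "full_functor (cat_of A) (LMod R) F" and "faithful_functor (cat_of A) (LMod R) F"
    and "\<RR> \<in> obj (cat_of A)"
    and "\<psi> \<in> mod_iso R (fob F \<RR>) (regular_module R)"
  shows
    "(mod_nat_iso R (cat_of A) G F (\<lambda>a. transport R F \<RR> \<psi>)
      \<and> exact_functor (cat_of A) (LMod R) G
      \<and> full_functor (cat_of A) (LMod R) G \<and> faithful_functor (cat_of A) (LMod R) G
      \<and> is_functor (cat_of A) (LModS S R) G)
     \<and>
     (exact_functor (cat_of (star_cat star A)) (LMod (star_ring star R)) Gt
      \<and> faithful_functor (cat_of (star_cat star A)) (LMod (star_ring star R)) Gt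
      \<and> is_functor (LModS S R) (LMod (star_ring star R)) (star_module_functor star R)
      \<and> functors_equal (cat_of A) (LMod (star_ring star R))
          (functor_comp (star_module_functor star R) G)
          (functor_comp Gt (star_cat_functor star))
      \<and> identifies_with_abelian_subcategory (cat_of A) (LMod R) G
      \<and> identifies_with_abelian_subcategory (cat_of (star_cat star A)) (LMod (star_ring star R)) Gt
      \<and> (\<forall>M\<in>obj (image_category (cat_of A) (LMod R) G).
            fob Gt (star (inv_into (obj (cat_of A)) (fob G) M)) = star_module star R M))
     \<and>
     serre_subcategory (fin_subcategory (cat_of (star_cat star A)) Gt) (cat_of (star_cat star A))"
proof -
  interpret E: enlarged_embedding S star A R F \<RR> \<psi>
    using assms(3-)
    by (intro enlarged_embedding.intro enlarged_category.intro enlarged_ring.intro enlarged.intro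
        enlarged_category_axioms.intro enlarged_ring_axioms.intro module_embedding.intro)
      (simp_all add: abelian_small_category_def)
  show ?thesis
    unfolding G_def Gt_def E.G_functor_eq E.Gtilde_functor_eq
    using E.G_nat_iso E.G.H_exact E.G_full E.G.H_faithful E.G_functor_LModS E.Gt.H_exact
      E.Gt.H_faithful E.SM_functor E.star_G_equal E.G.H_identifies E.Gt.H_identifies
      E.star_of_identified E.Gt.H_serre
    by (intro conjI ballI)
qed

end
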